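(* Let $R$ be an integral domain with quotient field $K$, $R\neq K$. The following conditions are equivalent: (1) $R$ has $t$-dimension one and each $t$-linked overring of $R$ is $w$-divisorial; (2) $R$ is a Mori domain and each $t$-linked overring of $R$ is $w$-divisorial; (3) $R$ is a Mori domain and $R_M$ is totally divisorial for each $M\in t\text{-Max}(R)$; (4) each nonzero ideal of $R$ is a two $w$-generated $w$-divisorial ideal; (5) each nonzero ideal of $R$ is two $w$-generated.
   Context: For a domain $D$ with quotient field $K\neq D$ and fractional ideals $I,J$, put $(J:I)=\{x\in K: xI\subseteq J\}$. For a nonzero fractional ideal $I$ of $D$: $I_v=(D:(D:I))$; $I_t=\bigcup J_v$, the union over nonzero finitely generated fractional ideals $J\subseteq I$. $I$ is divisorial if $I=I_v$, a $t$-ideal if $I=I_t$. A $t$-prime is a nonzero prime ideal that is a $t$-ideal; a $t$-maximal ideal is an ideal maximal among the proper integral $t$-ideals (it is prime); $t\text{-Max}(D)$ is the set of these. $I_w=\bigcap_{M\in t\text{-Max}(D)}ID_M$, and $I$ is a $w$-ideal if $I=I_w$. $D$ has $t$-dimension one if each $t$-prime ideal has height one. $D$ is Mori if it satisfies the ascending chain condition on proper divisorial ideals. $D$ is divisorial if every nonzero ideal is divisorial; $w$-divisorial if every $w$-ideal is divisorial. A field is regarded as (trivially) divisorial and $w$-divisorial. An overring of $D$ is a ring between $D$ and its quotient field; $D$ is totally divisorial if all its overrings are divisorial. An overring $T$ of $R$ is $t$-linked over $R$ if for each nonzero finitely generated ideal $J$ of $R$ with $(R:J)=R$ one has $(T:JT)=T$.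 A nonzero fractional ideal $I$ of $R$ is a $w$-divisorial ideal if $I_v=I_w$, and is two $w$-generated if $I_w=(aR+bR)_w$ for some $a,b\in K$. *)

theory Defs
  imports Main "HOL-Library.Extended_Nat"
begin

text \<open>
  The quotient field is the type \<open>'a :: field\<close>; an integral domain with this quotient field is a
  subring \<open>D\<close> of \<open>'a\<close> such that every element of \<open>'a\<close> is a fraction over \<open>D\<close>. Overrings,
  localizations and fractional ideals of \<open>D\<close> are then all subsets of \<open>'a\<close>.
\<close>

definition is_subring :: "'a::field set \<Rightarrow> bool" where
  "is_subring D \<longleftrightarrow> 1 \<in> D \<and> (\<forall>x\<in>D. \<forall>y\<in>D. x - y \<in> D \<and> x * y \<in> D)"

definition fractions :: "'a::field set \<Rightarrow> 'a set" where
  "fractions D = {a / b | a b. a \<in> D \<and> b \<in> D \<and> b \<noteq> 0}"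

definition domain_with_quotient_field_UNIV :: "'a::field set \<Rightarrow> bool" where
  "domain_with_quotient_field_UNIV D \<longleftrightarrow> is_subring D \<and> fractions D = UNIV"

definition overring :: "'a::field set \<Rightarrow> 'a set \<Rightarrow> bool" where
  "overring D T \<longleftrightarrow> is_subring T \<and> D \<subseteq> T"


subsection \<open>Ideals and fractional ideals\<close>

definition submodule_of :: "'a::field set \<Rightarrow> 'a set \<Rightarrow> bool" where
  "submodule_of D I \<longleftrightarrow>
     0 \<in> I \<and> (\<forall>x\<in>I. \<forall>y\<in>I. x + y \<in> I) \<and> (\<forall>r\<in>D. \<forall>x\<in>I. r * x \<in> I)"

definition ideal_of :: "'a::field set \<Rightarrow> 'a set \<Rightarrow> bool" where
  "ideal_of D I \<longleftrightarrow> submodule_of D I \<and> I \<subseteq> D"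

definition nz_ideal :: "'a::field set \<Rightarrow> 'a set \<Rightarrow> bool" where
  "nz_ideal D I \<longleftrightarrow> ideal_of D I \<and> I \<noteq> {0}"

definition nz_frac_ideal :: "'a::field set \<Rightarrow> 'a set \<Rightarrow> bool" where
  "nz_frac_ideal D I \<longleftrightarrow>
     submodule_of D I \<and> I \<noteq> {0} \<and> (\<exists>d\<in>D. d \<noteq> 0 \<and> (\<forall>x\<in>I. d * x \<in> D))"

text \<open>
  The \<open>D\<close>-submodule generated by a set. If \<open>T\<close> is an overring of \<open>D\<close> and \<open>I\<close> is a fractional
  ideal of \<open>D\<close>, then \<open>gen T I\<close> is the product \<open>IT\<close>.
\<close>

definition gen :: "'a::field set \<Rightarrow> 'a set \<Rightarrow> 'a set" where
  "gen D S = submodule_of D hull S"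

definition fin_gen :: "'a::field set \<Rightarrow> 'a set \<Rightarrow> bool" where
  "fin_gen D I \<longleftrightarrow> (\<exists>S. finite S \<and> I = gen D S)"

definition prime_ideal_of :: "'a::field set \<Rightarrow> 'a set \<Rightarrow> bool" where
  "prime_ideal_of D P \<longleftrightarrow>
     ideal_of D P \<and> P \<noteq> D \<and> (\<forall>x\<in>D. \<forall>y\<in>D. x * y \<in> P \<longrightarrow> x \<in> P \<or> y \<in> P)"

definition height :: "'a::field set \<Rightarrow> 'a set \<Rightarrow> enat" where
  "height D P = Sup {enat n | n. \<exists>Q :: nat \<Rightarrow> 'a set.
     Q n = P \<and> (\<forall>i\<le>n. prime_ideal_of D (Q i)) \<and> (\<forall>i<n. Q i \<subset> Q (Suc i))}"

definition localize :: "'a::field set \<Rightarrow> 'a set \<Rightarrow> 'a set" where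
  "localize D P = {a / s | a s. a \<in> D \<and> s \<in> D - P}"

definition colon :: "'a::field set \<Rightarrow> 'a set \<Rightarrow> 'a set" where
  "colon J I = {x. \<forall>y\<in>I. x * y \<in> J}"


subsection \<open>The \<open>v\<close>-, \<open>t\<close>- and \<open>w\<close>-operations\<close>

definition v_cl :: "'a::field set \<Rightarrow> 'a set \<Rightarrow> 'a set" where
  "v_cl D I = colon D (colon D I)"

definition t_cl :: "'a::field set \<Rightarrow> 'a set \<Rightarrow> 'a set" where
  "t_cl D I = \<Union> {v_cl D J | J. nz_frac_ideal D J \<and> fin_gen D J \<and> J \<subseteq> I}"

definition divisorial_ideal :: "'a::field set \<Rightarrow> 'a set \<Rightarrow> bool" where
  "divisorial_ideal D I \<longleftrightarrow> nz_frac_ideal D I \<and> I = v_cl D I"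

definition t_ideal :: "'a::field set \<Rightarrow> 'a set \<Rightarrow> bool" where
  "t_ideal D I \<longleftrightarrow> nz_frac_ideal D I \<and> I = t_cl D I"

definition t_prime :: "'a::field set \<Rightarrow> 'a set \<Rightarrow> bool" where
  "t_prime D P \<longleftrightarrow> prime_ideal_of D P \<and> P \<noteq> {0} \<and> t_ideal D P"

definition t_Max :: "'a::field set \<Rightarrow> 'a set set" where
  "t_Max D = {M. t_ideal D M \<and> M \<subset> D \<and> (\<forall>J. t_ideal D J \<and> J \<subset> D \<and> M \<subseteq> J \<longrightarrow> J = M)}"

definition w_cl :: "'a::field set \<Rightarrow> 'a set \<Rightarrow> 'a set" where
  "w_cl D I = (\<Inter>M\<in>t_Max D. gen (localize D M) I)"

definition w_ideal :: "'a::field set \<Rightarrow> 'a set \<Rightarrow> bool" where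
  "w_ideal D I \<longleftrightarrow> nz_frac_ideal D I \<and> I = w_cl D I"

definition w_divisorial_ideal :: "'a::field set \<Rightarrow> 'a set \<Rightarrow> bool" where
  "w_divisorial_ideal D I \<longleftrightarrow> nz_frac_ideal D I \<and> v_cl D I = w_cl D I"

definition two_w_generated :: "'a::field set \<Rightarrow> 'a set \<Rightarrow> bool" where
  "two_w_generated D I \<longleftrightarrow>
     nz_frac_ideal D I \<and> (\<exists>a b. w_cl D I = w_cl D {a * x + b * y | x y. x \<in> D \<and> y \<in> D})"


subsection \<open>Classes of domains\<close>

definition t_dimension_one :: "'a::field set \<Rightarrow> bool" where
  "t_dimension_one D \<longleftrightarrow> (\<forall>P. t_prime D P \<longrightarrow> height D P = 1)"

definition Mori :: "'a::field set \<Rightarrow> bool" where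
  "Mori D \<longleftrightarrow>
     (\<forall>I :: nat \<Rightarrow> 'a set.
        (\<forall>n. divisorial_ideal D (I n) \<and> I n \<subset> D \<and> I n \<subseteq> I (Suc n)) \<longrightarrow>
        (\<exists>N. \<forall>n\<ge>N. I n = I N))"

definition divisorial_domain :: "'a::field set \<Rightarrow> bool" where
  "divisorial_domain D \<longleftrightarrow> (\<forall>I. nz_ideal D I \<longrightarrow> divisorial_ideal D I)"

definition w_divisorial_domain :: "'a::field set \<Rightarrow> bool" where
  "w_divisorial_domain D \<longleftrightarrow> (\<forall>I. w_ideal D I \<longrightarrow> divisorial_ideal D I)"

definition totally_divisorial :: "'a::field set \<Rightarrow> bool" where
  "totally_divisorial D \<longleftrightarrow> (\<forall>T. overring D T \<longrightarrow> divisorial_domain T)"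

definition t_linked_overring :: "'a::field set \<Rightarrow> 'a set \<Rightarrow> bool" where
  "t_linked_overring R T \<longleftrightarrow> overring R T \<and>
     (\<forall>J. nz_ideal R J \<and> fin_gen R J \<and> colon R J = R \<longrightarrow> colon T (gen T J) = T)"

text \<open>
  The only overring that is a field is \<open>UNIV\<close>. The convention that a field is divisorial and
  \<open>w\<close>-divisorial is not built into the definitions because they already yield it.
\<close>

lemma nz_frac_ideal_UNIV: "nz_frac_ideal UNIV I \<longleftrightarrow> I = (UNIV :: 'a::field set)"
proof
  assume I: "nz_frac_ideal UNIV I"
  then obtain x where x: "x \<in> I" "x \<noteq> 0"
    by (auto simp: nz_frac_ideal_def submodule_of_def)
  have "y \<in> I" for y
  proof -
    have "(y / x) * x \<in> I"
      using I x(1) unfolding nz_frac_ideal_def submodule_of_def by blast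
    then show ?thesis using x(2) by simp
  qed
  then show "I = UNIV" by blast
next
  assume "I = UNIV"
  moreover have "(1::'a) \<noteq> 0" by simp
  ultimately show "nz_frac_ideal UNIV I"
    unfolding nz_frac_ideal_def submodule_of_def by blast
qed

lemma divisorial_domain_UNIV: "divisorial_domain (UNIV :: 'a::field set)"
  and w_divisorial_domain_UNIV: "w_divisorial_domain (UNIV :: 'a::field set)"
proof -
  have "divisorial_ideal UNIV (UNIV :: 'a set)"
    by (simp add: divisorial_ideal_def nz_frac_ideal_UNIV v_cl_def colon_def)
  moreover have "I = UNIV" if "nz_ideal UNIV I" for I :: "'a set"
  proof -
    have "nz_frac_ideal UNIV I"
      using that unfolding nz_ideal_def ideal_of_def nz_frac_ideal_def
      by (metis UNIV_I zero_neq_one)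
    then show ?thesis by (simp add: nz_frac_ideal_UNIV)
  qed
  ultimately show "divisorial_domain (UNIV :: 'a set)" "w_divisorial_domain (UNIV :: 'a set)"
    by (auto simp: divisorial_domain_def w_divisorial_domain_def w_ideal_def nz_frac_ideal_UNIV)
qed

end

theory Submission
  imports Defs
begin

text \<open>
  Everything is reduced to condition (5). Under each of (1), (2), (3) the ring \<open>R\<close> is w-divisorial,
  and every localization \<open>A = R\<^sub>M\<close> at a t-maximal ideal is one-dimensional and divisorial; if its
  maximal ideal \<open>m\<close> is not principal, then \<open>B = (A : m) = (m : m)\<close> is a divisorial ring of length two
  over \<open>m\<close>. Divisoriality of \<open>B\<close> makes \<open>m\<close> invertible and hence principal over \<open>B\<close>, say \<open>m = hB\<close>.
  Every nonprincipal ideal \<open>I\<close> of \<open>A\<close> is a \<open>B\<close>-module, so \<open>I / mI = I / hI\<close> has the same length as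
  \<open>B / hB\<close>, namely two, and \<open>I\<close> has two generators. A w-divisorial domain has finite t-character, and
  approximation at finitely many t-maximal ideals gives (5).

  Conversely (5) makes all ideals of every \<open>R\<^sub>M\<close> two-generated. A local ring with this property is
  one-dimensional, each of its fractional ideals is a multiple of a ring \<open>A + Ay\<close>, and such rings are
  reflexive, so it is divisorial. The property passes to overrings as in the theorem of Krull and
  Akizuki and to localizations of t-linked overrings, from which (1) to (4) follow.
\<close>

text \<open>On the way to (5) the ideals of \<open>R_M\<close> are not known to be finitely
  generated, so Nakayama's lemma does not apply to them. Its place is taken by dimension one in
  elementwise form: a power of each element of \<open>m\<close> lies in any given nonzero principal
  ideal, so iterating \<open>I = J + hI\<close> ends after finitely many rounds. Lengths of
  quotients are compared by explicit chains for the same reason.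

  From (5), the two-generator property enters mainly through a linear relation with a unit
  coefficient among any three elements of the field. For \<open>1\<close>, \<open>b\<close>,
  \<open>b^2\<close> it turns ideals into multiples of rings; for \<open>f^2\<close>,
  \<open>fs\<close>, \<open>s^2\<close> it excludes dimension two.

  A prescribed element can be matched at \<open>M\<close> only up to a factor outside
  \<open>M\<close>, which is enough to generate locally. Under (1) and (2) the ring
  \<open>(m : m)\<close> is at first only w-divisorial; it becomes divisorial once its nonzero
  primes are recognized as t-ideals.\<close>

abbreviation (input) qdom :: "'a::field set \<Rightarrow> bool" where
  "qdom \<equiv> domain_with_quotient_field_UNIV"

section \<open>Subrings, submodules and ideals inside a fixed field\<close>

lemma qdom_subring: "qdom D \<Longrightarrow> is_subring D"
  by (simp add: domain_with_quotient_field_UNIV_def)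

lemma subring_one: "is_subring D \<Longrightarrow> 1 \<in> D"
  and subring_diff: "is_subring D \<Longrightarrow> x \<in> D \<Longrightarrow> y \<in> D \<Longrightarrow> x - y \<in> D"
  and subring_mult: "is_subring D \<Longrightarrow> x \<in> D \<Longrightarrow> y \<in> D \<Longrightarrow> x * y \<in> D"
  by (auto simp: is_subring_def)

lemma subring_zero: "is_subring D \<Longrightarrow> 0 \<in> D"
  using subring_diff[of D 1 1] subring_one by auto

lemma subring_uminus: "is_subring D \<Longrightarrow> x \<in> D \<Longrightarrow> - x \<in> D"
  using subring_diff[of D 0 x] subring_zero by auto

lemma subring_add: "is_subring D \<Longrightarrow> x \<in> D \<Longrightarrow> y \<in> D \<Longrightarrow> x + y \<in> D"
  using subring_diff[of D x "- y"] subring_uminus by auto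

lemma subring_power: "is_subring D \<Longrightarrow> x \<in> D \<Longrightarrow> x ^ n \<in> D"
  by (induction n) (auto intro: subring_one subring_mult)

lemmas subring_closed = subring_one subring_zero subring_diff subring_mult subring_uminus
  subring_add subring_power

lemma submodule_zero: "submodule_of D I \<Longrightarrow> 0 \<in> I"
  and submodule_add: "submodule_of D I \<Longrightarrow> x \<in> I \<Longrightarrow> y \<in> I \<Longrightarrow> x + y \<in> I"
  and submodule_smult: "submodule_of D I \<Longrightarrow> r \<in> D \<Longrightarrow> x \<in> I \<Longrightarrow> r * x \<in> I"
  by (auto simp: submodule_of_def)

lemma submodule_uminus:
  assumes "is_subring D" "submodule_of D I" "x \<in> I" shows "- x \<in> I"
  using submodule_smult[OF assms(2), of "-1" x] assms by (auto intro: subring_closed)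

lemma submodule_diff:
  assumes "is_subring D" "submodule_of D I" "x \<in> I" "y \<in> I" shows "x - y \<in> I"
  using submodule_add[OF assms(2,3), of "- y"] submodule_uminus[OF assms(1,2,4)] by simp

lemma submodule_smult': "submodule_of D I \<Longrightarrow> r \<in> D \<Longrightarrow> x \<in> I \<Longrightarrow> x * r \<in> I"
  using submodule_smult[of D I r x] by (simp add: mult.commute)

lemma submodule_self: "is_subring D \<Longrightarrow> submodule_of D D"
  by (auto simp: submodule_of_def intro: subring_closed)

lemma submodule_Int: "submodule_of D I \<Longrightarrow> submodule_of D J \<Longrightarrow> submodule_of D (I \<inter> J)"
  by (auto simp: submodule_of_def)

lemma submodule_mono: "submodule_of T I \<Longrightarrow> D \<subseteq> T \<Longrightarrow> submodule_of D I"
  by (auto simp: submodule_of_def)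

lemma submodule_Union_directed:
  assumes "C \<noteq> {}" "\<And>X. X \<in> C \<Longrightarrow> submodule_of D X"
    and dir: "\<And>X Y. X \<in> C \<Longrightarrow> Y \<in> C \<Longrightarrow> \<exists>Z\<in>C. X \<subseteq> Z \<and> Y \<subseteq> Z"
  shows "submodule_of D (\<Union>C)"
  unfolding submodule_of_def
proof (intro conjI ballI)
  show "0 \<in> \<Union>C" using assms(1) submodule_zero[OF assms(2)] by blast
  fix x assume "x \<in> \<Union>C"
  then obtain X where X: "X \<in> C" "x \<in> X" by blast
  { fix y assume "y \<in> \<Union>C"
    then obtain Y where Y: "Y \<in> C" "y \<in> Y" by blast
    obtain Z where Z: "Z \<in> C" "X \<subseteq> Z" "Y \<subseteq> Z" using dir[OF X(1) Y(1)] by blast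
    then have "x + y \<in> Z" using X Y by (intro submodule_add[OF assms(2)]) auto
    then show "x + y \<in> \<Union>C" using Z by blast }
  { fix r assume "r \<in> D"
    then show "r * x \<in> \<Union>C" using X submodule_smult[OF assms(2)] by blast }
qed

lemma multiplier_ideal:
  assumes D: "is_subring D" and I: "submodule_of D I" shows "ideal_of D {r \<in> D. r * x \<in> I}"
  unfolding ideal_of_def submodule_of_def
  using submodule_zero[OF I] submodule_add[OF I] submodule_smult[OF I]
  by (auto intro: subring_closed[OF D] simp: distrib_right mult.assoc)

lemma submodule_colon: "is_subring D \<Longrightarrow> submodule_of D (colon D S)"
  unfolding submodule_of_def colon_def
  by (auto intro: subring_closed simp: distrib_right mult.assoc)

lemma ideal_one: "ideal_of D I \<Longrightarrow> 1 \<in> I \<Longrightarrow> I = D"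
  unfolding ideal_of_def submodule_of_def by force

lemma nz_ideal_frac: "is_subring D \<Longrightarrow> nz_ideal D I \<Longrightarrow> nz_frac_ideal D I"
  unfolding nz_ideal_def nz_frac_ideal_def ideal_of_def
  by (auto intro!: bexI[of _ 1] intro: subring_closed)

lemma nz_elem: "submodule_of D I \<Longrightarrow> I \<noteq> {0} \<Longrightarrow> \<exists>x\<in>I. x \<noteq> 0"
  using submodule_zero by blast

lemma qdom_denom:
  assumes "qdom D" shows "\<exists>d\<in>D. d \<noteq> 0 \<and> d * x \<in> D"
proof -
  have "x \<in> fractions D" using assms by (simp add: domain_with_quotient_field_UNIV_def)
  then show ?thesis by (auto simp: fractions_def)
qed

lemma qdom_common_denom:
  assumes "qdom D" "finite S" shows "\<exists>d\<in>D. d \<noteq> 0 \<and> (\<forall>x\<in>S. d * x \<in> D)"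
  using assms(2)
proof (induction S)
  case empty
  then show ?case using subring_one[OF qdom_subring[OF assms(1)]] by (intro bexI[of _ 1]) auto
next
  case (insert y S)
  obtain d where d: "d \<in> D" "d \<noteq> 0" "\<forall>x\<in>S. d * x \<in> D" using insert by auto
  obtain e where e: "e \<in> D" "e \<noteq> 0" "e * y \<in> D" using qdom_denom[OF assms(1), of y] by auto
  note sr = qdom_subring[OF assms(1)]
  have "(d * e) * x \<in> D" if x: "x \<in> insert y S" for x
  proof (cases "x = y")
    case True
    then show ?thesis using subring_mult[OF sr d(1) e(3)] by (simp add: mult.assoc)
  next
    case False
    then have "d * x \<in> D" using x d by auto
    then show ?thesis using subring_mult[OF sr e(1)] by (metis mult.assoc mult.commute)
  qed
  then show ?case using d e subring_mult[OF sr d(1) e(1)] by (intro bexI[of _ "d * e"]) auto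
qed

lemma qdom_overring:
  assumes "qdom D" "overring D T" shows "qdom T"
proof -
  have "x \<in> fractions T" for x
  proof -
    have "x \<in> fractions D" using assms(1) by (simp add: domain_with_quotient_field_UNIV_def)
    then show ?thesis using assms(2) by (auto simp: fractions_def overring_def)
  qed
  then show ?thesis using assms(2) by (auto simp: domain_with_quotient_field_UNIV_def overring_def)
qed

lemma submodule_nz_integral:
  assumes "qdom D" "submodule_of D I" "x \<in> I" "x \<noteq> 0"
  shows "\<exists>p\<in>I. p \<in> D \<and> p \<noteq> 0"
proof -
  obtain d where "d \<in> D" "d \<noteq> 0" "d * x \<in> D" using qdom_denom[OF assms(1)] by blast
  then show ?thesis using submodule_smult[OF assms(2) _ assms(3), of d] assms(4)
    by (intro bexI[of _ "d * x"]) auto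
qed

lemma nz_idealD:
  assumes "nz_ideal D I"
  shows "submodule_of D I" "\<exists>x\<in>I. x \<noteq> 0" "I \<subseteq> D"
  using assms nz_elem by (auto simp: nz_ideal_def ideal_of_def)

lemma nz_idealI: "submodule_of D I \<Longrightarrow> I \<subseteq> D \<Longrightarrow> x \<in> I \<Longrightarrow> x \<noteq> 0 \<Longrightarrow> nz_ideal D I"
  unfolding nz_ideal_def ideal_of_def by blast

lemma nz_ideal_contraction:
  assumes D: "qdom D" "D \<subseteq> T" and J: "nz_ideal T J" shows "nz_ideal D (J \<inter> D)"
proof -
  have sJ: "submodule_of D J" using submodule_mono[OF nz_idealD(1)[OF J] D(2)] .
  obtain p where "p \<in> J" "p \<in> D" "p \<noteq> 0"
    using submodule_nz_integral[OF D(1) sJ] nz_idealD(2)[OF J] by blast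
  then show ?thesis
    by (intro nz_idealI[of _ _ p] submodule_Int sJ submodule_self qdom_subring[OF D(1)]) auto
qed

section \<open>Submodules with two generators\<close>

definition span2 :: "'a::field set \<Rightarrow> 'a \<Rightarrow> 'a \<Rightarrow> 'a set" where
  "span2 D a b = {a * x + b * y | x y. x \<in> D \<and> y \<in> D}"

lemma span2I: "x \<in> D \<Longrightarrow> y \<in> D \<Longrightarrow> z = a * x + b * y \<Longrightarrow> z \<in> span2 D a b"
  by (auto simp: span2_def)

lemma submodule_span2:
  assumes "is_subring D" shows "submodule_of D (span2 D a b)"
  unfolding submodule_of_def
proof (intro conjI ballI)
  show "0 \<in> span2 D a b" using assms by (intro span2I[of 0 _ 0]) (auto intro: subring_closed)
  fix x assume "x \<in> span2 D a b"
  then obtain p q where x: "p \<in> D" "q \<in> D" "x = a * p + b * q" by (auto simp: span2_def)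
  { fix y assume "y \<in> span2 D a b"
    then obtain p' q' where y: "p' \<in> D" "q' \<in> D" "y = a * p' + b * q'" by (auto simp: span2_def)
    show "x + y \<in> span2 D a b"
      using assms x y by (intro span2I[of "p + p'" _ "q + q'"]) (auto intro: subring_closed simp: algebra_simps) }
  { fix r assume "r \<in> D"
    then show "r * x \<in> span2 D a b"
      using assms x by (intro span2I[of "r * p" _ "r * q"]) (auto intro: subring_closed simp: algebra_simps) }
qed

lemma span2_gens: "is_subring D \<Longrightarrow> a \<in> span2 D a b" "is_subring D \<Longrightarrow> b \<in> span2 D a b"
  by (intro span2I[of 1 _ 0]; auto intro: subring_closed)
     (intro span2I[of 0 _ 1]; auto intro: subring_closed)

lemma span2_least: "submodule_of D I \<Longrightarrow> a \<in> I \<Longrightarrow> b \<in> I \<Longrightarrow> span2 D a b \<subseteq> I"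
  by (auto simp: span2_def intro: submodule_add submodule_smult')

lemma span2_mult: "(*) c ` span2 D a b = span2 D (c * a) (c * b)"
proof -
  have e: "c * (a * x + b * y) = c * a * x + c * b * y" for x y by (simp add: algebra_simps)
  show ?thesis
    unfolding span2_def image_Collect e[symmetric] by blast
qed

lemma submodule_mult_image:
  assumes "submodule_of D I" shows "submodule_of D ((*) c ` I)"
  unfolding submodule_of_def
proof (intro conjI ballI)
  show "0 \<in> (*) c ` I" using submodule_zero[OF assms] by (auto intro!: image_eqI[of _ _ 0])
  fix x assume "x \<in> (*) c ` I"
  then obtain x' where x: "x' \<in> I" "x = c * x'" by auto
  { fix y assume "y \<in> (*) c ` I"
    then obtain y' where y: "y' \<in> I" "y = c * y'" by auto
    show "x + y \<in> (*) c ` I"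
      using submodule_add[OF assms x(1) y(1)] x y by (auto intro!: image_eqI[of _ _ "x' + y'"] simp: distrib_left) }
  { fix r assume "r \<in> D"
    then show "r * x \<in> (*) c ` I"
      using submodule_smult[OF assms _ x(1)] x by (auto intro!: image_eqI[of _ _ "r * x'"] simp: mult.left_commute) }
qed

subsection \<open>Divisorial closure\<close>

lemma v_clI: "(\<And>y. y \<in> colon D S \<Longrightarrow> x * y \<in> D) \<Longrightarrow> x \<in> v_cl D S"
  by (simp add: v_cl_def colon_def[of D "colon D S"])

lemma v_clD: "x \<in> v_cl D S \<Longrightarrow> y \<in> colon D S \<Longrightarrow> x * y \<in> D"
  by (simp add: v_cl_def colon_def[of D "colon D S"])

lemma v_cl_extensive: "S \<subseteq> v_cl D S"
  by (auto simp: v_cl_def colon_def mult.commute)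

lemma colon_antimono: "S \<subseteq> S' \<Longrightarrow> colon D S' \<subseteq> colon D S"
  by (auto simp: colon_def)

lemma v_cl_mono: "S \<subseteq> S' \<Longrightarrow> v_cl D S \<subseteq> v_cl D S'"
  unfolding v_cl_def by (intro colon_antimono)

lemma colon_v_cl: "colon D (v_cl D S) = colon D S"
proof
  show "colon D (v_cl D S) \<subseteq> colon D S" by (intro colon_antimono v_cl_extensive)
  show "colon D S \<subseteq> colon D (v_cl D S)" unfolding v_cl_def using v_cl_extensive[of "colon D S" D] 
    by (simp add: v_cl_def)
qed

lemma v_cl_idem: "v_cl D (v_cl D S) = v_cl D S"
  by (metis colon_v_cl v_cl_def)

lemma v_cl_colon: "v_cl D (colon D S) = colon D S"
  by (metis colon_v_cl v_cl_def)

lemma v_cl_mult: "x \<in> v_cl D S \<Longrightarrow> c * x \<in> v_cl D ((*) c ` S)"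
proof -
  assume x: "x \<in> v_cl D S"
  have "y * c \<in> colon D S" if "y \<in> colon D ((*) c ` S)" for y
    using that by (auto simp: colon_def mult.assoc)
  moreover have "x * w \<in> D" if "w \<in> colon D S" for w
    using x that by (blast intro: v_clD)
  ultimately have "c * x * y \<in> D" if "y \<in> colon D ((*) c ` S)" for y
    using that by (metis mult.assoc mult.commute)
  then show ?thesis
    by (rule v_clI)
qed

lemma submodule_v_cl: "is_subring D \<Longrightarrow> submodule_of D (v_cl D S)"
  unfolding v_cl_def by (rule submodule_colon)

lemma v_cl_subset_ring: "is_subring D \<Longrightarrow> S \<subseteq> D \<Longrightarrow> v_cl D S \<subseteq> D"
proof
  fix x assume D: "is_subring D" "S \<subseteq> D" and x: "x \<in> v_cl D S"
  then have "1 \<in> colon D S" by (auto simp: colon_def)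
  then have "x * 1 \<in> D" using x by (blast intro: v_clD)
  then show "x \<in> D" by simp
qed

lemma divisorial_domainI:
  assumes "is_subring D" "\<And>I. nz_ideal D I \<Longrightarrow> v_cl D I \<subseteq> I"
  shows "divisorial_domain D"
  unfolding divisorial_domain_def divisorial_ideal_def
proof (intro allI impI conjI)
  fix I assume I: "nz_ideal D I"
  show "nz_frac_ideal D I" using nz_ideal_frac[OF assms(1) I] .
  show "I = v_cl D I" using assms(2)[OF I] v_cl_extensive[of I D] by blast
qed

lemma divisorial_domain_frac:
  assumes D: "is_subring D" and dd: "divisorial_domain D" and I: "nz_frac_ideal D I"
  shows "v_cl D I = I"
proof -
  obtain d where d: "d \<in> D" "d \<noteq> 0" "\<forall>x\<in>I. d * x \<in> D" and sm: "submodule_of D I" and "I \<noteq> {0}"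
    using I by (auto simp: nz_frac_ideal_def)
  obtain z where z: "z \<in> I" "z \<noteq> 0" using nz_elem[OF sm \<open>I \<noteq> {0}\<close>] by blast
  have "nz_ideal D ((*) d ` I)"
    unfolding nz_ideal_def ideal_of_def using submodule_mult_image[OF sm] d z
      mult_eq_0_iff[of d z] by blast
  then have e: "v_cl D ((*) d ` I) = (*) d ` I"
    using dd by (auto simp: divisorial_domain_def divisorial_ideal_def)
  have "v_cl D I \<subseteq> I"
  proof
    fix x assume "x \<in> v_cl D I"
    then have "d * x \<in> (*) d ` I" using v_cl_mult[of x D I d] e by simp
    then show "x \<in> I" using d(2) by auto
  qed
  then show ?thesis using v_cl_extensive by blast
qed

definition two_gen_ring :: "'a::field set \<Rightarrow> bool" where
  "two_gen_ring D \<longleftrightarrow> (\<forall>I. nz_ideal D I \<longrightarrow> (\<exists>a b. I = span2 D a b))"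

lemma two_gen_frac:
  assumes "two_gen_ring D" "nz_frac_ideal D I"
  shows "\<exists>a b. I = span2 D a b"
proof -
  obtain d where d: "d \<in> D" "d \<noteq> 0" "\<forall>x\<in>I. d * x \<in> D" and sm: "submodule_of D I" and "I \<noteq> {0}"
    using assms(2) by (auto simp: nz_frac_ideal_def)
  obtain z where z: "z \<in> I" "z \<noteq> 0" using nz_elem[OF sm \<open>I \<noteq> {0}\<close>] by blast
  have "nz_ideal D ((*) d ` I)"
    unfolding nz_ideal_def ideal_of_def using submodule_mult_image[OF sm] d z
      mult_eq_0_iff[of d z] by blast
  then obtain a b where ab: "(*) d ` I = span2 D a b" using assms(1) by (auto simp: two_gen_ring_def)
  have "I = (*) (1/d) ` ((*) d ` I)" using d(2) by (auto simp: image_image)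
  also have "\<dots> = span2 D (1/d * a) (1/d * b)" by (simp only: ab span2_mult)
  finally show ?thesis by blast
qed

subsection \<open>Local rings\<close>

definition local_ring :: "'a::field set \<Rightarrow> 'a set \<Rightarrow> bool" where
  "local_ring A m \<longleftrightarrow> qdom A \<and> ideal_of A m \<and> 1 \<notin> m \<and> (\<forall>x\<in>A. x \<notin> m \<longrightarrow> inverse x \<in> A)"

lemma local_ringD:
  assumes "local_ring A m"
  shows "qdom A" "is_subring A" "submodule_of A m" "m \<subseteq> A" "1 \<notin> m"
    "x \<in> A \<Longrightarrow> x \<notin> m \<Longrightarrow> inverse x \<in> A" "x \<in> A \<Longrightarrow> x \<notin> m \<Longrightarrow> x \<noteq> 0"
  using assms qdom_subring by (auto simp: local_ring_def ideal_of_def submodule_of_def)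

lemma local_ring_div: "local_ring A m \<Longrightarrow> y \<in> A \<Longrightarrow> x \<in> A \<Longrightarrow> x \<notin> m \<Longrightarrow> y / x \<in> A"
  by (simp add: divide_inverse local_ringD subring_mult)

lemma local_ring_prime:
  assumes A: "local_ring A m" and "x \<in> A" "y \<in> A" "x * y \<in> m" shows "x \<in> m \<or> y \<in> m"
proof (rule ccontr)
  assume "\<not> ?thesis"
  then have n: "x \<notin> m" "y \<notin> m" by auto
  have "inverse (x * y) \<in> A" unfolding inverse_mult_distrib
    using A assms(2,3) n by (auto intro!: subring_mult local_ringD)
  then have "inverse (x * y) * (x * y) \<in> m" using assms(4) local_ringD(3)[OF A] submodule_smult by blast
  moreover have "x * y \<noteq> 0" using local_ringD(7)[OF A] assms n by auto
  ultimately show False using local_ringD(5)[OF A] by (metis left_inverse)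
qed

lemma local_ring_unit_minus:
  assumes A: "local_ring A m" and "u \<in> A" "u \<notin> m" "x \<in> m" shows "u - x \<in> A" "u - x \<notin> m"
proof -
  show "u - x \<in> A" using assms local_ringD[OF A] by (auto intro: subring_diff)
  show "u - x \<notin> m"
  proof
    assume "u - x \<in> m"
    then have "(u - x) + x \<in> m" using submodule_add[OF local_ringD(3)[OF A]] assms(4) by blast
    then show False using assms by simp
  qed
qed

lemma local_ring_unit_plus:
  assumes A: "local_ring A m" and "u \<in> A" "u \<notin> m" "x \<in> m" shows "u + x \<in> A" "u + x \<notin> m"
  using local_ring_unit_minus[OF assms(1-3), of "- x"] submodule_uminus[OF local_ringD(2,3)[OF A] assms(4)]
  by auto

text \<open>For a local ring \<open>A\<close> with maximal ideal \<open>m\<close> this says that \<open>m\<close> is the only nonzero prime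
  ideal, unless \<open>m = 0\<close>.\<close>
definition one_dim :: "'a::field set \<Rightarrow> 'a set \<Rightarrow> bool" where
  "one_dim A m \<longleftrightarrow> (\<forall>s\<in>m. \<forall>a\<in>A. a \<noteq> 0 \<longrightarrow> (\<exists>k::nat. \<exists>z\<in>A. s ^ k = a * z))"

subsection \<open>Local rings with two-generated ideals\<close>

text \<open>Expressing the \<open>x\<^sub>i\<close> through two generators of their span, and these through the \<open>x\<^sub>i\<close>, gives
  \<open>x = N x\<close> with \<open>det N = 0\<close>, so \<open>N\<close> is not the identity modulo \<open>m\<close>.\<close>
lemma three_elements_dependent:
  assumes A: "local_ring A m" and tg: "two_gen_ring A"
  shows "\<exists>c1 c2 c3. c1 \<in> A \<and> c2 \<in> A \<and> c3 \<in> A \<and> c1 * x1 + c2 * x2 + c3 * x3 = 0 \<and>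
     (c1 \<notin> m \<or> c2 \<notin> m \<or> c3 \<notin> m)"
proof (cases "x1 = 0")
  case True
  then show ?thesis using local_ringD[OF A] by (intro exI[of _ 1] exI[of _ 0]) (auto intro: subring_closed)
next
  case False
  note sr = local_ringD(2)[OF A] and mm = local_ringD(3)[OF A]
  define I where "I = {x1 * a + x2 * b + x3 * c | a b c. a \<in> A \<and> b \<in> A \<and> c \<in> A}"
  have II: "z = x1 * a + x2 * b + x3 * c \<Longrightarrow> a \<in> A \<Longrightarrow> b \<in> A \<Longrightarrow> c \<in> A \<Longrightarrow> z \<in> I" for z a b c
    by (auto simp: I_def)
  have sI: "submodule_of A I" unfolding submodule_of_def
  proof (intro conjI ballI)
    show "0 \<in> I" using sr by (intro II[of _ 0 0 0]) (auto intro: subring_closed)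
    fix x assume "x \<in> I"
    then obtain p q r where x: "x = x1 * p + x2 * q + x3 * r" "p \<in> A" "q \<in> A" "r \<in> A" by (auto simp: I_def)
    { fix y assume "y \<in> I"
      then obtain p' q' r' where y: "y = x1 * p' + x2 * q' + x3 * r'" "p' \<in> A" "q' \<in> A" "r' \<in> A" by (auto simp: I_def)
      show "x + y \<in> I" using sr x y
        by (intro II[of _ "p + p'" "q + q'" "r + r'"]) (auto intro: subring_closed simp: algebra_simps) }
    { fix c assume "c \<in> A"
      then show "c * x \<in> I" using sr x
        by (intro II[of _ "c * p" "c * q" "c * r"]) (auto intro: subring_closed simp: algebra_simps) }
  qed
  have x: "x1 \<in> I" "x2 \<in> I" "x3 \<in> I"
    using II[of x1 1 0 0] II[of x2 0 1 0] II[of x3 0 0 1] subring_one[OF sr] subring_zero[OF sr] by auto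
  obtain d where d: "d \<in> A" "d \<noteq> 0" "\<forall>x\<in>{x1,x2,x3}. d * x \<in> A"
    using qdom_common_denom[OF local_ringD(1)[OF A], of "{x1,x2,x3}"] by auto
  have "d * z \<in> A" if zI: "z \<in> I" for z
  proof -
    obtain a b c where "z = x1 * a + x2 * b + x3 * c" "a \<in> A" "b \<in> A" "c \<in> A" using zI unfolding I_def by blast
    moreover have "d * (x1 * a + x2 * b + x3 * c) = (d * x1) * a + (d * x2) * b + (d * x3) * c"
      by (simp add: algebra_simps)
    ultimately show ?thesis using d sr by (auto intro!: subring_closed)
  qed
  then have "nz_frac_ideal A I" unfolding nz_frac_ideal_def using sI x False d by blast
  then obtain u v where uv: "I = span2 A u v" using two_gen_frac[OF tg] by blast
  obtain p1 q1 p2 q2 p3 q3 where e: "x1 = u * p1 + v * q1" "x2 = u * p2 + v * q2" "x3 = u * p3 + v * q3"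
    and c: "p1 \<in> A" "q1 \<in> A" "p2 \<in> A" "q2 \<in> A" "p3 \<in> A" "q3 \<in> A"
    using x unfolding uv span2_def by blast
  obtain r1 r2 r3 s1 s2 s3 where f: "u = x1 * r1 + x2 * r2 + x3 * r3" "v = x1 * s1 + x2 * s2 + x3 * s3"
    and c': "r1 \<in> A" "r2 \<in> A" "r3 \<in> A" "s1 \<in> A" "s2 \<in> A" "s3 \<in> A"
    using span2_gens[OF sr, where a=u and b=v] unfolding uv[symmetric] unfolding I_def by blast
  define N where "N p q r s = p * r + q * s" for p q r s :: 'a
  have NA: "N p q r s \<in> A" if "p \<in> A" "q \<in> A" "r \<in> A" "s \<in> A" for p q r s
    unfolding N_def using that sr by (auto intro: subring_closed)
  define n11 n12 n13 n21 n22 n23 n31 n32 n33 where n: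
    "n11 = N p1 q1 r1 s1" "n12 = N p1 q1 r2 s2" "n13 = N p1 q1 r3 s3"
    "n21 = N p2 q2 r1 s1" "n22 = N p2 q2 r2 s2" "n23 = N p2 q2 r3 s3"
    "n31 = N p3 q3 r1 s1" "n32 = N p3 q3 r2 s2" "n33 = N p3 q3 r3 s3"
  have nA: "n11 \<in> A" "n12 \<in> A" "n13 \<in> A" "n21 \<in> A" "n22 \<in> A" "n23 \<in> A" "n31 \<in> A" "n32 \<in> A" "n33 \<in> A"
    unfolding n using NA c c' by auto
  have rel: "x1 = n11 * x1 + n12 * x2 + n13 * x3" "x2 = n21 * x1 + n22 * x2 + n23 * x3"
    "x3 = n31 * x1 + n32 * x2 + n33 * x3"
  proof -
    have "n11 * x1 + n12 * x2 + n13 * x3 = (x1 * r1 + x2 * r2 + x3 * r3) * p1 + (x1 * s1 + x2 * s2 + x3 * s3) * q1"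
      "n21 * x1 + n22 * x2 + n23 * x3 = (x1 * r1 + x2 * r2 + x3 * r3) * p2 + (x1 * s1 + x2 * s2 + x3 * s3) * q2"
      "n31 * x1 + n32 * x2 + n33 * x3 = (x1 * r1 + x2 * r2 + x3 * r3) * p3 + (x1 * s1 + x2 * s2 + x3 * s3) * q3"
      unfolding n N_def by (simp_all add: algebra_simps)
    then show "x1 = n11 * x1 + n12 * x2 + n13 * x3" "x2 = n21 * x1 + n22 * x2 + n23 * x3"
      "x3 = n31 * x1 + n32 * x2 + n33 * x3"
      by (simp_all only: f[symmetric] e[symmetric])
  qed
  have det: "n11 * n22 * n33 = n11 * n23 * n32 + n12 * n21 * n33 - n12 * n23 * n31 - n13 * n21 * n32 + n13 * n22 * n31"
    unfolding n N_def by (simp add: algebra_simps)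
  show ?thesis
  proof (rule ccontr)
    assume no: "\<not> ?thesis"
    have all: "c1 \<in> m \<and> c2 \<in> m \<and> c3 \<in> m" if "c1 \<in> A" "c2 \<in> A" "c3 \<in> A" "c1 * x1 + c2 * x2 + c3 * x3 = 0" for c1 c2 c3
      using no that by blast
    have 1: "1 - n11 \<in> m \<and> - n12 \<in> m \<and> - n13 \<in> m"
      by (rule all) (use nA sr rel in \<open>auto intro!: subring_closed simp: algebra_simps\<close>)
    have 2: "- n21 \<in> m \<and> 1 - n22 \<in> m \<and> - n23 \<in> m"
      by (rule all) (use nA sr rel in \<open>auto intro!: subring_closed simp: algebra_simps\<close>)
    have 3: "- n31 \<in> m \<and> - n32 \<in> m \<and> 1 - n33 \<in> m"
      by (rule all) (use nA sr rel in \<open>auto intro!: subring_closed simp: algebra_simps\<close>)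
    have off: "n12 \<in> m" "n13 \<in> m" "n21 \<in> m" "n23 \<in> m" "n32 \<in> m" "n31 \<in> m"
      using 1 2 3 submodule_uminus[OF sr mm] by force+
    \<comment> \<open>The first three summands telescope to \<open>1 - n11 * n22 * n33\<close>. The
      vanishing determinant rewrites the missing diagonal product as a sum of terms that each
      contain an off-diagonal entry.\<close>
    have "1 = (1 - n11) + n11 * (1 - n22) + n11 * n22 * (1 - n33) +
        (n11 * n23 * n32 + n12 * n21 * n33 - n12 * n23 * n31 - n13 * n21 * n32 + n13 * n22 * n31)"
      using det by (simp add: algebra_simps)
    moreover have "n11 * (1 - n22) \<in> m" "n11 * n22 * (1 - n33) \<in> m" "n11 * n23 * n32 \<in> m"
      "n12 * n21 * n33 \<in> m" "n12 * n23 * n31 \<in> m" "n13 * n21 * n32 \<in> m" "n13 * n22 * n31 \<in> m"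
      using 1 2 3 off nA by (simp_all add: submodule_smult[OF mm] submodule_smult'[OF mm] subring_mult[OF sr])
    ultimately have "1 \<in> m"
      using 1 by (metis submodule_add[OF mm] submodule_diff[OF sr mm])
    then show False using local_ringD(5)[OF A] by simp
  qed
qed

lemma is_subring_span2:
  assumes D: "is_subring D" and y: "y * y \<in> span2 D 1 y"
  shows "is_subring (span2 D 1 y)"
  unfolding is_subring_def
proof (intro conjI ballI)
  note sm = submodule_span2[OF D, of 1 y]
  show "1 \<in> span2 D 1 y" by (rule span2_gens[OF D])
  fix u v assume "u \<in> span2 D 1 y" and v: "v \<in> span2 D 1 y"
  then show "u - v \<in> span2 D 1 y" using submodule_diff[OF D sm] by blast
  obtain p q where u: "u = 1 * p + y * q" "p \<in> D" "q \<in> D" using \<open>u \<in> _\<close> unfolding span2_def by blast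
  obtain r s where v': "v = 1 * r + y * s" "r \<in> D" "s \<in> D" using v unfolding span2_def by blast
  have "u * v = (p * v + q * (r * y)) + (q * s) * (y * y)" using u v' by (simp add: algebra_simps)
  moreover have "p * v + q * (r * y) \<in> span2 D 1 y"
    using u v' v span2_gens[OF D] by (intro submodule_add[OF sm] submodule_smult[OF sm])
  moreover have "(q * s) * (y * y) \<in> span2 D 1 y"
    using submodule_smult[OF sm subring_mult[OF D u(3) v'(3)] y] .
  ultimately show "u * v \<in> span2 D 1 y" using submodule_add[OF sm] by simp
qed

lemma span2_swap: "span2 D a b = span2 D b a"
proof -
  have "span2 D a b \<subseteq> span2 D b a" for a b
  proof
    fix z assume "z \<in> span2 D a b"
    then obtain x y where "x \<in> D" "y \<in> D" "z = a * x + b * y" unfolding span2_def by blast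
    then show "z \<in> span2 D b a" by (intro span2I[of y _ x]) (simp_all add: add.commute)
  qed
  then show ?thesis by blast
qed

lemma span2_eqI:
  assumes "is_subring D" "a \<in> span2 D c d" "b \<in> span2 D c d" "c \<in> span2 D a b" "d \<in> span2 D a b"
  shows "span2 D a b = span2 D c d"
  using assms by (intro subset_antisym span2_least submodule_span2)

text \<open>If neither \<open>b\<close> nor \<open>1 / b\<close> is a root of a monic quadratic, then \<open>b = r + s b\<^sup>2\<close> with
  \<open>r\<close>, \<open>s\<close> in the maximal ideal; then \<open>y = s b\<close> is idempotent modulo \<open>m\<close>, it annihilates \<open>1\<close> and
  fixes \<open>b\<close> modulo \<open>m\<close>, and so \<open>(1 - y) 1 + y b\<close> is a generator.\<close>
lemma span2_eq_ring_multiple: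
  assumes A: "local_ring A m" and tg: "two_gen_ring A"
  shows "\<exists>g y. g \<noteq> 0 \<and> is_subring (span2 A 1 y) \<and> span2 A 1 b = (*) g ` span2 A 1 y"
proof -
  note sr = local_ringD(2)[OF A] and mm = local_ringD(3)[OF A]
  obtain c1 c2 c3 where c: "c1 \<in> A" "c2 \<in> A" "c3 \<in> A" "c1 * 1 + c2 * b + c3 * (b * b) = 0"
    and u: "c1 \<notin> m \<or> c2 \<notin> m \<or> c3 \<notin> m" using three_elements_dependent[OF A tg, of 1 b "b * b"] by blast
  consider "c3 \<notin> m" | "c1 \<notin> m" | "c2 \<notin> m" "c1 \<in> m" "c3 \<in> m" using u by blast
  then show ?thesis
  proof cases
    case 1
    have "c3 \<noteq> 0" using local_ringD(7)[OF A] c 1 by blast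
    have "b * b = 1 * - (c1 / c3) + b * - (c2 / c3)"
      using c(4) \<open>c3 \<noteq> 0\<close> by (simp add: field_simps) (metis add.commute add_eq_0_iff)
    then have "b * b \<in> span2 A 1 b"
      using c 1 by (intro span2I[of "- (c1 / c3)" _ "- (c2 / c3)"] subring_uminus[OF sr] local_ring_div[OF A])
    then show ?thesis using is_subring_span2[OF sr] by (intro exI[of _ 1] exI[of _ b]) auto
  next
    case 2
    have "c1 \<noteq> 0" using local_ringD(7)[OF A] c 2 by blast
    then have "b \<noteq> 0" using c by auto
    have "1 / b * (1 / b) = 1 * - (c3 / c1) + 1 / b * - (c2 / c1)"
    proof -
      have "c1 = - (c3 * (b * b)) - c2 * b" using c(4) by (simp add: algebra_simps eq_neg_iff_add_eq_0)
      then show ?thesis using \<open>c1 \<noteq> 0\<close> \<open>b \<noteq> 0\<close> by (simp add: field_simps)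
    qed
    then have "1 / b * (1 / b) \<in> span2 A 1 (1 / b)"
      using c 2 by (intro span2I[of "- (c3 / c1)" _ "- (c2 / c1)"] subring_uminus[OF sr] local_ring_div[OF A])
    then have S: "is_subring (span2 A 1 (1 / b))" using is_subring_span2[OF sr] by blast
    have "span2 A 1 b = span2 A b 1" by (rule span2_swap)
    also have "\<dots> = (*) b ` span2 A 1 (1 / b)" using \<open>b \<noteq> 0\<close> by (simp add: span2_mult)
    finally show ?thesis using S \<open>b \<noteq> 0\<close> by blast
  next
    case 3
    have "c2 \<noteq> 0" using local_ringD(7)[OF A] c 3 by blast
    define r s where "r = - inverse c2 * c1" and "s = - inverse c2 * c3"
    have ic: "- inverse c2 \<in> A" using c 3 A by (intro subring_uminus[OF sr] local_ringD(6))
    have rs: "r \<in> m" "s \<in> m" unfolding r_def s_def using ic 3 by (auto intro: submodule_smult[OF mm] simp del: mult_minus_left)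
    then have rsA: "r \<in> A" "s \<in> A" using local_ringD(4)[OF A] by auto
    have b: "b = r + s * (b * b)"
      using c(4) \<open>c2 \<noteq> 0\<close> unfolding r_def s_def
      by (simp add: field_simps) (metis add.commute add.left_commute add_eq_0_iff minus_add_distrib)
    define y g where "y = s * b" and "g = (1 - r) + (1 - s) * b"
    have yb: "y * b = b - r" using b unfolding y_def by (simp add: algebra_simps)
    have yy: "y * y = y - r * s"
    proof -
      have "y * y = s * (y * b)" by (simp add: y_def)
      then show ?thesis unfolding yb by (simp add: y_def algebra_simps)
    qed
    have S: "is_subring (span2 A 1 y)"
      by (rule is_subring_span2[OF sr], rule span2I[of "- (r * s)" _ 1])
         (use rsA sr yy in \<open>auto intro: subring_closed\<close>)
    \<comment> \<open>\<open>e\<close> is the determinant of the matrix expressing \<open>g\<close>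
      and \<open>y * g\<close> through \<open>1\<close> and \<open>b\<close>; the equations
      \<open>e1\<close> and \<open>eb\<close> are Cramer's rule.\<close>
    define e where "e = 1 - r * (s * (1 + 1 + 1 - r - s))"
    have eA: "e \<in> A" "e \<notin> m"
    proof -
      have "r * (s * (1 + 1 + 1 - r - s)) \<in> m"
        using rsA by (intro submodule_smult'[OF mm _ rs(1)] subring_closed[OF sr])
      then show "e \<in> A" "e \<notin> m"
        unfolding e_def using local_ring_unit_minus[OF A subring_one[OF sr] local_ringD(5)[OF A]] by blast+
    qed
    then have e0: "e \<noteq> 0" using local_ringD(7)[OF A] by blast
    have yg: "y * g = (1 - s) * (y * b) + (1 - r) * y" unfolding g_def by (simp add: algebra_simps)
    have e1: "e = (1 - r * s) * g - (1 - s) * (y * g)"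
      unfolding yg yb unfolding g_def y_def e_def by (simp add: algebra_simps)
    have eb: "e * b = (1 - r) * (y * g) + (r * (1 - s)) * g"
      unfolding yg yb unfolding g_def y_def e_def by (simp add: algebra_simps)
    have "g \<noteq> 0" using e1 e0 by auto
    have "span2 A 1 b = span2 A g (g * y)"
    proof (rule span2_eqI[OF sr])
      have "g * ((1 - r * s) / e) + g * y * - ((1 - s) / e) = ((1 - r * s) * g - (1 - s) * (y * g)) / e"
        by (simp add: divide_inverse algebra_simps)
      then have "1 = g * ((1 - r * s) / e) + g * y * - ((1 - s) / e)"
        unfolding e1[symmetric] using e0 by simp
      then show "1 \<in> span2 A g (g * y)"
        by (rule span2I[rotated 2])
           (use rsA sr eA in \<open>auto intro!: local_ring_div[OF A] subring_uminus[OF sr] intro: subring_closed\<close>)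
      have "g * (r * (1 - s) / e) + g * y * ((1 - r) / e) = ((1 - r) * (y * g) + (r * (1 - s)) * g) / e"
        by (simp add: divide_inverse algebra_simps)
      then have "b = g * (r * (1 - s) / e) + g * y * ((1 - r) / e)"
        unfolding eb[symmetric] using e0 by simp
      then show "b \<in> span2 A g (g * y)"
        by (rule span2I[rotated 2])
           (use rsA sr eA in \<open>auto intro!: local_ring_div[OF A] intro: subring_closed\<close>)
      show "g \<in> span2 A 1 b" unfolding g_def
        by (rule span2I[of "1 - r" _ "1 - s"]) (use rsA sr in \<open>auto intro: subring_closed\<close>)
      have "g * y = - r * (1 - s) + (1 - r * s) * b"
        using yg unfolding yb by (simp add: y_def algebra_simps)
      then show "g * y \<in> span2 A 1 b"
        by (intro span2I[of "- r * (1 - s)" _ "1 - r * s"]) (use rsA sr in \<open>auto intro!: subring_closed\<close>)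
    qed
    also have "\<dots> = (*) g ` span2 A 1 y" by (simp add: span2_mult)
    finally show ?thesis using S \<open>g \<noteq> 0\<close> by blast
  qed
qed

text \<open>Dividing by a nonzero generator normalizes the ideal to the span of \<open>1\<close> and
  one field element. Questions about ideals thus become questions about overrings
  \<open>A + Ay\<close>.\<close>

lemma ideal_eq_ring_multiple:
  assumes A: "local_ring A m" and tg: "two_gen_ring A" and I: "nz_frac_ideal A I"
  shows "\<exists>g y. g \<noteq> 0 \<and> is_subring (span2 A 1 y) \<and> I = (*) g ` span2 A 1 y"
proof -
  obtain a b where ab: "I = span2 A a b" using two_gen_frac[OF tg I] by blast
  have *: ?thesis if "I = span2 A a b" "a \<noteq> 0" for a b
  proof -
    obtain g y where "g \<noteq> 0" "is_subring (span2 A 1 y)" "span2 A 1 (b / a) = (*) g ` span2 A 1 y"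
      using span2_eq_ring_multiple[OF A tg] by blast
    moreover have "I = (*) a ` span2 A 1 (b / a)" using that by (simp add: span2_mult)
    ultimately show ?thesis using \<open>a \<noteq> 0\<close>
      by (intro exI[of _ "a * g"] exI[of _ y]) (auto simp: image_image mult.assoc)
  qed
  have "a \<noteq> 0 \<or> b \<noteq> 0"
  proof (rule ccontr)
    assume "\<not> ?thesis"
    then have "I \<subseteq> {0}" unfolding ab span2_def by auto
    then show False using I submodule_zero by (auto simp: nz_frac_ideal_def)
  qed
  then show ?thesis using *[OF ab] *[of b a] ab span2_swap[of A a b] by metis
qed

text \<open>An element of \<open>m\<close> that is regular modulo a proper nonzero ideal is a
  symptom of dimension two. If \<open>F = fA\<close>, then \<open>f * f\<close>,
  \<open>f * s\<close>, \<open>s * s\<close> would admit no relation with a unit coefficient; if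
  \<open>F\<close> needs two generators, these together with \<open>s\<close> would admit none.
  Either contradicts \<open>three_elements_dependent\<close>.\<close>

lemma regular_mod_ideal:
  assumes A: "local_ring A m" and tg: "two_gen_ring A" and F: "nz_ideal A F"
    and s: "s \<in> m" and reg: "\<And>x. x \<in> A \<Longrightarrow> s * x \<in> F \<Longrightarrow> x \<in> F"
  shows "F = A"
proof (rule ccontr)
  assume "F \<noteq> A"
  note sr = local_ringD(2)[OF A] and mm = local_ringD(3)[OF A]
  have sF: "submodule_of A F" and FA: "F \<subseteq> A" and F0: "F \<noteq> {0}" using F by (auto simp: nz_ideal_def ideal_of_def)
  have sA: "s \<in> A" using s local_ringD(4)[OF A] by auto
  have Fm: "F \<subseteq> m"
  proof
    fix x assume "x \<in> F"
    show "x \<in> m"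
    proof (rule ccontr)
      assume "x \<notin> m"
      then have "inverse x * x \<in> F" "x \<noteq> 0"
        using local_ringD[OF A] \<open>x \<in> F\<close> FA submodule_smult[OF sF] by blast+
      then have "1 \<in> F" by simp
      then show False using ideal_one[of A F] F \<open>F \<noteq> A\<close> by (auto simp: nz_ideal_def)
    qed
  qed
  obtain g h where gh: "F = span2 A g h" using tg F by (auto simp: two_gen_ring_def)
  have prin: False if "F = (*) f ` A" for f
  proof -
    have f0: "f \<noteq> 0" using F0 that subring_zero[OF sr] by auto
    have fF: "f \<in> F" unfolding that using subring_one[OF sr] by force
    have reg': "\<exists>z\<in>A. x = f * z" if "x \<in> A" "s * x = f * w" "w \<in> A" for x w
      using reg[of x] that \<open>F = (*) f ` A\<close> by auto
    obtain a b c where abc: "a \<in> A" "b \<in> A" "c \<in> A" "a * (f * f) + b * (f * s) + c * (s * s) = 0"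
      and u: "a \<notin> m \<or> b \<notin> m \<or> c \<notin> m" using three_elements_dependent[OF A tg] by blast
    have fA: "f \<in> A" using fF FA by auto
    \<comment> \<open>Regularity removes the two factors \<open>s\<close>, so \<open>f\<close>
      divides \<open>c\<close>. After cancelling \<open>f\<close>, the same argument treats
      \<open>b\<close>, and what remains puts \<open>a\<close> into \<open>m\<close>.\<close>
    have "s * (s * c) = f * (- a * f - b * s)" using abc(4) by (simp add: algebra_simps) (metis add.assoc add.commute add_eq_0_iff)
    then have "\<exists>z\<in>A. s * c = f * z" 
      using reg'[of "s * c" "- a * f - b * s"] abc(1-3) sA fA
      by (simp add: subring_mult[OF sr] subring_diff[OF sr] subring_uminus[OF sr])
    then have "\<exists>z\<in>A. c = f * z" using reg'[of c] abc by auto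
    then obtain c' where c': "c' \<in> A" "c = f * c'" by auto
    have "f * (a * f + b * s + c' * (s * s)) = 0" using abc(4) unfolding c' by (simp add: algebra_simps)
    then have e: "a * f + b * s + c' * (s * s) = 0" using f0 by simp
    then have "s * (b + c' * s) = f * - a" by (simp add: algebra_simps) (metis add.assoc add.commute add_eq_0_iff)
    then have "\<exists>z\<in>A. b + c' * s = f * z" using reg'[of "b + c' * s" "- a"] abc c' sA sr by (auto intro: subring_closed)
    then obtain b' where b': "b' \<in> A" "b + c' * s = f * b'" by auto
    have bb: "b = f * b' - c' * s" using b'(2) by (simp add: algebra_simps)
    have "f * (a + b' * s) = 0" using e unfolding bb by (simp add: algebra_simps)
    then have "a = - (b' * s)" using f0 by (simp add: eq_neg_iff_add_eq_0)
    then have "a \<in> m" using b' s submodule_smult[OF mm] submodule_uminus[OF sr mm] by auto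
    moreover have "c \<in> m" unfolding c' using fF Fm c' submodule_smult'[OF mm] by auto
    moreover have "b \<in> m" unfolding bb using fF Fm c' b' s submodule_smult'[OF mm] submodule_smult[OF mm]
      by (intro submodule_diff[OF sr mm]) auto
    ultimately show False using u by blast
  qed
  have notin: "\<exists>z\<in>A. g' = h' * z \<Longrightarrow> F = span2 A g' h' \<Longrightarrow> False" for g' h'
  proof -
    assume "\<exists>z\<in>A. g' = h' * z" and Fe: "F = span2 A g' h'"
    then obtain z where z: "z \<in> A" "g' = h' * z" by auto
    have "F = (*) h' ` A"
    proof
      show "F \<subseteq> (*) h' ` A" unfolding Fe
      proof (intro span2_least submodule_mult_image submodule_self sr)
        show "g' \<in> (*) h' ` A" using z by blast
        show "h' \<in> (*) h' ` A" using subring_one[OF sr] by force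
      qed
      show "(*) h' ` A \<subseteq> F" unfolding Fe
        using span2_gens(2)[OF sr] submodule_smult'[OF submodule_span2[OF sr]] by auto
    qed
    then show False by (rule prin)
  qed
  obtain a b c where abc: "a \<in> A" "b \<in> A" "c \<in> A" "a * g + b * h + c * s = 0"
    and u: "a \<notin> m \<or> b \<notin> m \<or> c \<notin> m" using three_elements_dependent[OF A tg] by blast
  have gF: "g \<in> F" "h \<in> F" unfolding gh using span2_gens[OF sr] by auto
  \<comment> \<open>By regularity \<open>c\<close> lies in \<open>F\<close>. Rewriting it through
    \<open>g\<close> and \<open>h\<close> changes \<open>a\<close> and \<open>b\<close> only by
    multiples of \<open>s\<close>, so units stay units, and a unit would make \<open>F\<close>
    principal.\<close>
  have "s * c = - (a * g + b * h)" using abc(4) by (simp add: algebra_simps eq_neg_iff_add_eq_0)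
  moreover have "- (a * g + b * h) \<in> F"
    using abc gF by (intro submodule_uminus[OF sr sF] submodule_add[OF sF] submodule_smult[OF sF])
  ultimately have cF: "c \<in> F" using reg abc by auto
  then obtain c1 c2 where c12: "c1 \<in> A" "c2 \<in> A" "c = g * c1 + h * c2" unfolding gh span2_def by auto
  have e: "(a + c1 * s) * g + (b + c2 * s) * h = 0" using abc(4) unfolding c12 by (simp add: algebra_simps)
  have red: False if "a \<in> A" "b \<in> A" "c1 \<in> A" "c2 \<in> A" "(a + c1 * s) * g + (b + c2 * s) * h = 0"
    "a \<notin> m" "F = span2 A g h" for a b c1 c2 g h
  proof -
    have un: "a + c1 * s \<in> A" "a + c1 * s \<notin> m"
      using local_ring_unit_plus[OF A that(1,6), of "c1 * s"] submodule_smult[OF mm that(3) s] by auto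
    then have "a + c1 * s \<noteq> 0" using local_ringD(7)[OF A] by blast
    then have "g = h * (- (b + c2 * s) / (a + c1 * s))" using that(5) by (simp add: field_simps eq_neg_iff_add_eq_0)
    moreover have "- (b + c2 * s) / (a + c1 * s) \<in> A"
      using that sA by (intro local_ring_div[OF A] subring_closed[OF sr] un)
    ultimately show False using notin[of g h] that(7) by blast
  qed
  have "a \<in> m" using red[OF abc(1,2) c12(1,2) e _ gh] by blast
  moreover have "b \<in> m" using red[OF abc(2,1) c12(2,1) _ _ gh[unfolded span2_swap[of A g h]]] e by (auto simp: add.commute)
  moreover have "c \<in> m" using cF Fm by auto
  ultimately show False using u by blast
qed

text \<open>It suffices to treat a ring \<open>S = A + Ay\<close>. Its conductor
  \<open>F = (A : S)\<close> is a multiple of a ring \<open>T = A + Ay'\<close> containing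
  \<open>S\<close>, which forces \<open>S_v\<close> into \<open>T\<close>. In
  \<open>y = r + s y'\<close> a unit \<open>s\<close> gives \<open>T = S\<close>; for
  \<open>s\<close> in \<open>m\<close> the equality \<open>(A : S) = (A : T)\<close> makes
  \<open>s\<close> regular modulo \<open>F\<close>, so \<open>F = A\<close> and
  \<open>T = A\<close>.\<close>

lemma two_gen_local_divisorial:
  assumes A: "local_ring A m" and tg: "two_gen_ring A"
  shows "divisorial_domain A"
proof (rule divisorial_domainI)
  note sr = local_ringD(2)[OF A] and mm = local_ringD(3)[OF A]
  show "is_subring A" by (rule sr)
  have refl: "v_cl A (span2 A 1 y) \<subseteq> span2 A 1 y" if S: "is_subring (span2 A 1 y)" for y
  proof -
    let ?S = "span2 A 1 y"
    define F where "F = colon A ?S"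
    have AS: "A \<subseteq> ?S" using span2_gens(1)[OF sr] submodule_smult'[OF submodule_span2[OF sr], of _ 1] by force
    have colS: "x \<in> colon A (span2 A 1 z) \<longleftrightarrow> x \<in> A \<and> x * z \<in> A" for x z
    proof
      assume "x \<in> colon A (span2 A 1 z)"
      then show "x \<in> A \<and> x * z \<in> A" using span2_gens(1)[OF sr, of 1 z] span2_gens(2)[OF sr, of z 1] by (force simp: colon_def)
    next
      assume "x \<in> A \<and> x * z \<in> A"
      moreover have "x * (1 * p + z * q) = x * p + (x * z) * q" for p q by (simp add: algebra_simps)
      ultimately show "x \<in> colon A (span2 A 1 z)"
        unfolding colon_def span2_def using subring_add[OF sr] subring_mult[OF sr] by auto
    qed
    have F: "F = {x \<in> A. x * y \<in> A}" unfolding F_def using colS by auto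
    have sF: "submodule_of A F" unfolding F_def by (rule submodule_colon[OF sr])
    obtain d where d: "d \<in> A" "d \<noteq> 0" "d * y \<in> A" using qdom_denom[OF local_ringD(1)[OF A]] by blast
    have nzF: "nz_ideal A F" unfolding nz_ideal_def ideal_of_def using sF d unfolding F by blast
    have SF: "x * z \<in> F" if "x \<in> F" "z \<in> ?S" for x z
      using that subring_mult[OF S that(2)] unfolding F_def colon_def by (auto simp: mult.assoc)
    obtain g y' where g: "g \<noteq> 0" and S': "is_subring (span2 A 1 y')" and Fg: "F = (*) g ` span2 A 1 y'"
      using ideal_eq_ring_multiple[OF A tg nz_ideal_frac[OF sr nzF]] by blast
    let ?T = "span2 A 1 y'"
    have ST: "?S \<subseteq> ?T"
    proof
      fix z assume "z \<in> ?S"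
      moreover have "g * 1 \<in> F" unfolding Fg using span2_gens(1)[OF sr] by blast
      ultimately have "g * 1 * z \<in> F" using SF by blast
      then show "z \<in> ?T" unfolding Fg using g by auto
    qed
    have FT: "F = colon A ?T"
    proof
      show "colon A ?T \<subseteq> F" unfolding F_def by (rule colon_antimono[OF ST])
      show "F \<subseteq> colon A ?T"
      proof
        fix x assume "x \<in> F"
        then obtain t where t: "x = g * t" "t \<in> ?T" unfolding Fg by auto
        have "x * z \<in> F" if "z \<in> ?T" for z
          unfolding Fg t using subring_mult[OF S' t(2) that] by (auto simp: mult.assoc)
        then show "x \<in> colon A ?T" using F by (auto simp: colon_def)
      qed
    qed
    have vS: "v_cl A ?S \<subseteq> ?T"
    proof
      fix x assume x: "x \<in> v_cl A ?S"
      have "g * x \<in> F"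
        unfolding FT colon_def
      proof (intro CollectI ballI)
        fix z assume "z \<in> ?T"
        then have "g * z \<in> colon A ?S" using Fg F_def by auto
        then have "x * (g * z) \<in> A" using x by (blast intro: v_clD)
        then show "g * x * z \<in> A" by (simp add: mult_ac)
      qed
      then show "x \<in> ?T" unfolding Fg using g by auto
    qed
    have "y \<in> ?T" using ST span2_gens(2)[OF sr] by auto
    then obtain r s where rs: "r \<in> A" "s \<in> A" "y = 1 * r + y' * s" unfolding span2_def by blast
    have F': "F = {x \<in> A. x * y' \<in> A}" unfolding FT using colS by auto
    have "y' \<in> ?S"
    proof (cases "s \<in> m")
      case False
      have "s \<noteq> 0" using local_ringD(7)[OF A] rs False by blast
      then have "y' = 1 * - (r / s) + y * (1 / s)" using rs by (simp add: field_simps)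
      then show ?thesis
        by (rule span2I[rotated 2]) (use rs sr False in \<open>auto intro!: local_ring_div[OF A] subring_uminus[OF sr] intro: subring_closed\<close>)
    next
      case True
      have "x \<in> F" if "x \<in> A" "s * x \<in> F" for x
      proof -
        have "s * x * y' \<in> A" using that F' by blast
        moreover have "x * y = x * r + s * x * y'" using rs by (simp add: algebra_simps)
        ultimately have "x * y \<in> A" using subring_add[OF sr] subring_mult[OF sr that(1) rs(1)] by simp
        then show ?thesis using F that by blast
      qed
      then have "F = A" using regular_mod_ideal[OF A tg nzF True] by blast
      then have "1 * y' \<in> A" using F' subring_one[OF sr] by blast
      then show ?thesis using AS by auto
    qed
    then have "?T \<subseteq> ?S" by (intro span2_least[OF submodule_span2[OF sr]] span2_gens sr)
    then show ?thesis using vS by blast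
  qed
  fix I assume "nz_ideal A I"
  then obtain g y where g: "g \<noteq> 0" "is_subring (span2 A 1 y)" "I = (*) g ` span2 A 1 y"
    using ideal_eq_ring_multiple[OF A tg] nz_ideal_frac[OF sr] by blast
  show "v_cl A I \<subseteq> I"
  proof
    fix x assume "x \<in> v_cl A I"
    then have "(1 / g) * x \<in> v_cl A ((*) (1 / g) ` I)" by (rule v_cl_mult)
    moreover have "(*) (1 / g) ` I = span2 A 1 y" using g by (auto simp: image_image)
    ultimately have "(1 / g) * x \<in> span2 A 1 y" using refl[OF g(2)] by auto
    then show "x \<in> I" unfolding g(3) using g(1) by (auto intro!: image_eqI[of _ _ "(1 / g) * x"])
  qed
qed

text \<open>The ideals of all \<open>x\<close> with \<open>s ^ n * x\<close> in \<open>aA\<close>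
  ascend with \<open>n\<close>, and their union has two generators, so they become stationary.
  Modulo the stationary ideal \<open>s\<close> is regular, hence that ideal is \<open>A\<close> and
  contains \<open>1\<close>.\<close>

lemma two_gen_local_one_dim:
  assumes A: "local_ring A m" and tg: "two_gen_ring A"
  shows "one_dim A m"
  unfolding one_dim_def
proof (intro ballI impI)
  note sr = local_ringD(2)[OF A] and mm = local_ringD(3)[OF A]
  fix s a assume s: "s \<in> m" and a: "a \<in> A" "a \<noteq> 0"
  have sA: "s \<in> A" using s local_ringD(4)[OF A] by auto
  define F where "F n = {x \<in> A. \<exists>z\<in>A. s ^ n * x = a * z}" for n :: nat
  have sF: "submodule_of A (F n)" for n
    unfolding submodule_of_def F_def
  proof (intro conjI ballI; clarsimp)
    show "0 \<in> A \<and> (\<exists>z\<in>A. a = 0 \<or> z = 0)" using sr by (auto intro: subring_closed)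
    { fix x z y z' assume *: "x \<in> A" "y \<in> A" "s ^ n * x = a * z" "z \<in> A" "s ^ n * y = a * z'" "z' \<in> A"
      show "x + y \<in> A \<and> (\<exists>z\<in>A. s ^ n * (x + y) = a * z)"
        using * sr by (auto intro!: bexI[of _ "z + z'"] intro: subring_closed simp: distrib_left) }
    { fix r x z assume *: "r \<in> A" "x \<in> A" "s ^ n * x = a * z" "z \<in> A"
      show "r * x \<in> A \<and> (\<exists>z\<in>A. s ^ n * (r * x) = a * z)"
        using * sr by (auto intro!: bexI[of _ "r * z"] intro: subring_closed simp: mult.left_commute) }
  qed
  have aF: "a \<in> F n" for n unfolding F_def using a sA sr by (auto intro!: bexI[of _ "s ^ n"] intro: subring_closed simp: mult.commute)
  have step: "F n \<subseteq> F (Suc n)" for n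
    unfolding F_def
  proof clarsimp
    fix x z assume *: "x \<in> A" "s ^ n * x = a * z" "z \<in> A"
    then have "s * s ^ n * x = a * (s * z)" by (simp add: mult_ac)
    then show "\<exists>z\<in>A. s * s ^ n * x = a * z" using * sA sr subring_mult by blast
  qed
  have mono: "F i \<subseteq> F j" if "i \<le> j" for i j using lift_Suc_mono_le[of F, OF step that] .
  have "nz_ideal A (\<Union>n. F n)"
    unfolding nz_ideal_def ideal_of_def
  proof (intro conjI)
    show "(\<Union>n. F n) \<subseteq> A" by (auto simp: F_def)
    show "(\<Union>n. F n) \<noteq> {0}" using aF a by blast
    show "submodule_of A (\<Union>n. F n)"
    proof (rule submodule_Union_directed)
      fix X Y assume "X \<in> range F" "Y \<in> range F"
      then obtain i j where "X = F i" "Y = F j" by blast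
      then show "\<exists>Z\<in>range F. X \<subseteq> Z \<and> Y \<subseteq> Z"
        using mono[of i "max i j"] mono[of j "max i j"] by (intro bexI[of _ "F (max i j)"]) auto
    qed (use sF in auto)
  qed
  then obtain u v where uv: "(\<Union>n. F n) = span2 A u v" using tg by (auto simp: two_gen_ring_def)
  then obtain i j where "u \<in> F i" "v \<in> F j" using span2_gens[OF sr, where a=u and b=v] by blast
  then have "u \<in> F (max i j)" "v \<in> F (max i j)" using mono[of i "max i j"] mono[of j "max i j"] by auto
  then have top: "(\<Union>n. F n) \<subseteq> F (max i j)" unfolding uv by (intro span2_least[OF sF])
  let ?N = "max i j"
  have "x \<in> F ?N" if "x \<in> A" "s * x \<in> F ?N" for x
  proof -
    have "x \<in> F (Suc ?N)" using that unfolding F_def by (auto simp: mult_ac)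
    then show ?thesis using top by blast
  qed
  moreover have "nz_ideal A (F ?N)"
    unfolding nz_ideal_def ideal_of_def using sF aF[of ?N] a by (auto simp: F_def)
  ultimately have "F ?N = A" using regular_mod_ideal[OF A tg _ s] by blast
  then have "1 \<in> F ?N" using subring_one[OF sr] by auto
  then show "\<exists>k. \<exists>z\<in>A. s ^ k = a * z" unfolding F_def by auto
qed

subsection \<open>Chains of submodules\<close>

definition adjoin :: "'a::field set \<Rightarrow> 'a set \<Rightarrow> 'a \<Rightarrow> 'a set" where
  "adjoin A X c = {x + r * c | x r. x \<in> X \<and> r \<in> A}"

lemma adjoinI: "x \<in> X \<Longrightarrow> r \<in> A \<Longrightarrow> z = x + r * c \<Longrightarrow> z \<in> adjoin A X c"
  by (auto simp: adjoin_def)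

lemma adjoin_submodule:
  assumes A: "is_subring A" and X: "submodule_of A X" shows "submodule_of A (adjoin A X c)"
  unfolding submodule_of_def
proof (intro conjI ballI)
  show "0 \<in> adjoin A X c"
    using submodule_zero[OF X] subring_zero[OF A] by (intro adjoinI[of 0 _ 0]) auto
  fix u assume "u \<in> adjoin A X c"
  then obtain x r where u: "x \<in> X" "r \<in> A" "u = x + r * c" by (auto simp: adjoin_def)
  { fix v assume "v \<in> adjoin A X c"
    then obtain y s where v: "y \<in> X" "s \<in> A" "v = y + s * c" by (auto simp: adjoin_def)
    then show "u + v \<in> adjoin A X c"
      using u submodule_add[OF X] subring_add[OF A] by (intro adjoinI[of "x + y" _ "r + s"]) (auto simp: algebra_simps) }
  { fix s assume "s \<in> A"
    then show "s * u \<in> adjoin A X c"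
      using u submodule_smult[OF X] subring_mult[OF A] by (intro adjoinI[of "s * x" _ "s * r"]) (auto simp: algebra_simps) }
qed

lemma adjoin_upper: "is_subring A \<Longrightarrow> X \<subseteq> adjoin A X c"
  by (rule subsetI, rule adjoinI[of _ _ 0]) (auto intro: subring_closed)

lemma adjoin_elem: "is_subring A \<Longrightarrow> submodule_of A X \<Longrightarrow> c \<in> adjoin A X c"
  by (rule adjoinI[of 0 _ 1]) (auto intro: subring_closed submodule_zero)

lemma adjoin_least: "submodule_of A Y \<Longrightarrow> X \<subseteq> Y \<Longrightarrow> c \<in> Y \<Longrightarrow> adjoin A X c \<subseteq> Y"
  by (auto simp: adjoin_def intro: submodule_add submodule_smult)

lemma adjoin_image: "(*) h ` adjoin A X c = adjoin A ((*) h ` X) (h * c)"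
proof (intro equalityI subsetI)
  fix z assume "z \<in> (*) h ` adjoin A X c"
  then obtain x r where "x \<in> X" "r \<in> A" "z = h * (x + r * c)" by (auto simp: adjoin_def)
  then show "z \<in> adjoin A ((*) h ` X) (h * c)" by (intro adjoinI[of "h * x" _ r]) (auto simp: algebra_simps)
next
  fix z assume "z \<in> adjoin A ((*) h ` X) (h * c)"
  then obtain x r where "x \<in> X" "r \<in> A" "z = h * x + r * (h * c)" by (auto simp: adjoin_def)
  then have "z = h * (x + r * c)" "x + r * c \<in> adjoin A X c"
    by (simp add: algebra_simps) (rule adjoinI[OF \<open>x \<in> X\<close> \<open>r \<in> A\<close> HOL.refl])
  then show "z \<in> (*) h ` adjoin A X c" by blast
qed

inductive strict_chain :: "'a::field set \<Rightarrow> nat \<Rightarrow> 'a set \<Rightarrow> 'a set \<Rightarrow> bool" for A where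
  refl: "submodule_of A X \<Longrightarrow> strict_chain A 0 X X"
| step: "strict_chain A k X Y \<Longrightarrow> Y \<subset> Z \<Longrightarrow> submodule_of A Z \<Longrightarrow> strict_chain A (Suc k) X Z"

text \<open>Each factor of a simple chain is zero or isomorphic to \<open>A / m\<close>, so \<open>n\<close> bounds the length.\<close>
inductive simple_chain :: "'a::field set \<Rightarrow> 'a set \<Rightarrow> nat \<Rightarrow> 'a set \<Rightarrow> 'a set \<Rightarrow> bool" for A m where
  refl: "simple_chain A m 0 X X"
| step: "simple_chain A m n X Y \<Longrightarrow> submodule_of A Y \<Longrightarrow> \<forall>r\<in>m. r * c \<in> Y \<Longrightarrow> simple_chain A m (Suc n) X (adjoin A Y c)"

lemma strict_chain_submodule: "strict_chain A k X Y \<Longrightarrow> submodule_of A X \<and> submodule_of A Y \<and> X \<subseteq> Y"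
  by (induction rule: strict_chain.induct) auto

lemma simple_chain_subset: "simple_chain A m n X Y \<Longrightarrow> is_subring A \<Longrightarrow> X \<subseteq> Y"
  by (induction rule: simple_chain.induct) (use adjoin_upper in blast)+

lemma strict_chain_trans: "strict_chain A l Y Z \<Longrightarrow> strict_chain A k X Y \<Longrightarrow> strict_chain A (k + l) X Z"
  by (induction rule: strict_chain.induct) (auto intro: strict_chain.step)

lemma simple_chain_trans: "simple_chain A m l Y Z \<Longrightarrow> simple_chain A m k X Y \<Longrightarrow> simple_chain A m (k + l) X Z"
  by (induction rule: simple_chain.induct) (auto intro: simple_chain.step)

lemma strict_chain_mult:
  "strict_chain A k X Y \<Longrightarrow> h \<noteq> 0 \<Longrightarrow> strict_chain A k ((*) h ` X) ((*) h ` Y)"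
proof (induction rule: strict_chain.induct)
  case (refl X) then show ?case by (intro strict_chain.refl submodule_mult_image)
next
  case (step k X Y Z)
  have "inj_on ((*) h) Z" using \<open>h \<noteq> 0\<close> by (simp add: inj_on_def)
  then have "(*) h ` Y \<subset> (*) h ` Z" using step(2) by (rule image_strict_mono)
  then show ?case using step by (intro strict_chain.step submodule_mult_image) auto
qed

lemma simple_chain_mult:
  "simple_chain A m n X Y \<Longrightarrow> simple_chain A m n ((*) h ` X) ((*) h ` Y)"
proof (induction rule: simple_chain.induct)
  case (refl X) then show ?case by (intro simple_chain.refl)
next
  case (step n X Y c)
  have "\<forall>r\<in>m. r * (h * c) \<in> (*) h ` Y" 
    using step(3) by (auto simp: mult.left_commute)
  then show ?case unfolding adjoin_image using step by (intro simple_chain.step submodule_mult_image) auto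
qed

text \<open>Modular law: intersecting with \<open>C\<close> can identify only one pair of consecutive members of
  a chain below a simple extension of \<open>C\<close>.\<close>
lemma strict_chain_Int:
  assumes A: "local_ring A m" and C: "submodule_of A C" "\<forall>r\<in>m. r * c \<in> C"
  shows "strict_chain A k X Y \<Longrightarrow> Y \<subseteq> adjoin A C c \<Longrightarrow>
    \<exists>k'. strict_chain A k' (X \<inter> C) (Y \<inter> C) \<and> k \<le> Suc k' \<and> (Y \<subseteq> C \<longrightarrow> k \<le> k')"
proof (induction rule: strict_chain.induct)
  case (refl X)
  then show ?case by (intro exI[of _ 0]) (auto intro: strict_chain.refl submodule_Int C)
next
  case (step k X Y Z)
  note sr = local_ringD(2)[OF A]
  obtain k' where k': "strict_chain A k' (X \<inter> C) (Y \<inter> C)" "k \<le> Suc k'" "Y \<subseteq> C \<longrightarrow> k \<le> k'"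
    using step by blast
  have sY: "submodule_of A Y" using strict_chain_submodule[OF step(1)] by blast
  have sZC: "submodule_of A (Z \<inter> C)" using step by (intro submodule_Int C)
  have strict: "strict_chain A (Suc k') (X \<inter> C) (Z \<inter> C)" if "Y \<inter> C \<noteq> Z \<inter> C"
    using that step by (intro strict_chain.step[OF k'(1) _ sZC]) blast
  \<comment> \<open>As long as \<open>Y\<close> stays inside \<open>C\<close> no link has been lost,
    which is why the last conjunct is carried along. The one possible loss is at the step where the
    chain leaves \<open>C\<close>.\<close>
  show ?case
  proof (cases "Y \<subseteq> C")
    case True
    show ?thesis
    proof (cases "Y \<inter> C = Z \<inter> C")
      case eq: True
      then have "\<not> Z \<subseteq> C" using True step(2) by blast
      then show ?thesis using k' True eq by (intro exI[of _ k']) auto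
    next
      case False
      then show ?thesis using strict k' True by (intro exI[of _ "Suc k'"]) auto
    qed
  next
    case False
    then obtain y where y: "y \<in> Y" "y \<notin> C" by blast
    have "Y \<inter> C \<noteq> Z \<inter> C"
    proof
      assume eq: "Y \<inter> C = Z \<inter> C"
      obtain z where z: "z \<in> Z" "z \<notin> Y" using step by blast
      obtain d r where d: "d \<in> C" "r \<in> A" "y = d + r * c" using y step unfolding adjoin_def by blast
      obtain d' r' where d': "d' \<in> C" "r' \<in> A" "z = d' + r' * c" using z step unfolding adjoin_def by blast
      \<comment> \<open>Since \<open>y\<close> is outside \<open>C\<close>, its coefficient at
        \<open>c\<close> is a unit, so subtracting a suitable multiple of \<open>y\<close> from
        \<open>z\<close> lands in \<open>C\<close>.\<close>
      have "r \<notin> m" using d y C submodule_add[OF C(1)] by blast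
      then have r0: "r \<noteq> 0" and q: "r' / r \<in> A" using local_ringD(7)[OF A] d d' local_ring_div[OF A] by auto
      have "z - r' / r * y = d' - r' / r * d" using r0 d d' by (simp add: field_simps)
      moreover have "z - r' / r * y \<in> Z"
        using z y step q by (intro submodule_diff[OF sr step(3)] submodule_smult[OF step(3)]) auto
      moreover have "d' - r' / r * d \<in> C"
        using d d' q by (intro submodule_diff[OF sr C(1)] submodule_smult[OF C(1)])
      ultimately have "z - r' / r * y \<in> Y" using eq by auto
      then have "(z - r' / r * y) + r' / r * y \<in> Y"
        using y q by (intro submodule_add[OF sY] submodule_smult[OF sY])
      then show False using z by simp
    qed
    then show ?thesis using strict k' False step(2) by (intro exI[of _ "Suc k'"]) auto
  qed
qed

text \<open>A Jordan-Hoelder bound: intersecting with the next lower member of the simple chain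
  costs at most one link, and induction along that chain counts the losses.\<close>

lemma strict_chain_length:
  assumes A: "local_ring A m"
  shows "simple_chain A m n X C \<Longrightarrow> strict_chain A k X' Y \<Longrightarrow> X \<subseteq> X' \<Longrightarrow> Y \<subseteq> C \<Longrightarrow> k \<le> n"
proof (induction arbitrary: k X' Y rule: simple_chain.induct)
  case (refl X)
  show ?case using refl(1)
  proof cases
    case (step k Y')
    then show ?thesis using strict_chain_submodule[of A k X' Y'] refl by blast
  qed simp
next
  case (step n X C c)
  obtain k' where k': "strict_chain A k' (X' \<inter> C) (Y \<inter> C)" "k \<le> Suc k'"
    using strict_chain_Int[OF A step(2,3) step(5) step(7)] by blast
  have "X \<subseteq> C" using simple_chain_subset[OF step(1) local_ringD(2)[OF A]] .
  then have "k' \<le> n" using step.IH[OF k'(1)] step(6) by blast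
  then show ?case using k' by auto
qed

subsection \<open>One-dimensional divisorial local rings\<close>

text \<open>The intermediate member is \<open>A\<close>: both \<open>A / m\<close> and
  \<open>(A + Ay) / A\<close> are killed by \<open>m\<close> and generated by one element.\<close>

lemma simple_chain_span2:
  assumes A: "local_ring A m" and y: "\<And>r. r \<in> m \<Longrightarrow> r * y \<in> A"
  shows "simple_chain A m 2 m (span2 A 1 y)"
proof -
  note sr = local_ringD(2)[OF A] and mm = local_ringD(3)[OF A]
  have 1: "adjoin A m 1 = A"
  proof
    show "adjoin A m 1 \<subseteq> A" using local_ringD[OF A] by (intro adjoin_least submodule_self) (auto intro: subring_closed)
    show "A \<subseteq> adjoin A m 1" using submodule_zero[OF mm] by (intro subsetI adjoinI[of 0]) auto
  qed
  have 2: "adjoin A A y = span2 A 1 y"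
    unfolding adjoin_def span2_def by (auto simp: mult.commute)
  have "simple_chain A m 1 m (adjoin A m 1)" using simple_chain.step[OF simple_chain.refl mm, of m 1] by auto
  then have "simple_chain A m 2 m (adjoin A A y)"
    unfolding 1 using simple_chain.step[of A m 1 m A y] y submodule_self[OF sr] by (simp add: numeral_2_eq_2)
  then show ?thesis unfolding 2 .
qed

text \<open>If \<open>I / hI\<close> had length three or more, powers of \<open>h\<close> would give
  strict chains of length \<open>3 * n\<close> from \<open>h ^ n I\<close> to \<open>I\<close>,
  against simple chains of length \<open>2 * n\<close> from \<open>h ^ n B\<close> to
  \<open>B\<close>, where \<open>B = A + Ay\<close>. As \<open>I\<close> contains some
  \<open>h ^ e B\<close>, the growth rates conflict. Powers of \<open>h\<close> also lift generators
  modulo \<open>hI\<close> to generators of \<open>I\<close>.\<close>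

lemma two_gen_of_module:
  assumes A: "local_ring A m" and od: "one_dim A m"
    and m: "m = (*) h ` span2 A 1 y" and h0: "h \<noteq> 0" and y: "\<And>r. r \<in> m \<Longrightarrow> r * y \<in> A"
    and I: "nz_ideal A I" and BI: "\<And>b x. b \<in> span2 A 1 y \<Longrightarrow> x \<in> I \<Longrightarrow> b * x \<in> I"
  shows "\<exists>a b. I = span2 A a b"
proof -
  note sr = local_ringD(2)[OF A] and mm = local_ringD(3)[OF A]
  let ?B = "span2 A 1 y"
  have sI: "submodule_of A I" and IA: "I \<subseteq> A" and I0: "I \<noteq> {0}" using I by (auto simp: nz_ideal_def ideal_of_def)
  have "h * 1 \<in> m" unfolding m using span2_gens(1)[OF sr] by blast
  then have hm: "h \<in> m" by simp
  then have hA: "h \<in> A" using local_ringD(4)[OF A] by auto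
  have AB: "A \<subseteq> ?B" using span2_gens(1)[OF sr] submodule_smult'[OF submodule_span2[OF sr], of _ 1] by force
  have sB: "submodule_of A ?B" by (rule submodule_span2[OF sr])
  have pw: "(*) h ` (*) (h ^ n) ` X = (*) (h ^ Suc n) ` X" "(*) (h ^ n) ` (*) h ` X = (*) (h ^ Suc n) ` X" for n X
    by (auto simp: image_image mult.assoc power_commutes[symmetric])
  have simp_chain: "simple_chain A m (2 * n) ((*) (h ^ n) ` ?B) ?B" for n
  proof (induction n)
    case 0 then show ?case by (simp add: simple_chain.refl)
  next
    case (Suc n)
    have "simple_chain A m 2 ((*) h ` ?B) ?B" using simple_chain_span2[OF A y] unfolding m[symmetric] .
    then have "simple_chain A m 2 ((*) (h ^ Suc n) ` ?B) ((*) (h ^ n) ` ?B)"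
      using simple_chain_mult[of A m 2 "(*) h ` ?B" ?B "h ^ n"] pw by simp
    from simple_chain_trans[OF Suc.IH this] show ?case by simp
  qed
  obtain p where p: "p \<in> I" "p \<noteq> 0" using nz_elem[OF sI I0] by blast
  then have pA: "p \<in> A" using IA by auto
  have "\<exists>x1\<in>I. \<exists>x2\<in>I. I \<subseteq> adjoin A (adjoin A ((*) h ` I) x1) x2"
  proof (rule ccontr)
    assume no: "\<not> ?thesis"
    let ?D0 = "(*) h ` I"
    have s0: "submodule_of A ?D0" by (rule submodule_mult_image[OF sI])
    have ex: "\<exists>x3\<in>I. x3 \<notin> adjoin A (adjoin A ?D0 x1) x2" if "x1 \<in> I" "x2 \<in> I" for x1 x2 using no that by blast
    have zI: "0 \<in> I" using submodule_zero[OF sI] .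
    obtain x1 where x1: "x1 \<in> I" "x1 \<notin> ?D0" using ex[OF zI zI] adjoin_upper[OF sr] by blast
    define D1 where "D1 = adjoin A ?D0 x1"
    obtain x2 where x2: "x2 \<in> I" "x2 \<notin> D1" using ex[OF x1(1) zI] adjoin_upper[OF sr] unfolding D1_def by blast
    define D2 where "D2 = adjoin A D1 x2"
    obtain x3 where x3: "x3 \<in> I" "x3 \<notin> D2" using ex[OF x1(1) x2(1)] unfolding D1_def D2_def by blast
    have s1: "submodule_of A D1" and s2: "submodule_of A D2" unfolding D1_def D2_def by (intro adjoin_submodule sr s0)+
    have D0I: "?D0 \<subseteq> I" using submodule_smult[OF sI hA] by auto
    have l1: "?D0 \<subset> D1" unfolding D1_def using adjoin_upper[OF sr, of ?D0 x1] adjoin_elem[OF sr s0, of x1] x1 by blast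
    have l2: "D1 \<subset> D2" unfolding D2_def using adjoin_upper[OF sr, of D1 x2] adjoin_elem[OF sr s1, of x2] x2 by blast
    have D1I: "D1 \<subseteq> I" unfolding D1_def by (intro adjoin_least sI D0I x1)
    have D2I: "D2 \<subseteq> I" unfolding D2_def by (intro adjoin_least sI D1I x2)
    have l3: "D2 \<subset> I" using D2I x3 by blast
    have c3: "strict_chain A 3 ?D0 I"
      using strict_chain.step[OF strict_chain.step[OF strict_chain.step[OF strict_chain.refl[OF s0] l1 s1] l2 s2] l3 sI]
      by (simp add: numeral_3_eq_3)
    have cn: "strict_chain A (3 * n) ((*) (h ^ n) ` I) I" for n
    proof (induction n)
      case 0 then show ?case by (simp add: strict_chain.refl[OF sI])
    next
      case (Suc n)
      have "strict_chain A 3 ((*) (h ^ Suc n) ` I) ((*) (h ^ n) ` I)"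
        using strict_chain_mult[OF c3, of "h ^ n"] h0 pw by simp
      from strict_chain_trans[OF Suc.IH this] show ?case by simp
    qed
    obtain e z where e: "h ^ e = p * z" "z \<in> A" using od hm pA p unfolding one_dim_def by blast
    have "(*) (h ^ e) ` ?B \<subseteq> I"
    proof
      fix x assume "x \<in> (*) (h ^ e) ` ?B"
      then obtain b where b: "b \<in> ?B" "x = h ^ e * b" by auto
      then have "x = z * (b * p)" using e by (simp add: mult_ac)
      then show "x \<in> I" using BI[OF b(1) p(1)] submodule_smult[OF sI e(2)] by simp
    qed
    \<comment> \<open>The exponent \<open>2 * e + 1\<close> is chosen so that the strict chain has
      \<open>6 * e + 3\<close> links, one more than the \<open>2 * (3 * e + 1)\<close> allowed
      between \<open>h ^ (3 * e + 1) B\<close> and \<open>B\<close>.\<close>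
    then have "(*) (h ^ (2 * e + 1)) ` (*) (h ^ e) ` ?B \<subseteq> (*) (h ^ (2 * e + 1)) ` I" by (rule image_mono)
    moreover have "(*) (h ^ (2 * e + 1)) ` (*) (h ^ e) ` ?B = (*) (h ^ (3 * e + 1)) ` ?B"
    proof -
      have "h ^ (2 * e + 1) * h ^ e = h ^ (2 * e + 1 + e)" by (simp only: power_add)
      also have "2 * e + 1 + e = 3 * e + 1" by simp
      finally have "h ^ (2 * e + 1) * h ^ e = h ^ (3 * e + 1)" .
      then show ?thesis unfolding image_image mult.assoc[symmetric] by (simp only:)
    qed
    ultimately have sub: "(*) (h ^ (3 * e + 1)) ` ?B \<subseteq> (*) (h ^ (2 * e + 1)) ` I" by simp
    have "3 * (2 * e + 1) \<le> 2 * (3 * e + 1)"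
      by (rule strict_chain_length[OF A simp_chain cn sub]) (use IA AB in blast)
    then show False by simp
  qed
  then obtain x1 x2 where x: "x1 \<in> I" "x2 \<in> I" and cov: "I \<subseteq> adjoin A (adjoin A ((*) h ` I) x1) x2" by blast
  have cov': "\<exists>u\<in>span2 A x1 x2. \<exists>z\<in>I. x = u + h * z" if xI: "x \<in> I" for x
  proof -
    obtain z r s where "z \<in> I" "r \<in> A" "s \<in> A" "x = (h * z + r * x1) + s * x2"
      using cov xI unfolding adjoin_def by blast
    then show ?thesis
      by (intro bexI[of _ "x1 * r + x2 * s"] bexI[of _ z] span2I[of r _ s]) (auto simp: algebra_simps)
  qed
  \<comment> \<open>The span must contain a nonzero \<open>q\<close> for the dimension argument
    below. If both generators vanish, \<open>p\<close> and \<open>0\<close> are taken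
    instead.\<close>
  obtain x1' x2' where x': "x1' \<in> I" "x2' \<in> I" "x1' \<noteq> 0 \<or> x2' \<noteq> 0"
    and c1: "\<And>x. x \<in> I \<Longrightarrow> \<exists>u\<in>span2 A x1' x2'. \<exists>z\<in>I. x = u + h * z"
  proof (cases "x1 = 0 \<and> x2 = 0")
    case True
    have "\<exists>u\<in>span2 A p 0. \<exists>z\<in>I. x = u + h * z" if "x \<in> I" for x
    proof -
      obtain u z where "u \<in> span2 A x1 x2" "z \<in> I" "x = u + h * z" using cov'[OF \<open>x \<in> I\<close>] by blast
      moreover have "u = 0" using \<open>u \<in> _\<close> True by (auto simp: span2_def)
      ultimately show ?thesis using submodule_zero[OF submodule_span2[OF sr]] by blast
    qed
    then show ?thesis using that[of p 0] p submodule_zero[OF sI] by blast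
  next
    case False
    then show ?thesis using that[of x1 x2] x cov' by blast
  qed
  let ?J = "span2 A x1' x2'"
  have sJ: "submodule_of A ?J" by (rule submodule_span2[OF sr])
  have JI: "?J \<subseteq> I" by (intro span2_least sI x')
  have cn: "x \<in> I \<Longrightarrow> \<exists>u\<in>?J. \<exists>z\<in>I. x = u + h ^ n * z" for x n
  proof (induction n)
    case 0 then show ?case using submodule_zero[OF sJ] by force
  next
    case (Suc n)
    then obtain u z where u: "u \<in> ?J" "z \<in> I" "x = u + h ^ n * z" by blast
    obtain u' z' where u': "u' \<in> ?J" "z' \<in> I" "z = u' + h * z'" using c1[OF u(2)] by blast
    have "x = (u + h ^ n * u') + h ^ Suc n * z'" using u u' by (simp add: algebra_simps)
    moreover have "u + h ^ n * u' \<in> ?J"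
      using u u' hA by (intro submodule_add[OF sJ] submodule_smult[OF sJ] subring_power[OF sr])
    ultimately show ?case using u' by blast
  qed
  obtain q where q: "q \<in> ?J" "q \<noteq> 0" using x'(3) span2_gens[OF sr] by metis
  then have "q \<in> A" using JI IA by auto
  then obtain e w where e: "h ^ e = q * w" "w \<in> A" using od hm q unfolding one_dim_def by blast
  have "I \<subseteq> ?J"
  proof
    fix x assume "x \<in> I"
    then obtain u z where u: "u \<in> ?J" "z \<in> I" "x = u + h ^ e * z" using cn[of x e] by blast
    have "x = u + (w * z) * q" using u e by (simp add: mult_ac)
    moreover have "w * z \<in> A" using e u IA by (auto intro: subring_mult[OF sr])
    ultimately show "x \<in> ?J" using submodule_add[OF sJ u(1)] submodule_smult[OF sJ _ q(1)] by simp
  qed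
  then show ?thesis using JI by blast
qed

lemma nz_frac_ideal_span2:
  assumes "qdom A" shows "nz_frac_ideal A (span2 A 1 y)"
proof -
  note sr = qdom_subring[OF assms]
  obtain d where d: "d \<in> A" "d \<noteq> 0" "d * y \<in> A" using qdom_denom[OF assms] by blast
  have "d * x \<in> A" if x: "x \<in> span2 A 1 y" for x
  proof -
    obtain p q where pq: "p \<in> A" "q \<in> A" "x = 1 * p + y * q" using x unfolding span2_def by blast
    then have "d * x = d * p + (d * y) * q" by (simp add: algebra_simps)
    then show ?thesis using d pq by (auto intro: subring_add[OF sr] subring_mult[OF sr])
  qed
  moreover have "span2 A 1 y \<noteq> {0}" using span2_gens(1)[OF sr, of 1 y] by auto
  ultimately show ?thesis unfolding nz_frac_ideal_def using submodule_span2[OF sr] d by blast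
qed

text \<open>A unit \<open>x\<close> with \<open>x * y\<close> in \<open>A\<close> would put
  \<open>y\<close> into \<open>A\<close>; so \<open>(A : A + Ay) = m\<close>, and since
  \<open>A + Ay\<close> is divisorial a second inverse returns it. Any element outside
  \<open>A\<close> can therefore serve as the second generator.\<close>

lemma colon_maximal_ideal_eq:
  assumes A: "local_ring A m" and dd: "divisorial_domain A" and y: "y \<in> colon A m" "y \<notin> A"
  shows "colon A m = span2 A 1 y"
proof -
  note sr = local_ringD(2)[OF A] and mm = local_ringD(3)[OF A]
  have "colon A (span2 A 1 y) = m"
  proof (intro equalityI subsetI)
    fix x assume "x \<in> colon A (span2 A 1 y)"
    then have "x * 1 \<in> A" "x * y \<in> A" unfolding colon_def using span2_gens[OF sr] by blast+
    moreover have "x \<in> m" if "x \<in> A" "x * y \<in> A" 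
    proof (rule ccontr)
      assume "x \<notin> m"
      then have "(x * y) / x \<in> A" "x \<noteq> 0" using local_ring_div[OF A] local_ringD(7)[OF A] that by blast+
      then show False using y by simp
    qed
    ultimately show "x \<in> m" by simp
  next
    fix x assume x: "x \<in> m"
    then have xA: "x \<in> A" "y * x \<in> A" using y local_ringD(4)[OF A] unfolding colon_def by auto
    have "x * (1 * p + y * q) \<in> A" if "p \<in> A" "q \<in> A" for p q
    proof -
      have "x * (1 * p + y * q) = x * p + (y * x) * q" by (simp add: algebra_simps)
      then show ?thesis using xA that by (auto intro: subring_add[OF sr] subring_mult[OF sr])
    qed
    then show "x \<in> colon A (span2 A 1 y)" unfolding colon_def span2_def by blast
  qed
  moreover have "v_cl A (span2 A 1 y) = span2 A 1 y"
    using divisorial_domain_frac[OF sr dd] nz_frac_ideal_span2[OF local_ringD(1)[OF A]] by blast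
  ultimately show ?thesis unfolding v_cl_def by auto
qed

text \<open>Since \<open>m\<close> is divisorial, \<open>(A : m)\<close> is strictly larger than
  \<open>A\<close>, which supplies \<open>y\<close>.\<close>

lemma colon_maximal_ideal:
  assumes A: "local_ring A m" and dd: "divisorial_domain A" and m0: "m \<noteq> {0}"
  shows "\<exists>y. y \<notin> A \<and> colon A m = span2 A 1 y"
proof -
  note sr = local_ringD(2)[OF A] and mm = local_ringD(3)[OF A]
  have "nz_ideal A m" unfolding nz_ideal_def ideal_of_def using mm m0 local_ringD(4)[OF A] by blast
  then have "v_cl A m = m" using divisorial_domain_frac[OF sr dd] nz_ideal_frac[OF sr] by blast
  moreover have "1 \<in> v_cl A m" if "colon A m \<subseteq> A"
    using that unfolding v_cl_def colon_def[of A "colon A m"] by auto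
  ultimately obtain y where "y \<in> colon A m" "y \<notin> A" using local_ringD(5)[OF A] by blast
  then show ?thesis using colon_maximal_ideal_eq[OF A dd] by blast
qed

text \<open>A unit product \<open>w * z\<close> with \<open>z\<close> in \<open>m\<close> and
  \<open>w\<close> in \<open>(A : m)\<close> would give \<open>x = z * (w * x / (w * z))\<close> for
  all \<open>x\<close> in \<open>m\<close>, making \<open>m\<close> principal. Hence
  \<open>(A : m) = (m : m)\<close>, which is a ring.\<close>

lemma colon_maximal_ideal_ring:
  assumes A: "local_ring A m" and m0: "m \<noteq> {0}" and np: "\<And>h. m \<noteq> (*) h ` A"
  shows "z \<in> m \<Longrightarrow> w \<in> colon A m \<Longrightarrow> w * z \<in> m" "is_subring (colon A m)" "A \<subseteq> colon A m"
proof -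
  note sr = local_ringD(2)[OF A] and mm = local_ringD(3)[OF A]
  show *: "w * z \<in> m" if z: "z \<in> m" and w: "w \<in> colon A m" for z w
  proof (rule ccontr)
    assume n: "w * z \<notin> m"
    have wz: "w * z \<in> A" using z w by (auto simp: colon_def)
    have "m = (*) z ` A"
    proof (intro equalityI subsetI)
      fix x assume "x \<in> m"
      then have "(w * x) / (w * z) \<in> A" using w wz n by (intro local_ring_div[OF A]) (auto simp: colon_def)
      moreover have "w * z \<noteq> 0" using local_ringD(7)[OF A wz n] .
      ultimately show "x \<in> (*) z ` A" by (auto intro!: image_eqI[of _ _ "(w * x) / (w * z)"])
    next
      fix x assume "x \<in> (*) z ` A" then show "x \<in> m" using submodule_smult'[OF mm _ z] by auto
    qed
    then show False using np by blast
  qed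
  have sB: "submodule_of A (colon A m)" by (rule submodule_colon[OF sr])
  show AB: "A \<subseteq> colon A m" using local_ringD(4)[OF A] subring_mult[OF sr] by (auto simp: colon_def)
  show "is_subring (colon A m)"
    unfolding is_subring_def
  proof (intro conjI ballI)
    show "1 \<in> colon A m" using AB subring_one[OF sr] by auto
    fix u v assume uv: "u \<in> colon A m" "v \<in> colon A m"
    show "u - v \<in> colon A m" by (rule submodule_diff[OF sr sB uv])
    show "u * v \<in> colon A m" using *[OF _ uv(2)] uv(1) unfolding colon_def[of A m] by (auto simp: mult.assoc)
  qed
qed

text \<open>Over a divisorial ring \<open>T\<close> an ideal \<open>m\<close> with \<open>(m : m) = T\<close> is invertible.\<close>
lemma one_mem_of_products:
  assumes T: "is_subring T" and dd: "divisorial_domain T" and m: "nz_ideal T m"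
    and mm: "colon m m \<subseteq> T" and X: "submodule_of T X" "X \<subseteq> T"
    and ab: "\<And>a b. a \<in> m \<Longrightarrow> b \<in> colon T m \<Longrightarrow> a * b \<in> X"
  shows "1 \<in> X"
proof -
  have sm: "submodule_of T m" and mT: "m \<subseteq> T" and m0: "m \<noteq> {0}" using m by (auto simp: nz_ideal_def ideal_of_def)
  have vm: "v_cl T m = m" using divisorial_domain_frac[OF T dd nz_ideal_frac[OF T m]] .
  have "1 \<in> colon T m" using mT by (auto simp: colon_def)
  then have mX: "m \<subseteq> X" using ab[of _ 1] by auto
  then have "nz_ideal T X" unfolding nz_ideal_def ideal_of_def using X nz_elem[OF sm m0] by blast
  then have vX: "v_cl T X = X" using divisorial_domain_frac[OF T dd] nz_ideal_frac[OF T] by blast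
  have "colon T X \<subseteq> T"
  proof
    fix x assume x: "x \<in> colon T X"
    have "x * a \<in> m" if a: "a \<in> m" for a
    proof -
      have "x * a * b \<in> T" if "b \<in> colon T m" for b
        using x ab[OF a that] unfolding colon_def[of T X] by (auto simp: mult.assoc)
      then have "x * a \<in> v_cl T m" by (rule v_clI)
      then show ?thesis unfolding vm .
    qed
    then show "x \<in> T" using mm by (auto simp: colon_def)
  qed
  then have "1 \<in> v_cl T X" unfolding v_cl_def colon_def[of T "colon T X"] by auto
  then show ?thesis unfolding vX .
qed

text \<open>The ring \<open>B\<close> has length two over \<open>m\<close>. If no product \<open>a b\<close> with \<open>a \<in> m\<close>, \<open>b \<in> (B : m)\<close> is a
  unit of \<open>B\<close>, then two of them are orthogonal idempotents modulo \<open>m\<close> with sum \<open>1\<close>.\<close>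
lemma maximal_ideal_principal_over_colon:
  assumes A: "local_ring A m" and m0: "m \<noteq> {0}" and np: "\<And>h. m \<noteq> (*) h ` A"
    and B: "B = colon A m" "B = span2 A 1 y" and ddB: "divisorial_domain B"
  shows "\<exists>h. m = (*) h ` B"
proof -
  note sr = local_ringD(2)[OF A] and mm = local_ringD(3)[OF A] and mA = local_ringD(4)[OF A]
  note cr = colon_maximal_ideal_ring[OF A m0 np, folded B(1)]
  have srB: "is_subring B" and AB: "A \<subseteq> B" using cr by auto
  have Bm: "w * z \<in> m" "z * w \<in> m" if "w \<in> B" "z \<in> m" for w z
    using cr(1)[OF that(2,1)] by (simp_all add: mult.commute[of z w])
  have smB: "submodule_of B m"
    unfolding submodule_of_def using submodule_zero[OF mm] submodule_add[OF mm] Bm by blast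
  have mB: "m \<subseteq> B" using mA AB by blast
  have nzm: "nz_ideal B m" unfolding nz_ideal_def ideal_of_def using smB mB m0 by blast
  have cmm: "colon m m \<subseteq> B" unfolding B(1) using mA by (auto simp: colon_def)
  define V where "V = colon B m"
  have sV: "submodule_of B V" unfolding V_def by (rule submodule_colon[OF srB])
  have one: "1 \<in> X" if "submodule_of B X" "X \<subseteq> B" "\<And>a b. a \<in> m \<Longrightarrow> b \<in> V \<Longrightarrow> a * b \<in> X" for X
    using one_mem_of_products[OF srB ddB nzm cmm that[unfolded V_def]] .
  have mV: "a * b \<in> B" if "a \<in> m" "b \<in> V" for a b using that by (auto simp: V_def colon_def mult.commute)
  \<comment> \<open>The congruence makes \<open>h * w\<close> a unit of \<open>A\<close>, so
    \<open>x = h * (x * w / (h * w))\<close> recovers every \<open>x\<close> in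
    \<open>m\<close>.\<close>
  have unit: ?thesis if "h \<in> m" "w \<in> V" "h * w - 1 \<in> m" for h w
  proof -
    have u: "h * w \<in> A" "h * w \<notin> m"
      using local_ring_unit_plus[OF A subring_one[OF sr] local_ringD(5)[OF A] that(3)] by auto
    then have u0: "h * w \<noteq> 0" "inverse (h * w) \<in> A" using local_ringD[OF A] by blast+
    have "m = (*) h ` B"
    proof (intro equalityI subsetI)
      fix x assume "x \<in> m"
      then have "inverse (h * w) * (x * w) \<in> B" 
        using subring_mult[OF srB _ mV[OF _ that(2)]] u0(2) AB by blast
      moreover have "x = h * (inverse (h * w) * (x * w))" using u0 by (simp add: field_simps)
      ultimately show "x \<in> (*) h ` B" by blast
    next
      fix x assume "x \<in> (*) h ` B" then show "x \<in> m" using Bm that by auto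
    qed
    then show ?thesis by blast
  qed
  \<comment> \<open>\<open>X c\<close> is the ideal \<open>cB + m\<close> of \<open>B\<close>; the
    case distinction below is whether it is proper for all products \<open>c\<close>.\<close>
  define X where "X c = {c * b + a | b a. b \<in> B \<and> a \<in> m}" for c
  have XI: "z = c * b + a \<Longrightarrow> b \<in> B \<Longrightarrow> a \<in> m \<Longrightarrow> z \<in> X c" for z c b a by (auto simp: X_def)
  have sX: "submodule_of B (X c)" for c
    unfolding submodule_of_def
  proof (intro conjI ballI)
    show "0 \<in> X c" using subring_zero[OF srB] submodule_zero[OF mm] by (intro XI[of _ c 0 0]) auto
    fix u assume "u \<in> X c"
    then obtain b a where u: "u = c * b + a" "b \<in> B" "a \<in> m" by (auto simp: X_def)
    { fix v assume "v \<in> X c"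
      then obtain b' a' where v: "v = c * b' + a'" "b' \<in> B" "a' \<in> m" by (auto simp: X_def)
      show "u + v \<in> X c"
        using u v by (intro XI[of _ c "b + b'" "a + a'"] subring_add[OF srB] submodule_add[OF mm])
          (auto simp: algebra_simps) }
    { fix s assume "s \<in> B"
      then show "s * u \<in> X c"
        using u by (intro XI[of _ c "s * b" "s * a"] subring_mult[OF srB] Bm) (auto simp: algebra_simps) }
  qed
  have mX: "m \<subseteq> X c" for c using subring_zero[OF srB] by (auto intro!: XI[of _ c 0])
  have cX: "c \<in> X c" for c using subring_one[OF srB] submodule_zero[OF mm] by (auto intro!: XI[of _ c 1 0])
  have XB: "X c \<subseteq> B" if "c \<in> B" for c
    using that mB by (auto simp: X_def intro!: subring_add[OF srB] subring_mult[OF srB])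
  show ?thesis
  proof (cases "\<exists>a\<in>m. \<exists>b\<in>V. 1 \<in> X (a * b)")
    case True
    then obtain a b d x where *: "a \<in> m" "b \<in> V" "1 = a * b * d + x" "d \<in> B" "x \<in> m" unfolding X_def by blast
    have "a * (d * b) - 1 = - x" using *(3) by (simp add: algebra_simps)
    then show ?thesis
      using unit[of a "d * b"] * submodule_smult[OF sV] submodule_uminus[OF sr mm] by auto
  next
    case False
    have "simple_chain A m 2 m B"
      unfolding B(2) by (rule simple_chain_span2[OF A])
        (use span2_gens(2)[OF sr, of y 1] in \<open>auto simp: B(2)[symmetric] B(1) colon_def mult.commute\<close>)
    then have no3: False if "m \<subset> Y" "Y \<subset> Z" "Z \<subset> B" "submodule_of A Y" "submodule_of A Z" for Y Z
    proof -
      have sB: "submodule_of A B" unfolding B(2) by (rule submodule_span2[OF sr])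
      have "strict_chain A 3 m B"
        using strict_chain.step[OF strict_chain.step[OF strict_chain.step[OF strict_chain.refl[OF mm]
              that(1,4)] that(2,5)] that(3) sB]
        by (simp add: numeral_3_eq_3)
      then have "3 \<le> (2::nat)"
        using strict_chain_length[OF A \<open>simple_chain A m 2 m B\<close>] by blast
      then show False by simp
    qed
    have n1: "1 \<notin> m" using local_ringD(5)[OF A] .
    obtain a1 b1 where ab1: "a1 \<in> m" "b1 \<in> V" "a1 * b1 \<notin> m" using one[OF smB mB] n1 by blast
    define c1 where "c1 = a1 * b1"
    have c1B: "c1 \<in> B" using mV ab1 c1_def by blast
    \<comment> \<open>Properness of \<open>X c1\<close> provides a product outside it. Then
      \<open>c1\<close> and \<open>c2\<close> are independent modulo \<open>m\<close>, and since
      \<open>B / m\<close> has length at most two they span it.\<close>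
    obtain a2 b2 where ab2: "a2 \<in> m" "b2 \<in> V" "a2 * b2 \<notin> X c1"
      using one[OF sX XB[OF c1B]] False ab1 unfolding c1_def by blast
    define c2 where "c2 = a2 * b2"
    have c2B: "c2 \<in> B" using mV ab2 c2_def by blast
    have c2m: "c2 \<notin> m" using ab2 mX unfolding c2_def by blast
    have 1: "1 \<notin> X c1" "1 \<notin> X c2" using False ab1 ab2 unfolding c1_def c2_def by blast+
    have sXA: "submodule_of A (X c)" for c using submodule_mono[OF sX AB] .
    have oneB: "1 \<in> B" using subring_one[OF srB] .
    have Xext: "X c = adjoin A m c" if "c \<in> B" "c \<notin> m" "1 \<notin> X c" for c
    proof -
      have "adjoin A m c \<subseteq> X c" by (intro adjoin_least sXA mX cX)
      moreover have "m \<subset> adjoin A m c" using adjoin_upper[OF sr, of m c] adjoin_elem[OF sr mm, of c] that by blast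
      moreover have "X c \<subset> B" using XB that oneB by blast
      ultimately show ?thesis using no3[of "adjoin A m c" "X c"] adjoin_submodule[OF sr mm] sXA by blast
    qed
    have X1: "X c1 = adjoin A m c1" using Xext c1B ab1(3) 1 c1_def by blast
    have X2: "X c2 = adjoin A m c2" using Xext c2B c2m 1 by blast
    define W where "W = adjoin A (X c1) c2"
    have "W = B"
    proof (rule ccontr)
      assume "W \<noteq> B"
      have sBA: "submodule_of A B" unfolding B(2) by (rule submodule_span2[OF sr])
      have "W \<subseteq> B" unfolding W_def by (intro adjoin_least sBA XB c1B c2B)
      moreover have "X c1 \<subset> W" unfolding W_def using adjoin_upper[OF sr, of "X c1" c2] adjoin_elem[OF sr sXA, of c2 c1] ab2(3) c2_def by blast
      moreover have "m \<subset> X c1" using mX cX[of c1] ab1(3) c1_def by blast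
      ultimately show False using no3[of "X c1" W] \<open>W \<noteq> B\<close> adjoin_submodule[OF sr sXA, of c1 c2] sXA unfolding W_def by blast
    qed
    then have "1 \<in> W" using oneB by simp
    then obtain r1 r2 x where r: "r1 \<in> A" "r2 \<in> A" "x \<in> m" "1 = (x + r1 * c1) + r2 * c2"
      unfolding W_def X1 adjoin_def by blast
    \<comment> \<open>Modulo \<open>m\<close> the product lies on both lines \<open>A c1\<close> and
      \<open>A c2\<close>, which meet only in zero.\<close>
    have c12: "c1 * c2 \<in> m"
    proof -
      have "c2 * c1 \<in> X c1" "c1 * c2 \<in> X c2" using submodule_smult[OF sX] cX c1B c2B by blast+
      then obtain x1 l1 x2 l2 where l: "x1 \<in> m" "l1 \<in> A" "c2 * c1 = x1 + l1 * c1" "x2 \<in> m" "l2 \<in> A" "c1 * c2 = x2 + l2 * c2"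
        unfolding X1 X2 adjoin_def by blast
      have "l2 \<in> m"
      proof (rule ccontr)
        assume l2: "l2 \<notin> m"
        then have "l2 \<noteq> 0" "inverse l2 \<in> A" using local_ringD[OF A] l by blast+
        have "l2 * c2 = (x1 - x2) + l1 * c1" using l by (simp add: algebra_simps)
        then have "l2 * c2 \<in> X c1" unfolding X1 using l submodule_diff[OF sr mm] by (intro adjoinI) auto
        then have "inverse l2 * (l2 * c2) \<in> X c1" using submodule_smult[OF sXA] \<open>inverse l2 \<in> A\<close> by blast
        then show False using \<open>l2 \<noteq> 0\<close> ab2(3) c2_def by (simp add: mult.assoc[symmetric])
      qed
      then show ?thesis unfolding l(6) using l Bm c2B by (intro submodule_add[OF mm]) auto
    qed
    define e1 e2 where "e1 = r1 * c1" and "e2 = r2 * c2"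
    have eB: "e1 \<in> B" "e2 \<in> B" unfolding e1_def e2_def using r c1B c2B AB by (auto intro!: subring_mult[OF srB])
    have e12: "e1 * e2 \<in> m"
    proof -
      have "e1 * e2 = (r1 * r2) * (c1 * c2)" by (simp add: e1_def e2_def)
      then show ?thesis using submodule_smult[OF mm _ c12] subring_mult[OF sr] r by simp
    qed
    have es: "e1 + e2 = 1 - x" using r(4) unfolding e1_def e2_def by (simp add: algebra_simps)
    \<comment> \<open>\<open>e1\<close> and \<open>e2\<close> are orthogonal idempotents modulo
      \<open>m\<close> with sum \<open>1\<close>. Gluing \<open>a1\<close>, \<open>a2\<close> and
      \<open>b1\<close>, \<open>b2\<close> along them yields one product congruent to
      \<open>1\<close>. In \<open>q\<close> the cross terms are collected, minus the
      \<open>3 * (e1 + e2)\<close> that comes from the cube of \<open>e1 + e2\<close>.\<close>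
    define h w where "h = (r1 * a1) * e1 + (r2 * a2) * e2" and "w = b1 * e1 + b2 * e2"
    have ra: "r1 * a1 \<in> m" "r2 * a2 \<in> m" using submodule_smult[OF mm] r ab1 ab2 by auto
    have hm: "h \<in> m" unfolding h_def using ra Bm eB by (intro submodule_add[OF mm]) auto
    have wV: "w \<in> V" unfolding w_def using ab1 ab2 eB by (intro submodule_add[OF sV] submodule_smult'[OF sV]) auto
    define q where "q = (r1 * a1) * b2 + (r2 * a2) * b1 - (e1 + e2) - (e1 + e2) - (e1 + e2)"
    have qB: "q \<in> B" unfolding q_def
      using ra ab1 ab2 mV eB by (intro subring_diff[OF srB] subring_add[OF srB]) auto
    have "h * w = (e1 + e2) * (e1 + e2) * (e1 + e2) + e1 * e2 * q"
    proof -
      have "h * w = (r1 * (a1 * b1)) * e1 * e1 + (r2 * (a2 * b2)) * e2 * e2 + e1 * e2 * ((r1 * a1) * b2 + (r2 * a2) * b1)"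
        unfolding h_def w_def by (simp add: algebra_simps)
      also have "\<dots> = e1 * e1 * e1 + e2 * e2 * e2 + e1 * e2 * ((r1 * a1) * b2 + (r2 * a2) * b1)"
        by (simp add: e1_def e2_def c1_def c2_def)
      also have "\<dots> = (e1 + e2) * (e1 + e2) * (e1 + e2) + e1 * e2 * q"
        unfolding q_def by (simp add: algebra_simps)
      finally show ?thesis .
    qed
    have "h * w - 1 = x * (x * (1 - x + 1 + 1) - 1 - 1 - 1) + e1 * e2 * q"
      unfolding \<open>h * w = _\<close> es by (simp add: algebra_simps)
    moreover have "x * (x * (1 - x + 1 + 1) - 1 - 1 - 1) + e1 * e2 * q \<in> m"
    proof (intro submodule_add[OF mm] Bm(2)[OF _ r(3)] Bm(2)[OF qB e12])
      show "x * (1 - x + 1 + 1) - 1 - 1 - 1 \<in> B"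
        using r(3) mB by (intro subring_diff[OF srB] subring_mult[OF srB] subring_add[OF srB] oneB) auto
    qed
    ultimately show ?thesis using unit[OF hm wV] by simp
  qed
qed

text \<open>If \<open>m\<close> is principal, \<open>two_gen_of_module\<close> applies with
  \<open>y = 0\<close>. Otherwise let \<open>I\<close> be nonprincipal: all products of
  \<open>I\<close> with \<open>(A : I)\<close> lie in \<open>m\<close>, since a unit product would
  make \<open>I\<close> principal. So \<open>B\<close> maps \<open>(A : I)\<close> into itself, and
  \<open>I = I_v\<close> is a \<open>B\<close>-module.\<close>

lemma two_gen_of_divisorial:
  assumes A: "local_ring A m" and od: "one_dim A m" and dd: "divisorial_domain A" and m0: "m \<noteq> {0}"
    and ddB: "(\<And>h. m \<noteq> (*) h ` A) \<Longrightarrow> divisorial_domain (colon A m)"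
  shows "two_gen_ring A"
  unfolding two_gen_ring_def
proof (intro allI impI)
  fix I assume I: "nz_ideal A I"
  note sr = local_ringD(2)[OF A] and mm = local_ringD(3)[OF A] and mA = local_ringD(4)[OF A]
  have sI: "submodule_of A I" and IA: "I \<subseteq> A" using I by (auto simp: nz_ideal_def ideal_of_def)
  have nz: "h \<noteq> 0" if "m = (*) h ` X" "X \<noteq> {}" for h X using m0 that by auto
  show "\<exists>a b. I = span2 A a b"
  proof (cases "\<exists>h. m = (*) h ` A")
    case True
    then obtain h where h: "m = (*) h ` A" by blast
    have e: "span2 A 1 0 = A" unfolding span2_def using sr subring_zero by auto
    show ?thesis
    proof (rule two_gen_of_module[OF A od _ _ _ I])
      show "m = (*) h ` span2 A 1 0" unfolding e by (rule h)
      show "h \<noteq> 0" using nz[OF h] subring_one[OF sr] by blast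
      show "r * 0 \<in> A" if "r \<in> m" for r using subring_zero[OF sr] by simp
      show "b * x \<in> I" if "b \<in> span2 A 1 0" "x \<in> I" for b x using that submodule_smult[OF sI] unfolding e by blast
    qed
  next
    case False
    then have np: "m \<noteq> (*) h ` A" for h by blast
    show ?thesis
    proof (cases "\<exists>g. I = (*) g ` A")
      case True
      then obtain g where "I = (*) g ` A" by blast
      moreover have "span2 A g 0 = (*) g ` A" unfolding span2_def using subring_zero[OF sr] by auto
      ultimately show ?thesis by metis
    next
      case npI: False
      obtain y where y: "colon A m = span2 A 1 y" using colon_maximal_ideal[OF A dd m0] by blast
      define B where "B = colon A m"
      obtain h where h: "m = (*) h ` B"
        using maximal_ideal_principal_over_colon[OF A m0 np B_def _ ddB[OF np, folded B_def]] y B_def by blast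
      have BA: "b * r \<in> A" if "b \<in> B" "r \<in> m" for b r using that by (auto simp: B_def colon_def)
      have ab: "a * b \<in> m" if a: "a \<in> I" and b: "b \<in> colon A I" for a b
      proof (rule ccontr)
        assume n: "a * b \<notin> m"
        have abA: "a * b \<in> A" using that by (auto simp: colon_def mult.commute)
        then have u: "a * b \<noteq> 0" "inverse (a * b) \<in> A" using local_ringD[OF A] n by blast+
        have "I = (*) a ` A"
        proof (intro equalityI subsetI)
          fix x assume "x \<in> I"
          then have "b * x \<in> A" using b by (auto simp: colon_def)
          then have "inverse (a * b) * (b * x) \<in> A" using u subring_mult[OF sr] by blast
          moreover have "x = a * (inverse (a * b) * (b * x))" using u by (simp add: field_simps)
          ultimately show "x \<in> (*) a ` A" by blast
        next
          fix x assume "x \<in> (*) a ` A" then show "x \<in> I" using submodule_smult'[OF sI _ a] by auto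
        qed
        then show False using npI by blast
      qed
      have BI: "w * x \<in> I" if w: "w \<in> B" and x: "x \<in> I" for w x
      proof -
        have "w * b \<in> colon A I" if "b \<in> colon A I" for b
          unfolding colon_def using BA[OF w ab[OF _ that]] by (auto simp: mult_ac)
        then have "w * x * b \<in> A" if "b \<in> colon A I" for b
          using x that unfolding colon_def by (simp add: mult_ac) (metis mult.assoc mult.commute)
        then have "w * x \<in> v_cl A I" by (rule v_clI)
        then show ?thesis using divisorial_domain_frac[OF sr dd nz_ideal_frac[OF sr I]] by simp
      qed
      have yB: "y \<in> B" unfolding B_def y using span2_gens(2)[OF sr] by blast
      show ?thesis
      proof (rule two_gen_of_module[OF A od h[unfolded B_def y] _ _ I])
        show "h \<noteq> 0" using nz[OF h] yB by blast
        show "r * y \<in> A" if "r \<in> m" for r using BA[OF yB that] by (simp add: mult.commute)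
        show "b * x \<in> I" if "b \<in> span2 A 1 y" "x \<in> I" for b x using BI that unfolding B_def y by blast
      qed
    qed
  qed
qed

subsection \<open>Generated submodules and prime ideals\<close>

lemma gen_superset: "S \<subseteq> gen D S"
  unfolding gen_def by (rule hull_subset)

lemma gen_least: "submodule_of D X \<Longrightarrow> S \<subseteq> X \<Longrightarrow> gen D S \<subseteq> X"
  unfolding gen_def by (rule hull_minimal)

lemma submodule_gen: "submodule_of D (gen D S)"
  unfolding gen_def by (rule hull_in) (auto simp: submodule_of_def)

lemma submodule_vimage_mult: "submodule_of D I \<Longrightarrow> submodule_of D {y. d * y \<in> I}"
  unfolding submodule_of_def by (auto simp: distrib_left mult.left_commute)

lemma colon_gen:
  assumes "is_subring D" shows "colon D (gen D S) = colon D S"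
proof
  show "colon D (gen D S) \<subseteq> colon D S" by (intro colon_antimono gen_superset)
  show "colon D S \<subseteq> colon D (gen D S)"
  proof
    fix x assume "x \<in> colon D S"
    then have "S \<subseteq> {y. x * y \<in> D}" by (auto simp: colon_def)
    then have "gen D S \<subseteq> {y. x * y \<in> D}" by (intro gen_least submodule_vimage_mult submodule_self assms)
    then show "x \<in> colon D (gen D S)" by (auto simp: colon_def)
  qed
qed

lemma v_cl_gen: "is_subring D \<Longrightarrow> v_cl D (gen D S) = v_cl D S"
  by (simp add: v_cl_def colon_gen)

lemma nz_frac_ideal_gen:
  assumes D: "qdom D" and S: "finite S" "\<not> S \<subseteq> {0}" shows "nz_frac_ideal D (gen D S)"
proof -
  obtain d where d: "d \<in> D" "d \<noteq> 0" "\<forall>x\<in>S. d * x \<in> D" using qdom_common_denom[OF D S(1)] by blast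
  then have "gen D S \<subseteq> {y. d * y \<in> D}"
    by (intro gen_least submodule_vimage_mult submodule_self qdom_subring[OF D]) auto
  then show ?thesis unfolding nz_frac_ideal_def using submodule_gen gen_superset[of S D] S(2) d by blast
qed

lemma prime_idealD:
  assumes "prime_ideal_of D P"
  shows "ideal_of D P" "submodule_of D P" "P \<subseteq> D" "1 \<notin> P"
    "x \<in> D \<Longrightarrow> y \<in> D \<Longrightarrow> x * y \<in> P \<Longrightarrow> x \<in> P \<or> y \<in> P" "0 \<in> P"
  using assms ideal_one submodule_zero unfolding prime_ideal_of_def ideal_of_def by blast+

lemma prime_ideal_zero:
  assumes "is_subring D" shows "prime_ideal_of D {0}"
  unfolding prime_ideal_of_def ideal_of_def submodule_of_def
  using subring_zero[OF assms] subring_one[OF assms] by auto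

lemma prime_ideal_mult:
  assumes "is_subring D" "prime_ideal_of D P" "x \<in> D - P" "y \<in> D - P" shows "x * y \<in> D - P"
  using prime_idealD(5)[OF assms(2), of x y] subring_mult[OF assms(1), of x y] assms(3,4) by blast

lemma prime_ideal_power:
  assumes "is_subring D" "prime_ideal_of D P" "x \<in> D - P" shows "x ^ n \<in> D - P"
proof (induction n)
  case 0 then show ?case using subring_one[OF assms(1)] prime_idealD(4)[OF assms(2)] by simp
next
  case (Suc n) then show ?case using prime_ideal_mult[OF assms] by simp
qed

lemma prime_ideal_power_mem:
  assumes "is_subring D" "prime_ideal_of D P" "x \<in> D" "x ^ n \<in> P" shows "x \<in> P"
  using prime_ideal_power[OF assms(1,2), of x n] assms(3,4) by blast

text \<open>Krull's argument: an ideal maximal among those containing \<open>E\<close> and missing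
  \<open>S\<close> is prime, since two elements outside it would yield two members of
  \<open>S\<close> whose product it contains.\<close>

lemma exists_prime_ideal:
  assumes D: "is_subring D" and E: "ideal_of D E" and S: "S \<subseteq> D" "S \<noteq> {}"
    "\<And>x y. x \<in> S \<Longrightarrow> y \<in> S \<Longrightarrow> x * y \<in> S" and ES: "E \<inter> S = {}"
  shows "\<exists>P. prime_ideal_of D P \<and> E \<subseteq> P \<and> P \<inter> S = {}"
proof -
  let ?C = "{J. ideal_of D J \<and> E \<subseteq> J \<and> J \<inter> S = {}}"
  have "\<exists>P\<in>?C. \<forall>X\<in>?C. P \<subseteq> X \<longrightarrow> X = P"
  proof (rule subset_Zorn_nonempty)
    show "?C \<noteq> {}" using E ES by blast
    fix C assume C: "C \<noteq> {}" "subset.chain ?C C"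
    then have CC: "C \<subseteq> ?C" and tot: "\<And>X Y. X \<in> C \<Longrightarrow> Y \<in> C \<Longrightarrow> X \<subseteq> Y \<or> Y \<subseteq> X"
      by (auto simp: subset_chain_def)
    have "submodule_of D (\<Union>C)"
    proof (rule submodule_Union_directed[OF C(1)])
      show "submodule_of D X" if "X \<in> C" for X using CC that by (auto simp: ideal_of_def)
      show "\<exists>Z\<in>C. X \<subseteq> Z \<and> Y \<subseteq> Z" if "X \<in> C" "Y \<in> C" for X Y using tot[OF that] that by blast
    qed
    moreover have "\<Union>C \<subseteq> D" "\<Union>C \<inter> S = {}" using CC by (auto simp: ideal_of_def)
    moreover obtain X where "X \<in> C" using C(1) by blast
    then have "E \<subseteq> \<Union>C" using CC by auto
    ultimately show "\<Union>C \<in> ?C" by (simp add: ideal_of_def)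
  qed
  then obtain P where PC: "P \<in> ?C" "\<forall>X\<in>?C. P \<subseteq> X \<longrightarrow> X = P" by (elim bexE)
  then have P: "ideal_of D P" "E \<subseteq> P" "P \<inter> S = {}"
    and max: "\<And>X. ideal_of D X \<Longrightarrow> E \<subseteq> X \<Longrightarrow> X \<inter> S = {} \<Longrightarrow> P \<subseteq> X \<Longrightarrow> X = P" by simp_all
  have sP: "submodule_of D P" and PD: "P \<subseteq> D" using P by (auto simp: ideal_of_def)
  have meets: "\<exists>p\<in>P. \<exists>r\<in>D. p + r * x \<in> S" if "x \<in> D" "x \<notin> P" for x
  proof (rule ccontr)
    assume "\<not> ?thesis"
    then have "adjoin D P x \<inter> S = {}" by (auto simp: adjoin_def)
    moreover have "ideal_of D (adjoin D P x)"
      unfolding ideal_of_def using adjoin_submodule[OF D sP] adjoin_least[OF submodule_self[OF D] PD that(1)] by blast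
    ultimately have "adjoin D P x = P" using max adjoin_upper[OF D, of P x] P(2) by blast
    then show False using adjoin_elem[OF D sP, of x] that by blast
  qed
  have "prime_ideal_of D P"
    unfolding prime_ideal_of_def
  proof (intro conjI ballI impI)
    show "ideal_of D P" by (rule P)
    show "P \<noteq> D" using P(3) S by blast
    fix x y assume xy: "x \<in> D" "y \<in> D" "x * y \<in> P"
    show "x \<in> P \<or> y \<in> P"
    proof (rule ccontr)
      assume "\<not> ?thesis"
      then obtain p r q s where *: "p \<in> P" "r \<in> D" "p + r * x \<in> S" "q \<in> P" "s \<in> D" "q + s * y \<in> S"
        using meets xy by meson
      have "(p + r * x) * (q + s * y) = (q + s * y) * p + ((r * x) * q + (r * s) * (x * y))"
        by (simp add: algebra_simps)
      moreover have "\<dots> \<in> P"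
        using * xy S(1)
        by (intro submodule_add[OF sP] submodule_smult[OF sP _ *(1)] submodule_smult[OF sP _ *(4)]
            submodule_smult[OF sP _ xy(3)] subring_mult[OF D]) auto
      ultimately show False using S(3)[OF *(3,6)] P(3) by auto
    qed
  qed
  then show ?thesis using P by blast
qed

subsection \<open>Localization\<close>

text \<open>Denominators come from \<open>D - P\<close> even when \<open>I\<close> belongs to a
  larger ring, so \<open>loc D P T\<close> is the localization of an overring \<open>T\<close> at a
  multiplicative set of \<open>D\<close>. Membership is tested by multiplying, without choosing
  fractions.\<close>

definition loc :: "'a::field set \<Rightarrow> 'a set \<Rightarrow> 'a set \<Rightarrow> 'a set" where
  "loc D P I = {x. \<exists>u\<in>D - P. u * x \<in> I}"

lemma locI: "u \<in> D - P \<Longrightarrow> u * x \<in> I \<Longrightarrow> x \<in> loc D P I"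
  by (auto simp: loc_def)

lemma locE: "x \<in> loc D P I \<Longrightarrow> (\<And>u. u \<in> D \<Longrightarrow> u \<notin> P \<Longrightarrow> u * x \<in> I \<Longrightarrow> thesis) \<Longrightarrow> thesis"
  by (auto simp: loc_def)

lemma loc_mono: "I \<subseteq> J \<Longrightarrow> loc D P I \<subseteq> loc D P J"
  by (auto simp: loc_def)

lemma loc_upper:
  assumes "is_subring D" "prime_ideal_of D P" shows "I \<subseteq> loc D P I"
  using subring_one[OF assms(1)] prime_idealD(4)[OF assms(2)] by (auto intro: locI[of 1])

lemma localize_eq_loc:
  assumes "prime_ideal_of D P" shows "localize D P = loc D P D"
proof (intro equalityI subsetI)
  fix x assume "x \<in> localize D P"
  then obtain a s where as: "x = a / s" "a \<in> D" "s \<in> D - P" by (auto simp: localize_def)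
  then have "s \<noteq> 0" using prime_idealD(6)[OF assms] by blast
  then show "x \<in> loc D P D" using as by (intro locI[OF as(3)]) simp
next
  fix x assume "x \<in> loc D P D"
  then obtain u where u: "u \<in> D" "u \<notin> P" "u * x \<in> D" by (rule locE)
  then have "u \<noteq> 0" using prime_idealD(6)[OF assms] by blast
  then have "x = (u * x) / u" by simp
  then show "x \<in> localize D P" unfolding localize_def using u by blast
qed

context
  fixes D P :: "'a::field set"
  assumes D: "is_subring D" and P: "prime_ideal_of D P"
begin

lemma submodule_loc_overring:
  assumes T: "D \<subseteq> T" and I: "submodule_of T I" shows "submodule_of (loc D P T) (loc D P I)"
  unfolding submodule_of_def
proof (intro conjI ballI)
  show "0 \<in> loc D P I" using loc_upper[OF D P] submodule_zero[OF I] by blast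
  fix x assume "x \<in> loc D P I"
  then obtain u where u: "u \<in> D" "u \<notin> P" "u * x \<in> I" by (rule locE)
  { fix y assume "y \<in> loc D P I"
    then obtain v where v: "v \<in> D" "v \<notin> P" "v * y \<in> I" by (rule locE)
    have "v * (u * x) + u * (v * y) \<in> I"
      using u(1) v(1) T by (intro submodule_add[OF I] submodule_smult[OF I _ u(3)] submodule_smult[OF I _ v(3)]) auto
    then have "(u * v) * (x + y) \<in> I" by (simp add: algebra_simps)
    then show "x + y \<in> loc D P I" using prime_ideal_mult[OF D P] u v by (blast intro: locI) }
  { fix r assume "r \<in> loc D P T"
    then obtain v where v: "v \<in> D" "v \<notin> P" "v * r \<in> T" by (rule locE)
    have "(v * r) * (u * x) \<in> I" by (rule submodule_smult[OF I v(3) u(3)])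
    then have "(u * v) * (r * x) \<in> I" by (simp add: mult_ac)
    then show "r * x \<in> loc D P I" using prime_ideal_mult[OF D P] u v by (blast intro: locI) }
qed

lemmas submodule_loc = submodule_loc_overring[OF order_refl]

lemma subring_loc_overring:
  assumes DT: "D \<subseteq> T" and T: "is_subring T" shows "is_subring (loc D P T)"
  unfolding is_subring_def
proof (intro conjI ballI)
  note sm = submodule_loc_overring[OF DT submodule_self[OF T]]
  have T': "T \<subseteq> loc D P T" by (rule loc_upper[OF D P])
  then show "1 \<in> loc D P T" using subring_one[OF T] by blast
  fix x y assume xy: "x \<in> loc D P T" "y \<in> loc D P T"
  have "- 1 \<in> loc D P T" using T' subring_uminus[OF T subring_one[OF T]] by blast
  then show "x - y \<in> loc D P T"
    using submodule_add[OF sm xy(1) submodule_smult[OF sm _ xy(2)], of "- 1"] by simp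
  show "x * y \<in> loc D P T" by (rule submodule_smult[OF sm xy])
qed

lemmas subring_loc = subring_loc_overring[OF order_refl D]

lemma overring_loc: "overring D (loc D P D)"
  unfolding overring_def using subring_loc loc_upper[OF D P] by blast

lemma inverse_mem_loc: "u \<in> D - P \<Longrightarrow> inverse u \<in> loc D P D"
  using prime_idealD(6)[OF P] subring_one[OF D] by (intro locI[of u]) (auto, metis right_inverse)

lemma loc_module:
  assumes "submodule_of (loc D P D) J" shows "loc D P J = J"
proof
  show "J \<subseteq> loc D P J" by (rule loc_upper[OF D P])
  show "loc D P J \<subseteq> J"
  proof
    fix x assume "x \<in> loc D P J"
    then obtain u where u: "u \<in> D" "u \<notin> P" "u * x \<in> J" by (rule locE)
    then have "inverse u * (u * x) \<in> J" using submodule_smult[OF assms] inverse_mem_loc by blast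
    moreover have "u \<noteq> 0" using u prime_idealD(6)[OF P] by blast
    ultimately show "x \<in> J" by (simp add: mult.assoc[symmetric])
  qed
qed

lemma loc_contraction:
  assumes "submodule_of (loc D P D) J" "J \<subseteq> loc D P D" shows "loc D P (J \<inter> D) = J"
proof
  show "loc D P (J \<inter> D) \<subseteq> J" using loc_mono[of "J \<inter> D" J] loc_module[OF assms(1)] by blast
  show "J \<subseteq> loc D P (J \<inter> D)"
  proof
    fix x assume x: "x \<in> J"
    then obtain u where u: "u \<in> D" "u \<notin> P" "u * x \<in> D" using assms(2) by (auto elim: locE)
    moreover have "u * x \<in> J"
      using submodule_smult[OF assms(1) _ x] u loc_upper[OF D P] by blast
    ultimately show "x \<in> loc D P (J \<inter> D)" by (auto intro: locI)
  qed
qed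

lemma gen_localize:
  assumes "submodule_of D I" shows "gen (localize D P) I = loc D P I"
  unfolding localize_eq_loc[OF P]
proof
  show "gen (loc D P D) I \<subseteq> loc D P I"
    by (intro gen_least submodule_loc assms loc_upper D P)
  show "loc D P I \<subseteq> gen (loc D P D) I"
    using loc_mono[OF gen_superset, of D P I "loc D P D"] loc_module[OF submodule_gen] by simp
qed

text \<open>Finitely many denominators have a common multiple outside \<open>P\<close>. This is why
  \<open>v\<close>-closures are compared with those over a localization only for finite
  sets.\<close>

lemma colon_loc_finite:
  assumes "finite S" "z \<in> colon (loc D P D) S"
  shows "\<exists>u\<in>D - P. u * z \<in> colon D S"
  using assms
proof (induction S)
  case empty
  then show ?case using subring_one[OF D] prime_idealD(4)[OF P] by (auto simp: colon_def)
next
  case (insert s S)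
  then obtain u where u: "u \<in> D - P" "u * z \<in> colon D S" by (auto simp: colon_def)
  have "z * s \<in> loc D P D" using insert by (auto simp: colon_def)
  then obtain v where v: "v \<in> D" "v \<notin> P" "v * (z * s) \<in> D" by (rule locE)
  have "(u * v) * z * y \<in> D" if y: "y \<in> insert s S" for y
  proof (cases "y = s")
    case True
    have "(u * v) * z * y = u * (v * (z * s))" using True by (simp add: mult_ac)
    moreover have "u * (v * (z * s)) \<in> D" using u(1) v(3) by (auto intro: subring_mult[OF D])
    ultimately show ?thesis by (simp only:)
  next
    case False
    have "(u * v) * z * y = v * (u * z * y)" by (simp add: mult_ac)
    moreover have "u * z * y \<in> D" using u(2) y False by (auto simp: colon_def)
    ultimately show ?thesis using subring_mult[OF D v(1), of "u * z * y"] by (simp only:)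
  qed
  moreover have "u * v \<in> D - P" using prime_ideal_mult[OF D P] u v by blast
  ultimately show ?case by (auto simp: colon_def)
qed

lemma v_cl_finite_subset_loc:
  assumes S: "finite S" and x: "x \<in> v_cl D S" shows "x \<in> v_cl (loc D P D) S"
proof -
  have "x * z \<in> loc D P D" if z: "z \<in> colon (loc D P D) S" for z
  proof -
    obtain u where u: "u \<in> D - P" "u * z \<in> colon D S" using colon_loc_finite[OF S z] by blast
    then have "x * (u * z) \<in> D" using x by (blast intro: v_clD)
    then show ?thesis using u(1) by (intro locI[of u]) (auto simp: mult.left_commute)
  qed
  then show ?thesis by (rule v_clI)
qed

end

lemma local_ring_loc:
  assumes D: "qdom D" and P: "prime_ideal_of D P" shows "local_ring (loc D P D) (loc D P P)"
  unfolding local_ring_def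
proof (intro conjI ballI impI)
  note sr = qdom_subring[OF D]
  show "qdom (loc D P D)" by (rule qdom_overring[OF D overring_loc[OF sr P]])
  show "ideal_of (loc D P D) (loc D P P)"
    unfolding ideal_of_def using submodule_loc[OF sr P prime_idealD(2)[OF P]] loc_mono[OF prime_idealD(3)[OF P]] by blast
  show "1 \<notin> loc D P P" by (auto simp: loc_def)
  fix x assume "x \<in> loc D P D" and n: "x \<notin> loc D P P"
  then obtain u where u: "u \<in> D" "u \<notin> P" "u * x \<in> D" by (auto elim: locE)
  then have ux: "u * x \<notin> P" using n by (auto intro: locI)
  then have "x \<noteq> 0" using prime_idealD(6)[OF P] by auto
  then have "(u * x) * inverse x \<in> D" using u by (simp add: mult.assoc)
  then show "inverse x \<in> loc D P D" using u ux by (blast intro: locI)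
qed

subsection \<open>The t-operation\<close>

text \<open>Finite sets replace finitely generated fractional ideals, because a set and its span
  have the same \<open>v\<close>-closure; a nonzero member of the set corresponds to the span being
  nonzero.\<close>

lemma t_cl_iff:
  assumes D: "qdom D" and I: "submodule_of D I"
  shows "x \<in> t_cl D I \<longleftrightarrow> (\<exists>S. finite S \<and> S \<subseteq> I \<and> \<not> S \<subseteq> {0} \<and> x \<in> v_cl D S)"
proof
  note sr = qdom_subring[OF D]
  { assume "x \<in> t_cl D I"
    then obtain J where J: "nz_frac_ideal D J" "fin_gen D J" "J \<subseteq> I" "x \<in> v_cl D J" by (auto simp: t_cl_def)
    then obtain S where S: "finite S" "J = gen D S" by (auto simp: fin_gen_def)
    have "\<not> S \<subseteq> {0}"
    proof
      assume "S \<subseteq> {0}"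
      then have "gen D S \<subseteq> {0}" by (intro gen_least) (auto simp: submodule_of_def)
      then show False using J(1) S submodule_zero unfolding nz_frac_ideal_def by blast
    qed
    moreover have "S \<subseteq> I" using gen_superset[of S D] S J by blast
    ultimately show "\<exists>S. finite S \<and> S \<subseteq> I \<and> \<not> S \<subseteq> {0} \<and> x \<in> v_cl D S"
      using S J(4) v_cl_gen[OF sr] by blast }
  { assume "\<exists>S. finite S \<and> S \<subseteq> I \<and> \<not> S \<subseteq> {0} \<and> x \<in> v_cl D S"
    then obtain S where S: "finite S" "S \<subseteq> I" "\<not> S \<subseteq> {0}" "x \<in> v_cl D S" by blast
    then have "nz_frac_ideal D (gen D S)" "fin_gen D (gen D S)" "gen D S \<subseteq> I" "x \<in> v_cl D (gen D S)"
      using nz_frac_ideal_gen[OF D] gen_least[OF I] v_cl_gen[OF sr] by (auto simp: fin_gen_def)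
    then show "x \<in> t_cl D I" unfolding t_cl_def by blast }
qed

lemma nz_fracD:
  assumes "nz_frac_ideal D I"
  shows "submodule_of D I" "\<exists>x\<in>I. x \<noteq> 0" "\<exists>d\<in>D. d \<noteq> 0 \<and> (\<forall>x\<in>I. d * x \<in> D)"
  using assms nz_elem by (auto simp: nz_frac_ideal_def)

lemma t_idealI:
  assumes D: "qdom D" and I: "nz_frac_ideal D I" and v: "\<And>S. finite S \<Longrightarrow> S \<subseteq> I \<Longrightarrow> v_cl D S \<subseteq> I"
  shows "t_ideal D I"
proof -
  note sI = nz_fracD(1)[OF I]
  obtain p where p: "p \<in> I" "p \<noteq> 0" using nz_fracD(2)[OF I] by blast
  have "x \<in> t_cl D I" if "x \<in> I" for x
    unfolding t_cl_iff[OF D sI]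
    using p that v_cl_extensive[of "{p, x}" D] by (intro exI[of _ "{p, x}"]) auto
  moreover have "x \<in> I" if "x \<in> t_cl D I" for x using that v unfolding t_cl_iff[OF D sI] by blast
  ultimately show ?thesis using I by (auto simp: t_ideal_def)
qed

lemma t_idealD:
  assumes D: "qdom D" and I: "t_ideal D I" and S: "finite S" "S \<subseteq> I"
  shows "v_cl D S \<subseteq> I"
proof
  have fI: "nz_frac_ideal D I" and tI: "I = t_cl D I" using I by (auto simp: t_ideal_def)
  obtain p where p: "p \<in> I" "p \<noteq> 0" using nz_fracD(2)[OF fI] by blast
  fix x assume "x \<in> v_cl D S"
  then have "x \<in> v_cl D (insert p S)" using v_cl_mono[of S "insert p S" D] by blast
  then have "x \<in> t_cl D I"
    unfolding t_cl_iff[OF D nz_fracD(1)[OF fI]] using p S by (intro exI[of _ "insert p S"]) auto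
  then show "x \<in> I" using tI by simp
qed

lemma divisorial_t_ideal:
  assumes "qdom D" "divisorial_ideal D I" shows "t_ideal D I"
proof (rule t_idealI[OF assms(1)])
  show "nz_frac_ideal D I" using assms(2) by (auto simp: divisorial_ideal_def)
  show "v_cl D S \<subseteq> I" if "S \<subseteq> I" for S
    using v_cl_mono[OF that, of D] assms(2) by (auto simp: divisorial_ideal_def)
qed

lemma t_cl_extensive:
  assumes "qdom D" "nz_frac_ideal D I" shows "I \<subseteq> t_cl D I"
proof
  fix x assume "x \<in> I"
  moreover obtain p where "p \<in> I" "p \<noteq> 0" using nz_fracD(2)[OF assms(2)] by blast
  ultimately show "x \<in> t_cl D I" unfolding t_cl_iff[OF assms(1) nz_fracD(1)[OF assms(2)]]
    using v_cl_extensive[of "{p, x}" D] by (intro exI[of _ "{p, x}"]) auto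
qed

lemma submodule_t_cl:
  assumes D: "qdom D" and I: "nz_frac_ideal D I" shows "submodule_of D (t_cl D I)"
proof -
  note sr = qdom_subring[OF D] and sI = nz_fracD(1)[OF I]
  show ?thesis unfolding submodule_of_def
  proof (intro conjI ballI)
    show "0 \<in> t_cl D I" using t_cl_extensive[OF assms] submodule_zero[OF sI] by blast
    fix x assume "x \<in> t_cl D I"
    then obtain S where S: "finite S" "S \<subseteq> I" "\<not> S \<subseteq> {0}" "x \<in> v_cl D S" unfolding t_cl_iff[OF D sI] by blast
    { fix y assume "y \<in> t_cl D I"
      then obtain T where T: "finite T" "T \<subseteq> I" "y \<in> v_cl D T" unfolding t_cl_iff[OF D sI] by blast
      have "x \<in> v_cl D (S \<union> T)" "y \<in> v_cl D (S \<union> T)"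
        using S(4) T(3) v_cl_mono[of S "S \<union> T" D] v_cl_mono[of T "S \<union> T" D] by blast+
      then have "x + y \<in> v_cl D (S \<union> T)" using submodule_add[OF submodule_v_cl[OF sr]] by blast
      then show "x + y \<in> t_cl D I" unfolding t_cl_iff[OF D sI] using S T by (intro exI[of _ "S \<union> T"]) auto }
    { fix r assume "r \<in> D"
      then have "r * x \<in> v_cl D S" using submodule_smult[OF submodule_v_cl[OF sr]] S by blast
      then show "r * x \<in> t_cl D I" unfolding t_cl_iff[OF D sI] using S by blast }
  qed
qed

lemma t_ideal_t_cl:
  assumes D: "qdom D" and I: "nz_frac_ideal D I" shows "t_ideal D (t_cl D I)"
proof (rule t_idealI[OF D])
  note sr = qdom_subring[OF D] and sI = nz_fracD(1)[OF I]
  obtain d where d: "d \<in> D" "d \<noteq> 0" "\<forall>x\<in>I. d * x \<in> D" using nz_fracD(3)[OF I] by blast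
  have "d * x \<in> D" if xt: "x \<in> t_cl D I" for x
  proof -
    obtain S where S: "S \<subseteq> I" "x \<in> v_cl D S" using xt unfolding t_cl_iff[OF D sI] by blast
    then have "d \<in> colon D S" using d by (auto simp: colon_def)
    then have "x * d \<in> D" using S(2) by (blast intro: v_clD)
    then show ?thesis by (simp add: mult.commute)
  qed
  moreover obtain p where "p \<in> I" "p \<noteq> 0" using nz_fracD(2)[OF I] by blast
  ultimately show "nz_frac_ideal D (t_cl D I)"
    unfolding nz_frac_ideal_def using submodule_t_cl[OF assms] t_cl_extensive[OF assms] d by blast
  fix S assume "finite S" "S \<subseteq> t_cl D I"
  \<comment> \<open>A finite part of the closure comes from one finite subset of \<open>I\<close>,
    so that idempotence of the \<open>v\<close>-operation applies.\<close>
  then have "\<exists>T. finite T \<and> T \<subseteq> I \<and> S \<subseteq> v_cl D T"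
  proof (induction S)
    case empty then show ?case by (intro exI[of _ "{}"]) auto
  next
    case (insert s S)
    have "s \<in> t_cl D I" "S \<subseteq> t_cl D I" using insert.prems by auto
    then obtain T T' where T: "finite T" "T \<subseteq> I" "S \<subseteq> v_cl D T"
      and T': "finite T'" "T' \<subseteq> I" "s \<in> v_cl D T'"
      using insert.IH unfolding t_cl_iff[OF D sI] by (elim exE conjE impE) auto
    have "insert s S \<subseteq> v_cl D (T \<union> T')"
      using T(3) T'(3) v_cl_mono[of T "T \<union> T'" D] v_cl_mono[of T' "T \<union> T'" D] by blast
    then show ?case using T T' by (intro exI[of _ "T \<union> T'"]) auto
  qed
  then obtain T where T: "finite T" "T \<subseteq> I" "S \<subseteq> v_cl D T" by blast
  obtain p where p: "p \<in> I" "p \<noteq> 0" using nz_fracD(2)[OF I] by blast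
  have "v_cl D S \<subseteq> v_cl D (insert p T)"
    using v_cl_mono[OF T(3), of D] v_cl_mono[of T "insert p T" D] unfolding v_cl_idem by blast
  moreover have "v_cl D (insert p T) \<subseteq> t_cl D I"
  proof
    fix x assume "x \<in> v_cl D (insert p T)"
    then show "x \<in> t_cl D I"
      unfolding t_cl_iff[OF D sI] using T p by (intro exI[of _ "insert p T"]) auto
  qed
  ultimately show "v_cl D S \<subseteq> t_cl D I" by blast
qed

text \<open>Zorn's lemma applies because a finite subset of the union of a chain lies in one member,
  so the union is again a t-ideal.\<close>

lemma exists_t_Max:
  assumes D: "qdom D" and E: "t_ideal D E" "E \<subset> D"
  shows "\<exists>M\<in>t_Max D. E \<subseteq> M"
proof -
  let ?C = "{J. t_ideal D J \<and> J \<subset> D \<and> E \<subseteq> J}"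
  note sr = qdom_subring[OF D]
  have "\<exists>P\<in>?C. \<forall>X\<in>?C. P \<subseteq> X \<longrightarrow> X = P"
  proof (rule subset_Zorn_nonempty)
    show "?C \<noteq> {}" using E by blast
    fix C assume C: "C \<noteq> {}" "subset.chain ?C C"
    then have CC: "C \<subseteq> ?C" and tot: "\<And>X Y. X \<in> C \<Longrightarrow> Y \<in> C \<Longrightarrow> X \<subseteq> Y \<or> Y \<subseteq> X"
      by (auto simp: subset_chain_def)
    obtain X0 where X0: "X0 \<in> C" using C(1) by blast
    have tX: "t_ideal D X" "X \<subset> D" "E \<subseteq> X" if "X \<in> C" for X using CC that by blast+
    have fX: "nz_frac_ideal D X" if "X \<in> C" for X using tX[OF that] by (auto simp: t_ideal_def)
    note sX = nz_fracD(1)[OF fX]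
    have sU: "submodule_of D (\<Union>C)"
    proof (rule submodule_Union_directed[OF C(1) sX])
      show "\<exists>Z\<in>C. X \<subseteq> Z \<and> Y \<subseteq> Z" if "X \<in> C" "Y \<in> C" for X Y using tot[OF that] that by blast
    qed
    have UD: "\<Union>C \<subseteq> D" using tX by blast
    obtain p where "p \<in> X0" "p \<noteq> 0" using nz_fracD(2)[OF fX[OF X0]] by blast
    then have nzU: "nz_ideal D (\<Union>C)" using nz_idealI[OF sU UD] X0 by blast
    have "t_ideal D (\<Union>C)"
    proof (rule t_idealI[OF D nz_ideal_frac[OF sr nzU]])
      fix S assume S: "finite S" "S \<subseteq> \<Union>C"
      then obtain X where "X \<in> C" "S \<subseteq> X" using finite_subset_Union_chain[OF S C] by blast
      then show "v_cl D S \<subseteq> \<Union>C" using t_idealD[OF D tX(1) S(1)] by blast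
    qed
    moreover have "1 \<notin> X" if "X \<in> C" for X
      using ideal_one[of D X] tX(2)[OF that] sX[OF that] by (auto simp: ideal_of_def)
    then have "\<Union>C \<noteq> D" using subring_one[OF sr] by blast
    moreover have "E \<subseteq> \<Union>C" using tX(3) X0 by blast
    ultimately show "\<Union>C \<in> ?C" using UD by simp
  qed
  then obtain M where MC: "M \<in> ?C" "\<forall>X\<in>?C. M \<subseteq> X \<longrightarrow> X = M" by (elim bexE)
  then have "M \<in> t_Max D" unfolding t_Max_def by auto
  then show ?thesis using MC by blast
qed

lemma t_MaxD:
  assumes D: "qdom D" and M: "M \<in> t_Max D"
  shows "t_ideal D M" "nz_ideal D M" "1 \<notin> M" "finite S \<Longrightarrow> S \<subseteq> M \<Longrightarrow> v_cl D S \<subseteq> M"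
proof -
  show t: "t_ideal D M" using M by (auto simp: t_Max_def)
  have MD: "M \<subset> D" using M by (auto simp: t_Max_def)
  have f: "nz_frac_ideal D M" using t by (auto simp: t_ideal_def)
  show "nz_ideal D M" using f MD by (auto simp: nz_ideal_def ideal_of_def nz_frac_ideal_def)
  then show "1 \<notin> M" using ideal_one[of D M] MD by (auto simp: nz_ideal_def)
  show "finite S \<Longrightarrow> S \<subseteq> M \<Longrightarrow> v_cl D S \<subseteq> M" by (rule t_idealD[OF D t])
qed

lemma t_cl_subset_ring:
  assumes D: "qdom D" and E: "nz_ideal D E" shows "t_cl D E \<subseteq> D"
proof
  fix x assume "x \<in> t_cl D E"
  then obtain S where "S \<subseteq> E" "x \<in> v_cl D S" unfolding t_cl_iff[OF D nz_idealD(1)[OF E]] by blast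
  then show "x \<in> D" using v_cl_subset_ring[OF qdom_subring[OF D], of S] nz_idealD(3)[OF E] by blast
qed

text \<open>The t-closure of such an ideal is all of \<open>D\<close>, and membership of
  \<open>1\<close> is witnessed by a finite subset. Later arguments exploit t-maximal ideals through
  these finite certificates.\<close>

lemma not_subset_t_Max:
  assumes D: "qdom D" and E: "nz_ideal D E" and no: "\<And>M. M \<in> t_Max D \<Longrightarrow> \<not> E \<subseteq> M"
  shows "\<exists>S. finite S \<and> S \<subseteq> E \<and> \<not> S \<subseteq> {0} \<and> 1 \<in> v_cl D S"
proof -
  note f = nz_ideal_frac[OF qdom_subring[OF D] E]
  have "\<not> t_cl D E \<subset> D"
    using exists_t_Max[OF D t_ideal_t_cl[OF D f]] no t_cl_extensive[OF D f] by blast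
  then have "1 \<in> t_cl D E" using t_cl_subset_ring[OF D E] subring_one[OF qdom_subring[OF D]] by blast
  then show ?thesis unfolding t_cl_iff[OF D nz_fracD(1)[OF f]] .
qed

text \<open>For \<open>x\<close> outside \<open>M\<close>, maximality gives a finite
  \<open>S\<close> inside \<open>M + Dx\<close> with \<open>1\<close> in its
  \<open>v\<close>-closure. Multiplying by \<open>y\<close> moves \<open>S\<close> into
  \<open>M\<close> and \<open>1\<close> to \<open>y\<close>.\<close>

lemma t_Max_prime:
  assumes D: "qdom D" and M: "M \<in> t_Max D" shows "prime_ideal_of D M"
  unfolding prime_ideal_of_def
proof (intro conjI ballI impI)
  note sr = qdom_subring[OF D] and tM = t_MaxD[OF D M]
  note sM = nz_idealD(1)[OF tM(2)] and MD = nz_idealD(3)[OF tM(2)]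
  show "ideal_of D M" using tM by (auto simp: nz_ideal_def)
  show "M \<noteq> D" using tM(3) subring_one[OF sr] by blast
  fix x y assume xy: "x \<in> D" "y \<in> D" "x * y \<in> M"
  show "x \<in> M \<or> y \<in> M"
  proof (rule ccontr)
    assume n: "\<not> ?thesis"
    obtain p where p: "p \<in> M" "p \<noteq> 0" using nz_idealD(2)[OF tM(2)] by blast
    let ?E = "adjoin D M x"
    have E: "nz_ideal D ?E"
      using p adjoin_upper[OF sr, of M x] by (intro nz_idealI[of D ?E p] adjoin_submodule sr sM adjoin_least submodule_self MD xy) auto
    have fE: "nz_frac_ideal D ?E" by (rule nz_ideal_frac[OF sr E])
    have "1 \<in> t_cl D ?E"
    proof (rule ccontr)
      assume "1 \<notin> t_cl D ?E"
      then have "t_cl D ?E \<subset> D" using t_cl_subset_ring[OF D E] subring_one[OF sr] by blast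
      moreover have "M \<subseteq> t_cl D ?E" using adjoin_upper[OF sr, of M x] t_cl_extensive[OF D fE] by blast
      ultimately have "t_cl D ?E = M" using M t_ideal_t_cl[OF D fE] unfolding t_Max_def by blast
      then show False using n t_cl_extensive[OF D fE] adjoin_elem[OF sr sM, of x] by blast
    qed
    then obtain S where S: "finite S" "S \<subseteq> ?E" "1 \<in> v_cl D S" unfolding t_cl_iff[OF D nz_fracD(1)[OF fE]] by blast
    have "(*) y ` S \<subseteq> M"
    proof
      fix z assume "z \<in> (*) y ` S"
      then obtain q r where qr: "q \<in> M" "r \<in> D" "z = y * (q + r * x)" using S(2) by (auto simp: adjoin_def)
      then have "z = y * q + r * (x * y)" by (simp add: algebra_simps)
      then show "z \<in> M" using qr xy by (auto intro: submodule_add[OF sM] submodule_smult[OF sM])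
    qed
    then have "v_cl D ((*) y ` S) \<subseteq> M" using tM(4) S(1) by blast
    then show False using v_cl_mult[OF S(3), of y] n by auto
  qed
qed

subsection \<open>The w-operation\<close>

lemma w_cl_iff:
  assumes D: "qdom D" and I: "submodule_of D I"
  shows "x \<in> w_cl D I \<longleftrightarrow> (\<forall>M\<in>t_Max D. x \<in> loc D M I)"
  unfolding w_cl_def using gen_localize[OF qdom_subring[OF D] t_Max_prime[OF D] I] by auto

lemma w_cl_extensive:
  assumes "qdom D" "submodule_of D I" shows "I \<subseteq> w_cl D I"
  using loc_upper[OF qdom_subring[OF assms(1)] t_Max_prime[OF assms(1)]] w_cl_iff[OF assms] by blast

text \<open>The multipliers of \<open>x\<close> into \<open>I\<close> form an ideal contained in no
  t-maximal ideal. This recovers the description of the w-operation by finitely generated ideals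
  with trivial inverse.\<close>

lemma w_cl_finite:
  assumes D: "qdom D" and I: "nz_frac_ideal D I" and x: "x \<in> w_cl D I"
  shows "\<exists>S. finite S \<and> S \<subseteq> D \<and> 1 \<in> v_cl D S \<and> (\<forall>s\<in>S. s * x \<in> I)"
proof -
  note sr = qdom_subring[OF D] and sI = nz_fracD(1)[OF I]
  define E where "E = {r \<in> D. r * x \<in> I}"
  have sE: "submodule_of D E" using multiplier_ideal[OF sr sI] by (simp add: E_def ideal_of_def)
  obtain p where p: "p \<in> I" "p \<in> D" "p \<noteq> 0" using submodule_nz_integral[OF D sI] nz_fracD(2)[OF I] by blast
  obtain d where d: "d \<in> D" "d \<noteq> 0" "d * x \<in> D" using qdom_denom[OF D] by blast
  have "p * d * x = (d * x) * p" by (simp add: mult_ac)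
  then have "p * d * x \<in> I" using submodule_smult[OF sI d(3) p(1)] by (simp only:)
  then have "p * d \<in> E" unfolding E_def using p d subring_mult[OF sr] by simp
  then have "nz_ideal D E" using sE p d by (intro nz_idealI[of D E "p * d"]) (auto simp: E_def)
  moreover have "\<not> E \<subseteq> M" if "M \<in> t_Max D" for M
  proof -
    have "x \<in> loc D M I" using x that unfolding w_cl_iff[OF D sI] by blast
    then show ?thesis by (auto simp: E_def elim: locE)
  qed
  ultimately obtain S where "finite S" "S \<subseteq> E" "1 \<in> v_cl D S" using not_subset_t_Max[OF D] by blast
  then show ?thesis unfolding E_def by blast
qed

lemma one_v_cl_cancel:
  assumes "1 \<in> v_cl D S" "\<And>s. s \<in> S \<Longrightarrow> s * x \<in> D" shows "x \<in> D"
proof -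
  have "x \<in> colon D S" using assms(2) by (auto simp: colon_def mult.commute)
  then have "1 * x \<in> D" using assms(1) by (blast intro: v_clD)
  then show ?thesis by simp
qed

lemma one_v_cl_cancel_v:
  assumes S: "1 \<in> v_cl D S" and x: "\<And>s. s \<in> S \<Longrightarrow> s * x \<in> v_cl D I" shows "x \<in> v_cl D I"
proof -
  have "x * y \<in> D" if y: "y \<in> colon D I" for y
  proof (rule one_v_cl_cancel[OF S])
    fix s assume "s \<in> S"
    then have "(s * x) * y \<in> D" using x y by (blast intro: v_clD)
    then show "s * (x * y) \<in> D" by (simp add: mult.assoc)
  qed
  then show ?thesis by (rule v_clI)
qed

lemma w_cl_subset_v_cl:
  assumes "qdom D" "nz_frac_ideal D I" shows "w_cl D I \<subseteq> v_cl D I"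
proof
  fix x assume "x \<in> w_cl D I"
  then obtain S where "1 \<in> v_cl D S" "\<forall>s\<in>S. s * x \<in> I" using w_cl_finite[OF assms] by blast
  then show "x \<in> v_cl D I" using one_v_cl_cancel_v[of D S x I] v_cl_extensive[of I D] by blast
qed

lemma w_ideal_w_cl:
  assumes D: "qdom D" and I: "nz_frac_ideal D I" shows "w_ideal D (w_cl D I)"
proof -
  note sr = qdom_subring[OF D] and sI = nz_fracD(1)[OF I]
  have sm: "submodule_of D (loc D M I)" if "M \<in> t_Max D" for M
    using submodule_mono[OF submodule_loc[OF sr t_Max_prime[OF D that] sI] loc_upper[OF sr t_Max_prime[OF D that]]] .
  have sw: "submodule_of D (w_cl D I)"
    unfolding submodule_of_def
    by (auto simp: w_cl_iff[OF D sI] intro: submodule_zero[OF sm] submodule_add[OF sm] submodule_smult[OF sm])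
  obtain d where d: "d \<in> D" "d \<noteq> 0" "\<forall>x\<in>I. d * x \<in> D" using nz_fracD(3)[OF I] by blast
  then have dc: "d \<in> colon D I" by (auto simp: colon_def)
  have "d * x \<in> D" if "x \<in> w_cl D I" for x
  proof -
    have "x * d \<in> D" using w_cl_subset_v_cl[OF assms] that dc by (blast intro: v_clD)
    then show ?thesis by (simp add: mult.commute)
  qed
  then have "nz_frac_ideal D (w_cl D I)"
    unfolding nz_frac_ideal_def using sw nz_fracD(2)[OF I] w_cl_extensive[OF D sI] d by blast
  moreover have "w_cl D (w_cl D I) \<subseteq> w_cl D I"
  proof
    fix x assume "x \<in> w_cl D (w_cl D I)"
    then have *: "x \<in> loc D M (w_cl D I)" if "M \<in> t_Max D" for M using that unfolding w_cl_iff[OF D sw] by blast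
    show "x \<in> w_cl D I" unfolding w_cl_iff[OF D sI]
    proof
      fix M assume M: "M \<in> t_Max D"
      have "w_cl D I \<subseteq> loc D M I" using M w_cl_iff[OF D sI] by blast
      then have "x \<in> loc D M (loc D M I)" using *[OF M] loc_mono by blast
      then show "x \<in> loc D M I"
        using loc_module[OF sr t_Max_prime[OF D M] submodule_loc[OF sr t_Max_prime[OF D M] sI]] by simp
    qed
  qed
  ultimately show ?thesis unfolding w_ideal_def using w_cl_extensive[OF D sw] by blast
qed

lemma w_divisorial_v_cl:
  assumes D: "qdom D" and wd: "w_divisorial_domain D" and I: "nz_frac_ideal D I"
  shows "v_cl D I = w_cl D I"
proof -
  have "divisorial_ideal D (w_cl D I)" using wd w_ideal_w_cl[OF D I] by (auto simp: w_divisorial_domain_def)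
  then have "w_cl D I = v_cl D (w_cl D I)" by (auto simp: divisorial_ideal_def)
  then have "v_cl D I \<subseteq> w_cl D I" using v_cl_mono[OF w_cl_extensive[OF D nz_fracD(1)[OF I]], of D] by blast
  then show ?thesis using w_cl_subset_v_cl[OF D I] by blast
qed

lemma w_divisorial_domainI:
  assumes D: "qdom D" and v: "\<And>I. nz_frac_ideal D I \<Longrightarrow> v_cl D I \<subseteq> w_cl D I"
  shows "w_divisorial_domain D"
  unfolding w_divisorial_domain_def divisorial_ideal_def w_ideal_def
  using v v_cl_extensive by blast

text \<open>The last hypothesis expresses that \<open>n\<close> is minimal over \<open>aD\<close>.\<close>
lemma t_ideal_of_minimal_prime:
  assumes D: "qdom D" and n: "prime_ideal_of D n" and a: "a \<in> n" "a \<noteq> 0"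
    and min: "\<And>s. s \<in> n \<Longrightarrow> \<exists>u\<in>D - n. \<exists>k::nat. \<exists>w\<in>D. u * s ^ k = a * w"
  shows "t_ideal D n"
proof (rule t_idealI[OF D])
  note sr = qdom_subring[OF D] and nD = prime_idealD[OF n]
  have nzn: "nz_ideal D n" using nz_idealI[OF nD(2,3) a] .
  then show "nz_frac_ideal D n" by (rule nz_ideal_frac[OF sr])
  \<comment> \<open>\<open>L\<close> is the extended principal ideal \<open>a D_n\<close>. It misses
    \<open>1\<close> because \<open>a\<close> lies in \<open>n\<close>.\<close>
  define L where "L = {z. \<exists>u\<in>D - n. \<exists>w\<in>D. u * z = a * w}"
  have LD: "r * z \<in> L" if r: "r \<in> D" and "z \<in> L" for r z
  proof -
    obtain u w where u: "u \<in> D - n" "w \<in> D" "u * z = a * w" using \<open>z \<in> L\<close> by (auto simp: L_def)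
    then have "u * (r * z) = a * (r * w)" by (metis mult.left_commute)
    then show ?thesis unfolding L_def using u r subring_mult[OF sr] by blast
  qed
  have 1: "1 \<notin> L"
  proof
    assume "1 \<in> L"
    then obtain u w where "u \<in> D - n" "w \<in> D" "u * 1 = a * w" by (auto simp: L_def)
    then show False using submodule_smult'[OF nD(2) _ a(1)] by auto
  qed
  fix S assume S: "finite S" "S \<subseteq> n"
  have "\<exists>z\<in>D. z \<notin> L \<and> (\<forall>s\<in>S. s * z \<in> L)"
    using S
  proof (induction S)
    case empty then show ?case using 1 subring_one[OF sr] by blast
  next
    case (insert s S)
    then obtain z where z: "z \<in> D" "z \<notin> L" "\<forall>s\<in>S. s * z \<in> L" by blast
    have sD: "s \<in> D" using insert nD by auto
    obtain u k w where k: "u \<in> D - n" "w \<in> D" "u * s ^ k = a * w" using min[of s] insert by blast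
    have "u * (s ^ k * z) = a * (w * z)" using k(3) by (metis mult.assoc)
    then have ex: "s ^ k * z \<in> L" unfolding L_def using k subring_mult[OF sr _ z(1)] by blast
    \<comment> \<open>The last power of \<open>s\<close> that keeps \<open>z\<close> outside
      \<open>L\<close> is absorbed into \<open>z\<close>; minimality of \<open>n\<close> over
      \<open>a\<close> ensures that some power brings it inside.\<close>
    define j where "j = (LEAST k. s ^ k * z \<in> L)"
    have j: "s ^ j * z \<in> L" unfolding j_def by (rule LeastI[of _ k]) (rule ex)
    then have "j \<noteq> 0" using z(2) by (cases j) auto
    then obtain i where i: "j = Suc i" by (cases j) auto
    have "s ^ i * z \<notin> L" using not_less_Least[of i "\<lambda>k. s ^ k * z \<in> L"] i unfolding j_def by auto
    moreover have "s * (s ^ i * z) \<in> L" using j unfolding i by (simp add: mult.assoc)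
    moreover have "s' * (s ^ i * z) \<in> L" if "s' \<in> S" for s'
      using LD[of "s ^ i" "s' * z"] z(3) that subring_power[OF sr sD] by (simp add: mult.left_commute)
    moreover have "s ^ i * z \<in> D" using subring_mult[OF sr subring_power[OF sr sD] z(1)] .
    ultimately show ?case by blast
  qed
  then obtain z where z: "z \<in> D" "z \<notin> L" "\<forall>s\<in>S. s * z \<in> L" by blast
  have "\<exists>u\<in>D - n. \<forall>s\<in>S. \<exists>w\<in>D. u * (s * z) = a * w"
    using S(1) z(3)
  proof (induction S)
    case empty then show ?case using nD(4) subring_one[OF sr] by auto
  next
    case (insert s S)
    then obtain u where u: "u \<in> D - n" "\<forall>s\<in>S. \<exists>w\<in>D. u * (s * z) = a * w" by auto
    obtain v w where v: "v \<in> D - n" "w \<in> D" "v * (s * z) = a * w" using insert by (auto simp: L_def)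
    have "\<exists>w\<in>D. (u * v) * (t * z) = a * w" if t: "t \<in> insert s S" for t
    proof (cases "t = s")
      case True
      have "(u * v) * (s * z) = a * (u * w)" using v(3) by (metis mult.assoc mult.left_commute)
      then show ?thesis using True u v subring_mult[OF sr] by blast
    next
      case False
      then obtain w' where w': "w' \<in> D" "u * (t * z) = a * w'" using u t by blast
      have "(u * v) * (t * z) = a * (v * w')" using w'(2) by (metis mult.assoc mult.left_commute)
      then show ?thesis using w' v subring_mult[OF sr] by blast
    qed
    then show ?case using prime_ideal_mult[OF sr n u(1) v(1)] by blast
  qed
  then obtain u where u: "u \<in> D - n" "\<And>s. s \<in> S \<Longrightarrow> \<exists>w\<in>D. u * (s * z) = a * w" by blast
  show "v_cl D S \<subseteq> n"
  proof
    fix x assume x: "x \<in> v_cl D S"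
    have xD: "x \<in> D" using v_cl_subset_ring[OF sr, of S] x S nD by blast
    \<comment> \<open>This fraction tests membership: if some \<open>x\<close> in the
      \<open>v\<close>-closure were outside \<open>n\<close>, then \<open>x * u\<close> would be an
      admissible denominator placing \<open>z\<close> in \<open>L\<close>.\<close>
    have "u * z / a \<in> colon D S"
      unfolding colon_def
    proof (intro CollectI ballI)
      fix s assume "s \<in> S"
      then obtain w where w: "w \<in> D" "u * (s * z) = a * w" using u by blast
      then have "u * z / a * s = w" using a by (simp add: field_simps)
      then show "u * z / a * s \<in> D" using w by simp
    qed
    then have "x * (u * z / a) \<in> D" using x by (blast intro: v_clD)
    moreover have "(x * u) * z = a * (x * (u * z / a))" using a by (simp add: field_simps)
    ultimately have "x * u \<in> D - n \<Longrightarrow> z \<in> L" unfolding L_def by blast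
    then show "x \<in> n" using prime_ideal_mult[OF sr n, of x u] u(1) z(2) xD by blast
  qed
qed

subsection \<open>Overrings of local rings with two-generated ideals\<close>

text \<open>The argument of Krull and Akizuki: \<open>I / mI\<close> has dimension at most two even if \<open>I\<close> is not
  finitely generated over \<open>A\<close>, and a power of \<open>m\<close> lies in any nonzero principal ideal.\<close>
lemma two_gen_overring:
  assumes A: "local_ring A m" and tg: "two_gen_ring A" and T: "overring A T"
  shows "two_gen_ring T"
  unfolding two_gen_ring_def
proof (intro allI impI)
  fix I assume I: "nz_ideal T I"
  note sr = local_ringD(2)[OF A] and mm = local_ringD(3)[OF A] and mA = local_ringD(4)[OF A]
  have srT: "is_subring T" and AT: "A \<subseteq> T" using T by (auto simp: overring_def)
  note sI = nz_idealD(1)[OF I] and IT = nz_idealD(3)[OF I]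
  have sIA: "submodule_of A I" using submodule_mono[OF sI AT] .
  have od: "one_dim A m" by (rule two_gen_local_one_dim[OF A tg])
  obtain h1 h2 where h: "m = span2 A h1 h2"
  proof (cases "m = {0}")
    case True
    have "span2 A 0 0 = {0}" using subring_zero[OF sr] by (auto simp: span2_def)
    then show ?thesis using that[of 0 0] True by simp
  next
    case False
    then have "nz_ideal A m" using mm mA by (auto simp: nz_ideal_def ideal_of_def)
    then show ?thesis using tg that by (auto simp: two_gen_ring_def)
  qed
  have hm: "h1 \<in> m" "h2 \<in> m" unfolding h using span2_gens[OF sr] by auto
  then have hA: "h1 \<in> A" "h2 \<in> A" using mA by auto
  \<comment> \<open>\<open>X\<close> is the product \<open>mI\<close>, written with the two
    generators of \<open>m\<close>.\<close>
  define X where "X = {h1 * z + h2 * z' | z z'. z \<in> I \<and> z' \<in> I}"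
  have XI: "w = h1 * z + h2 * z' \<Longrightarrow> z \<in> I \<Longrightarrow> z' \<in> I \<Longrightarrow> w \<in> X" for w z z' by (auto simp: X_def)
  have sX: "submodule_of A X"
    unfolding submodule_of_def
  proof (intro conjI ballI)
    show "0 \<in> X" using submodule_zero[OF sI] by (intro XI[of _ 0 0]) auto
    fix u assume "u \<in> X"
    then obtain z z' where u: "u = h1 * z + h2 * z'" "z \<in> I" "z' \<in> I" by (auto simp: X_def)
    { fix v assume "v \<in> X"
      then obtain y y' where v: "v = h1 * y + h2 * y'" "y \<in> I" "y' \<in> I" by (auto simp: X_def)
      show "u + v \<in> X" using u v by (intro XI[of _ "z + y" "z' + y'"] submodule_add[OF sI]) (auto simp: algebra_simps) }
    { fix r assume "r \<in> A"
      then show "r * u \<in> X" using u by (intro XI[of _ "r * z" "r * z'"] submodule_smult[OF sIA]) (auto simp: algebra_simps) }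
  qed
  have mX: "c * x \<in> X" if c: "c \<in> m" and x: "x \<in> I" for c x
  proof -
    obtain p q where "p \<in> A" "q \<in> A" "c = h1 * p + h2 * q" using c unfolding h span2_def by blast
    then show ?thesis using x by (intro XI[of _ "p * x" "q * x"] submodule_smult[OF sIA]) (auto simp: algebra_simps)
  qed
  have zI: "0 \<in> I" using submodule_zero[OF sI] .
  have "\<exists>x1\<in>I. \<exists>x2\<in>I. I \<subseteq> adjoin A (adjoin A X x1) x2"
  proof (rule ccontr)
    assume no: "\<not> ?thesis"
    have ex: "\<exists>x3\<in>I. x3 \<notin> adjoin A (adjoin A X x1) x2" if "x1 \<in> I" "x2 \<in> I" for x1 x2 using no that by blast
    obtain x1 where x1: "x1 \<in> I" "x1 \<notin> X" using ex[OF zI zI] adjoin_upper[OF sr] by blast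
    obtain x2 where x2: "x2 \<in> I" "x2 \<notin> adjoin A X x1" using ex[OF x1(1) zI] adjoin_upper[OF sr] by blast
    obtain x3 where x3: "x3 \<in> I" "x3 \<notin> adjoin A (adjoin A X x1) x2" using ex[OF x1(1) x2(1)] by blast
    note sX1 = adjoin_submodule[OF sr sX, of x1]
    note sX2 = adjoin_submodule[OF sr sX1, of x2]
    \<comment> \<open>The relation is read backwards: a unit coefficient would put
      \<open>x3\<close>, then \<open>x2\<close>, then \<open>x1\<close> into the very module it was
      chosen to avoid.\<close>
    obtain c1 c2 c3 where c: "c1 \<in> A" "c2 \<in> A" "c3 \<in> A" "c1 * x1 + c2 * x2 + c3 * x3 = 0"
      and u: "c1 \<notin> m \<or> c2 \<notin> m \<or> c3 \<notin> m" using three_elements_dependent[OF A tg] by blast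
    have divide: False if "submodule_of A Y" "c \<in> A" "c \<notin> m" "c * x \<in> Y" "x \<notin> Y" for Y c x
    proof -
      have "inverse c * (c * x) \<in> Y" using that local_ringD(6)[OF A] submodule_smult by blast
      moreover have "c \<noteq> 0" using that local_ringD(7)[OF A] by blast
      ultimately show False using that(5) by (simp add: mult.assoc[symmetric])
    qed
    have up1: "X \<subseteq> adjoin A X x1" and up2: "adjoin A X x1 \<subseteq> adjoin A (adjoin A X x1) x2" by (rule adjoin_upper[OF sr])+
    have e1: "c1 * x1 \<in> adjoin A X x1" using submodule_smult[OF sX1 c(1)] adjoin_elem[OF sr sX] by blast
    have e2: "c2 * x2 \<in> adjoin A (adjoin A X x1) x2" using submodule_smult[OF sX2 c(2)] adjoin_elem[OF sr sX1] by blast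
    have "c3 * x3 = - (c1 * x1 + c2 * x2)" using c(4) by (simp add: eq_neg_iff_add_eq_0 algebra_simps)
    moreover have "- (c1 * x1 + c2 * x2) \<in> adjoin A (adjoin A X x1) x2"
      using e1 e2 up2 by (intro submodule_uminus[OF sr sX2] submodule_add[OF sX2]) auto
    ultimately have m3: "c3 \<in> m" using divide[OF sX2 c(3)] x3 by metis
    have "c2 * x2 = - (c1 * x1 + c3 * x3)" using c(4) by (simp add: eq_neg_iff_add_eq_0 algebra_simps)
    moreover have "- (c1 * x1 + c3 * x3) \<in> adjoin A X x1"
      using e1 mX[OF m3 x3(1)] up1 by (intro submodule_uminus[OF sr sX1] submodule_add[OF sX1]) auto
    ultimately have m2: "c2 \<in> m" using divide[OF sX1 c(2)] x2 by metis
    have "c1 * x1 = - (c2 * x2 + c3 * x3)" using c(4) by (simp add: eq_neg_iff_add_eq_0 algebra_simps)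
    moreover have "- (c2 * x2 + c3 * x3) \<in> X"
      using mX[OF m3 x3(1)] mX[OF m2 x2(1)] by (intro submodule_uminus[OF sr sX] submodule_add[OF sX]) auto
    ultimately have "c1 \<in> m" using divide[OF sX c(1)] x1 by metis
    then show False using u m2 m3 by blast
  qed
  then obtain x1 x2 where x: "x1 \<in> I" "x2 \<in> I" and cov: "I \<subseteq> adjoin A (adjoin A X x1) x2" by blast
  have cov': "\<exists>u\<in>span2 T x1 x2. \<exists>z\<in>I. \<exists>z'\<in>I. x = u + h1 * z + h2 * z'" if xI: "x \<in> I" for x
  proof -
    obtain w r s where w: "w \<in> X" "r \<in> A" "s \<in> A" "x = (w + r * x1) + s * x2"
      using cov xI unfolding adjoin_def by blast
    obtain z z' where z: "w = h1 * z + h2 * z'" "z \<in> I" "z' \<in> I" using w(1) unfolding X_def by blast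
    have "x = (x1 * r + x2 * s) + h1 * z + h2 * z'" using w z by (simp add: algebra_simps)
    moreover have "x1 * r + x2 * s \<in> span2 T x1 x2" using w AT by (intro span2I[of r _ s]) auto
    ultimately show ?thesis using z by blast
  qed
  obtain p0 where p0: "p0 \<in> I" "p0 \<noteq> 0" using nz_idealD(2)[OF I] by blast
  obtain x1' x2' where x': "x1' \<in> I" "x2' \<in> I" "x1' \<noteq> 0 \<or> x2' \<noteq> 0"
    and c1: "\<And>x. x \<in> I \<Longrightarrow> \<exists>u\<in>span2 T x1' x2'. \<exists>z\<in>I. \<exists>z'\<in>I. x = u + h1 * z + h2 * z'"
  proof (cases "x1 = 0 \<and> x2 = 0")
    case True
    have "span2 T x1 x2 \<subseteq> span2 T p0 0"
      using True by (intro span2_least submodule_span2 srT) (auto intro: submodule_zero[OF submodule_span2[OF srT]])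
    then show ?thesis using that[of p0 0] p0 zI cov' by blast
  next
    case False
    then show ?thesis using that[of x1 x2] x cov' by blast
  qed
  let ?J = "span2 T x1' x2'"
  have sJ: "submodule_of T ?J" by (rule submodule_span2[OF srT])
  have JI: "?J \<subseteq> I" by (intro span2_least sI x')
  obtain q0 where "q0 \<in> ?J" "q0 \<noteq> 0" using x'(3) span2_gens[OF srT] by metis
  then obtain q where q: "q \<in> ?J" "q \<in> A" "q \<noteq> 0"
    using submodule_nz_integral[OF local_ringD(1)[OF A] submodule_mono[OF sJ AT]] by blast
  obtain e1 w1 where e1: "h1 ^ e1 = q * w1" "w1 \<in> A" using od hm q unfolding one_dim_def by blast
  obtain e2 w2 where e2: "h2 ^ e2 = q * w2" "w2 \<in> A" using od hm q unfolding one_dim_def by blast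
  have absorb: "u + (q * w) * z \<in> ?J" if "u \<in> ?J" "w \<in> A" "z \<in> I" for u w z
  proof -
    have "w * z \<in> T" using that AT IT by (auto intro: subring_mult[OF srT])
    then have "u + (w * z) * q \<in> ?J" using that(1) q(1) by (intro submodule_add[OF sJ] submodule_smult[OF sJ])
    then show ?thesis by (simp add: mult_ac)
  qed
  \<comment> \<open>Powers of \<open>h1\<close> are raised first, all new multiples of
    \<open>h2\<close> being collected in one summand. Once \<open>h1 ^ e1\<close> is a multiple of
    \<open>q\<close> its term is absorbed into the span, and then \<open>h2\<close> is treated
    alone.\<close>
  have it1: "x \<in> I \<Longrightarrow> \<exists>u\<in>?J. \<exists>z\<in>I. \<exists>z'\<in>I. x = u + h1 ^ n * z + h2 * z'" for x n
  proof (induction n)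
    case 0 then show ?case using submodule_zero[OF sJ] zI by (intro bexI[of _ 0] bexI[of _ x]) auto
  next
    case (Suc n)
    then obtain u z z' where u: "u \<in> ?J" "z \<in> I" "z' \<in> I" "x = u + h1 ^ n * z + h2 * z'" by blast
    obtain v y y' where v: "v \<in> ?J" "y \<in> I" "y' \<in> I" "z = v + h1 * y + h2 * y'" using c1[OF u(2)] by blast
    have hT: "h1 ^ n \<in> T" using subring_power[OF sr hA(1)] AT by auto
    have "x = (u + h1 ^ n * v) + h1 ^ Suc n * y + h2 * (h1 ^ n * y' + z')" using u v by (simp add: algebra_simps)
    moreover have "u + h1 ^ n * v \<in> ?J" using u v hT by (intro submodule_add[OF sJ] submodule_smult[OF sJ])
    moreover have "h1 ^ n * y' + z' \<in> I" using u v hT by (intro submodule_add[OF sI] submodule_smult[OF sI])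
    ultimately show ?case using v by blast
  qed
  have c2: "\<exists>u\<in>?J. \<exists>z\<in>I. x = u + h2 * z" if xI: "x \<in> I" for x
  proof -
    obtain u z z' where u: "u \<in> ?J" "z \<in> I" "z' \<in> I" "x = u + h1 ^ e1 * z + h2 * z'" using it1[OF xI] by blast
    then show ?thesis using absorb[OF u(1) e1(2) u(2)] unfolding e1(1) by blast
  qed
  have it2: "x \<in> I \<Longrightarrow> \<exists>u\<in>?J. \<exists>z\<in>I. x = u + h2 ^ n * z" for x n
  proof (induction n)
    case 0 then show ?case using submodule_zero[OF sJ] by (intro bexI[of _ 0] bexI[of _ x]) auto
  next
    case (Suc n)
    then obtain u z where u: "u \<in> ?J" "z \<in> I" "x = u + h2 ^ n * z" by blast
    obtain v y where v: "v \<in> ?J" "y \<in> I" "z = v + h2 * y" using c2[OF u(2)] by blast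
    have hT: "h2 ^ n \<in> T" using subring_power[OF sr hA(2)] AT by auto
    have "x = (u + h2 ^ n * v) + h2 ^ Suc n * y" using u v by (simp add: algebra_simps)
    moreover have "u + h2 ^ n * v \<in> ?J" using u v hT by (intro submodule_add[OF sJ] submodule_smult[OF sJ])
    ultimately show ?case using v by blast
  qed
  have "I \<subseteq> ?J"
  proof
    fix x assume "x \<in> I"
    then obtain u z where u: "u \<in> ?J" "z \<in> I" "x = u + h2 ^ e2 * z" using it2 by blast
    then show "x \<in> ?J" using absorb[OF u(1) e2(2) u(2)] unfolding e2(1) by blast
  qed
  then show "\<exists>a b. I = span2 T a b" using JI by blast
qed

section \<open>Two-generated ideals under localization, and divisoriality of nonlocal
  overrings\<close>

lemma loc_span2:
  assumes D: "is_subring D" and P: "prime_ideal_of D P"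
  shows "loc D P (span2 D a b) = span2 (loc D P D) a b"
proof
  note srL = subring_loc[OF D P]
  have "span2 D a b \<subseteq> span2 (loc D P D) a b" using loc_upper[OF D P, of D] by (auto simp: span2_def)
  then have "loc D P (span2 D a b) \<subseteq> loc D P (span2 (loc D P D) a b)" by (rule loc_mono)
  then show "loc D P (span2 D a b) \<subseteq> span2 (loc D P D) a b"
    using loc_module[OF D P submodule_span2[OF srL]] by simp
  show "span2 (loc D P D) a b \<subseteq> loc D P (span2 D a b)"
    by (intro span2_least submodule_loc[OF D P] submodule_span2 D)
      (use span2_gens[OF D] loc_upper[OF D P] in blast)+
qed

lemma two_gen_loc:
  assumes D: "qdom D" and tg: "two_gen_ring D" and P: "prime_ideal_of D P"
  shows "two_gen_ring (loc D P D)"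
  unfolding two_gen_ring_def
proof (intro allI impI)
  note sr = qdom_subring[OF D]
  fix J assume J: "nz_ideal (loc D P D) J"
  have "nz_ideal D (J \<inter> D)" by (rule nz_ideal_contraction[OF D loc_upper[OF sr P] J])
  then obtain a b where "J \<inter> D = span2 D a b" using tg by (auto simp: two_gen_ring_def)
  then have "J = span2 (loc D P D) a b"
    using loc_contraction[OF sr P nz_idealD(1,3)[OF J]] loc_span2[OF sr P] by simp
  then show "\<exists>a b. J = span2 (loc D P D) a b" by blast
qed

lemma span2_eq_gen:
  assumes "is_subring D" shows "span2 D a b = gen D {a, b}"
proof
  show "span2 D a b \<subseteq> gen D {a, b}" using gen_superset[of "{a, b}" D] by (intro span2_least submodule_gen) auto
  show "gen D {a, b} \<subseteq> span2 D a b" using span2_gens[OF assms] by (intro gen_least submodule_span2 assms) auto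
qed

lemma v_cl_span2: "is_subring D \<Longrightarrow> v_cl D (span2 D a b) = v_cl D {a, b}"
  by (simp add: span2_eq_gen v_cl_gen)

lemma nz_frac_ideal_loc:
  assumes D: "is_subring D" and P: "prime_ideal_of D P" and I: "nz_frac_ideal D I"
  shows "nz_frac_ideal (loc D P D) (loc D P I)"
proof -
  obtain d where d: "d \<in> D" "d \<noteq> 0" "\<forall>x\<in>I. d * x \<in> D" using nz_fracD(3)[OF I] by blast
  have "d * x \<in> loc D P D" if "x \<in> loc D P I" for x
    using that
  proof (rule locE)
    fix u assume u: "u \<in> D" "u \<notin> P" "u * x \<in> I"
    then have "u * (d * x) \<in> D" using d by (simp add: mult.left_commute)
    then show ?thesis using u by (blast intro: locI)
  qed
  moreover have "d \<in> loc D P D" using d loc_upper[OF D P] by blast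
  ultimately show ?thesis
    unfolding nz_frac_ideal_def using submodule_loc[OF D P nz_fracD(1)[OF I]] nz_fracD(2)[OF I] d(2) loc_upper[OF D P, of I]
    by blast
qed

text \<open>The ring need not be local, so the local result is applied at a prime containing all
  multipliers into \<open>I\<close> of a putative element of \<open>I_v\<close> outside
  \<open>I\<close>. Two generators make the \<open>v\<close>-closure pass to that
  localization.\<close>

lemma two_gen_divisorial:
  assumes D: "qdom D" and tg: "two_gen_ring D"
  shows "divisorial_domain D"
proof (rule divisorial_domainI)
  note sr = qdom_subring[OF D]
  show "is_subring D" by (rule sr)
  fix I assume I: "nz_ideal D I"
  note fI = nz_ideal_frac[OF sr I] and sI = nz_idealD(1)[OF I]
  obtain a b where ab: "I = span2 D a b" using tg I by (auto simp: two_gen_ring_def)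
  show "v_cl D I \<subseteq> I"
  proof
    fix x assume x: "x \<in> v_cl D I"
    define E where "E = {r \<in> D. r * x \<in> I}"
    have xD: "x \<in> D" using x v_cl_subset_ring[OF sr] nz_idealD(3)[OF I] by blast
    have iE: "ideal_of D E" unfolding E_def by (rule multiplier_ideal[OF sr sI])
    show "x \<in> I"
    proof (rule ccontr)
      assume "x \<notin> I"
      then have "E \<inter> {1} = {}" by (auto simp: E_def)
      then obtain P where P: "prime_ideal_of D P" "E \<subseteq> P"
        using exists_prime_ideal[OF sr iE, of "{1}"] subring_one[OF sr] by auto
      let ?L = "loc D P D"
      have L: "local_ring ?L (loc D P P)" by (rule local_ring_loc[OF D P(1)])
      have dL: "divisorial_domain ?L" using two_gen_local_divisorial[OF L two_gen_loc[OF D tg P(1)]] .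
      have "x \<in> v_cl ?L {a, b}"
        using v_cl_finite_subset_loc[OF sr P(1), of "{a, b}" x] x unfolding ab v_cl_span2[OF sr] by blast
      then have "x \<in> v_cl ?L (loc D P I)"
        unfolding ab loc_span2[OF sr P(1)] v_cl_span2[OF subring_loc[OF sr P(1)]] .
      then have "x \<in> loc D P I"
        using divisorial_domain_frac[OF subring_loc[OF sr P(1)] dL nz_frac_ideal_loc[OF sr P(1) fI]] by simp
      then show False using P(2) by (auto simp: E_def elim: locE)
    qed
  qed
qed

lemma two_gen_totally_divisorial:
  assumes A: "local_ring A m" and tg: "two_gen_ring A"
  shows "totally_divisorial A"
  unfolding totally_divisorial_def
  using two_gen_divisorial[OF qdom_overring[OF local_ringD(1)[OF A]] two_gen_overring[OF A tg]] by blast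

subsection \<open>Finite t-character of w-divisorial domains\<close>

lemma w_divisorial_domainI_ideal:
  assumes D: "qdom D" and v: "\<And>I. nz_ideal D I \<Longrightarrow> v_cl D I \<subseteq> w_cl D I"
  shows "w_divisorial_domain D"
proof (rule w_divisorial_domainI[OF D])
  fix I assume I: "nz_frac_ideal D I"
  note sI = nz_fracD(1)[OF I]
  obtain d where d: "d \<in> D" "d \<noteq> 0" "\<forall>x\<in>I. d * x \<in> D" using nz_fracD(3)[OF I] by blast
  obtain p where "p \<in> I" "p \<noteq> 0" using nz_fracD(2)[OF I] by blast
  then have "nz_ideal D ((*) d ` I)"
    using d by (intro nz_idealI[of _ _ "d * p"] submodule_mult_image sI) auto
  then have sub: "v_cl D ((*) d ` I) \<subseteq> w_cl D ((*) d ` I)" by (rule v)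
  show "v_cl D I \<subseteq> w_cl D I"
  proof
    fix x assume "x \<in> v_cl D I"
    then have dx: "d * x \<in> w_cl D ((*) d ` I)" using v_cl_mult[of x D I d] sub by blast
    show "x \<in> w_cl D I" unfolding w_cl_iff[OF D sI]
    proof
      fix M assume "M \<in> t_Max D"
      then have "d * x \<in> loc D M ((*) d ` I)" using dx unfolding w_cl_iff[OF D submodule_mult_image[OF sI]] by blast
      then obtain u where u: "u \<in> D" "u \<notin> M" "u * (d * x) \<in> (*) d ` I" by (rule locE)
      then obtain y where y: "y \<in> I" "u * (d * x) = d * y" by blast
      then have "d * (u * x) = d * y" by (simp add: mult_ac)
      then have "u * x = y" using d(2) by simp
      then show "x \<in> loc D M I" using u y by (auto intro: locI)
    qed
  qed
qed

text \<open>Here \<open>I_v = S_v\<close>, and for the finite set \<open>S\<close> the closure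
  passes to \<open>D_M\<close>, where the extended ideal is divisorial. Allowing \<open>S\<close> in
  the w-closure rather than in \<open>I\<close> covers generators known only up to the
  w-operation.\<close>

lemma v_cl_subset_w_cl_of_finite:
  assumes D: "qdom D" and dL: "\<And>M. M \<in> t_Max D \<Longrightarrow> divisorial_domain (loc D M D)"
    and I: "nz_frac_ideal D I" and S: "finite S" "S \<subseteq> w_cl D I" "I \<subseteq> v_cl D S"
  shows "v_cl D I \<subseteq> w_cl D I"
proof
  note sr = qdom_subring[OF D] and sI = nz_fracD(1)[OF I]
  fix x assume "x \<in> v_cl D I"
  then have xS: "x \<in> v_cl D S" using v_cl_mono[OF S(3), of D] unfolding v_cl_idem by blast
  show "x \<in> w_cl D I" unfolding w_cl_iff[OF D sI]
  proof
    fix M assume M: "M \<in> t_Max D"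
    note P = t_Max_prime[OF D M]
    have "S \<subseteq> loc D M I" using S(2) M w_cl_iff[OF D sI] by blast
    then have "x \<in> v_cl (loc D M D) (loc D M I)"
      using v_cl_finite_subset_loc[OF sr P S(1) xS] v_cl_mono by blast
    then show "x \<in> loc D M I"
      using divisorial_domain_frac[OF subring_loc[OF sr P] dL[OF M] nz_frac_ideal_loc[OF sr P I]] by simp
  qed
qed

lemma t_Max_eq:
  assumes "qdom D" "M \<in> t_Max D" "N \<in> t_Max D" "M \<subseteq> N" shows "M = N"
  using assms unfolding t_Max_def by blast

text \<open>Distinct t-maximal ideals are incomparable, and a product of elements chosen outside
  \<open>N\<close> stays outside because \<open>N\<close> is prime.\<close>

lemma t_Max_avoid:
  assumes D: "qdom D" and N: "N \<in> t_Max D" and G: "finite G" "G \<subseteq> t_Max D - {N}"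
  shows "\<exists>r\<in>D - N. \<forall>M\<in>G. r \<in> M"
  using G
proof (induction G)
  case empty
  then show ?case using subring_one[OF qdom_subring[OF D]] t_MaxD(3)[OF D N] by blast
next
  case (insert M G)
  note sr = qdom_subring[OF D]
  obtain r where r: "r \<in> D - N" "\<forall>M\<in>G. r \<in> M" using insert by auto
  have M: "M \<in> t_Max D" "M \<noteq> N" using insert by auto
  then obtain s where s: "s \<in> M" "s \<notin> N" using t_Max_eq[OF D M(1) N] by blast
  have id: "submodule_of D M'" if "M' \<in> t_Max D" for M' using nz_idealD(1)[OF t_MaxD(2)[OF D that]] .
  have sD: "s \<in> D" using s nz_idealD(3)[OF t_MaxD(2)[OF D M(1)]] by blast
  have "r * s \<in> D - N" using prime_ideal_mult[OF sr t_Max_prime[OF D N] r(1)] s sD by blast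
  moreover have "r * s \<in> M" using submodule_smult[OF id[OF M(1)] _ s(1)] r by blast
  moreover have "r * s \<in> M'" if "M' \<in> G" for M'
  proof -
    have "M' \<in> t_Max D" "r \<in> M'" using insert that r by auto
    then show ?thesis using submodule_smult'[OF id sD] by blast
  qed
  ultimately show ?case by blast
qed

text \<open>Localizing at \<open>M\<close> shows that \<open>1\<close> is not in
  \<open>M_w = M_v\<close>, so some \<open>x\<close> in \<open>(D : M)\<close> is outside
  \<open>D\<close>. Its ideal of denominators is a proper t-ideal containing \<open>M\<close>, hence
  equal to \<open>M\<close>.\<close>

lemma t_Max_colon:
  assumes D: "qdom D" and wd: "w_divisorial_domain D" and M: "M \<in> t_Max D"
  shows "\<exists>x. \<forall>r\<in>D. r * x \<in> D \<longleftrightarrow> r \<in> M"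
proof -
  note sr = qdom_subring[OF D] and tM = t_MaxD[OF D M]
  note sM = nz_idealD(1)[OF tM(2)] and MD = nz_idealD(3)[OF tM(2)] and fM = nz_ideal_frac[OF sr tM(2)]
  have "1 \<notin> loc D M M" by (auto simp: loc_def)
  then have "1 \<notin> v_cl D M" using M unfolding w_divisorial_v_cl[OF D wd fM] w_cl_iff[OF D sM] by blast
  then obtain x where x: "x \<in> colon D M" "x \<notin> D" unfolding v_cl_def colon_def[of D "colon D M"] by auto
  define E where "E = {r \<in> D. r * x \<in> D}"
  have ME: "M \<subseteq> E" using x(1) MD by (auto simp: E_def colon_def mult.commute)
  have sE: "submodule_of D E"
    using multiplier_ideal[OF sr submodule_self[OF sr]] by (simp add: E_def ideal_of_def)
  obtain p where "p \<in> M" "p \<noteq> 0" using nz_idealD(2)[OF tM(2)] by blast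
  then have "nz_ideal D E" using ME sE by (intro nz_idealI[of _ _ p]) (auto simp: E_def)
  then have "t_ideal D E"
  proof (intro t_idealI[OF D] nz_ideal_frac[OF sr])
    fix S assume S: "S \<subseteq> E"
    show "v_cl D S \<subseteq> E"
    proof
      fix y assume y: "y \<in> v_cl D S"
      have "x \<in> colon D S" using S by (auto simp: E_def colon_def mult.commute)
      then have "y * x \<in> D" using y by (blast intro: v_clD)
      moreover have "y \<in> D" using y v_cl_subset_ring[OF sr, of S] S by (auto simp: E_def)
      ultimately show "y \<in> E" by (simp add: E_def)
    qed
  qed
  moreover have "1 \<notin> E" using x(2) by (simp add: E_def)
  then have "E \<subset> D" using subring_one[OF sr] unfolding E_def by blast
  ultimately have "E = M" using M ME unfolding t_Max_def by blast
  then show ?thesis unfolding E_def by blast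
qed

lemma t_Max_v_cl:
  assumes D: "qdom D" and wd: "w_divisorial_domain D" and M: "M \<in> t_Max D"
  shows "v_cl D M = M"
proof -
  note MD = nz_idealD(3)[OF t_MaxD(2)[OF D M]]
  obtain x where x: "\<forall>r\<in>D. r * x \<in> D \<longleftrightarrow> r \<in> M" using t_Max_colon[OF assms] by blast
  have "y \<in> M" if y: "y \<in> v_cl D M" for y
  proof -
    have "x \<in> colon D M" using x MD by (auto simp: colon_def mult.commute)
    then have "y * x \<in> D" using y by (blast intro: v_clD)
    then show ?thesis using x y v_cl_subset_ring[OF qdom_subring[OF D] MD] by blast
  qed
  then show ?thesis using v_cl_extensive by blast
qed

text \<open>If \<open>a\<close> lies in infinitely many t-maximal ideals, then one of them contains the intersection of
  the others. By duality \<open>(D : M)\<close> then lies in the directed union of the inverses of the finite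
  intersections of the others, which is a w-ideal, and so \<open>M\<close> contains one of these intersections.\<close>
lemma w_divisorial_finite_character:
  assumes D: "qdom D" and wd: "w_divisorial_domain D" and a: "a \<in> D" "a \<noteq> 0"
  shows "finite {M \<in> t_Max D. a \<in> M}"
proof (rule ccontr)
  note sr = qdom_subring[OF D]
  define L where "L = {M \<in> t_Max D. a \<in> M}"
  assume "infinite {M \<in> t_Max D. a \<in> M}"
  then have inf: "infinite L" by (simp add: L_def)
  have LM: "M \<in> t_Max D" "a \<in> M" if "M \<in> L" for M using that by (auto simp: L_def)
  have id: "submodule_of D M" "M \<subseteq> D" if "M \<in> L" for M using nz_idealD(1,3)[OF t_MaxD(2)[OF D LM(1)[OF that]]] .
  \<comment> \<open>\<open>N G\<close> is the intersection of the members of \<open>G\<close>, cut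
    down to \<open>D\<close> so that \<open>N {} = D\<close>.\<close>
  define N where "N G = {r \<in> D. \<forall>M\<in>G. r \<in> M}" for G
  have sN: "submodule_of D (N G)" if "G \<subseteq> L" for G
    unfolding submodule_of_def N_def using that
    by (auto intro: subring_closed[OF sr] submodule_zero[OF id(1)] submodule_add[OF id(1)] submodule_smult[OF id(1)])
  have aN: "a \<in> N G" if "G \<subseteq> L" for G using that LM a by (auto simp: N_def)
  have Nmono: "N G \<subseteq> N G'" if "G' \<subseteq> G" for G G' using that by (auto simp: N_def)
  have directed: "\<exists>G\<in>\<G>. S \<subseteq> F G"
    if "finite S" "S \<subseteq> (\<Union>G\<in>\<G>. F G)" "\<G> = {G. finite G \<and> G \<subseteq> X}" "\<And>G G'. G \<subseteq> G' \<Longrightarrow> F G \<subseteq> F G'" for S :: "'a set" and F \<G> X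
    using that(1,2)
  proof (induction S)
    case empty
    then show ?case using that(3) by blast
  next
    case (insert s S)
    then obtain G where G: "G \<in> \<G>" "S \<subseteq> F G" by auto
    obtain G' where G': "G' \<in> \<G>" "s \<in> F G'" using insert by auto
    have "F G \<subseteq> F (G \<union> G')" "F G' \<subseteq> F (G \<union> G')" by (rule that(4), blast)+
    then have "insert s S \<subseteq> F (G \<union> G')" using G G' by blast
    moreover have "G \<union> G' \<in> \<G>" using G G' that(3) by blast
    ultimately show ?case by blast
  qed
  define \<G> where "\<G> = {G. finite G \<and> G \<subseteq> L}"
  \<comment> \<open>Each finite \<open>G\<close> lists ideals to be left out, so \<open>I\<close> is
    a directed union of intersections of cofinitely many members of \<open>L\<close>. A finite
    certificate that \<open>I\<close> escapes all t-maximal ideals would lie in one such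
    intersection, hence in some member of the infinite set \<open>L\<close>.\<close>
  define I where "I = (\<Union>G\<in>\<G>. N (L - G))"
  have Idir: "\<exists>G\<in>\<G>. S \<subseteq> N (L - G)" if "finite S" "S \<subseteq> I" for S
    using directed[OF that(1) that(2)[unfolded I_def] \<G>_def] Nmono by (metis Diff_mono order_refl)
  have memI: "x \<in> I" if "G \<in> \<G>" "x \<in> N (L - G)" for G x using that by (auto simp: I_def)
  have "submodule_of D I"
    unfolding I_def
  proof (rule submodule_Union_directed)
    fix X Y assume "X \<in> (\<lambda>G. N (L - G)) ` \<G>" "Y \<in> (\<lambda>G. N (L - G)) ` \<G>"
    then obtain G H where "G \<in> \<G>" "H \<in> \<G>" "X = N (L - G)" "Y = N (L - H)" by blast
    then show "\<exists>Z\<in>(\<lambda>G. N (L - G)) ` \<G>. X \<subseteq> Z \<and> Y \<subseteq> Z"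
      using Nmono[of "L - (G \<union> H)"] by (intro bexI[of _ "N (L - (G \<union> H))"]) (auto simp: \<G>_def)
  qed (use sN in \<open>auto simp: \<G>_def\<close>)
  moreover have "a \<in> I" using memI[of "{}"] aN by (auto simp: \<G>_def)
  moreover have "I \<subseteq> D" by (auto simp: I_def N_def)
  ultimately have nzI: "nz_ideal D I" using a by (intro nz_idealI)
  have "\<exists>M0\<in>t_Max D. I \<subseteq> M0"
  proof (rule ccontr)
    assume "\<not> ?thesis"
    then obtain S where S: "finite S" "S \<subseteq> I" "1 \<in> v_cl D S" using not_subset_t_Max[OF D nzI] by blast
    then obtain G where G: "G \<in> \<G>" "S \<subseteq> N (L - G)" using Idir by blast
    then have "L - G \<noteq> {}" using inf unfolding \<G>_def by (metis (mono_tags, lifting) Diff_eq_empty_iff finite_subset mem_Collect_eq)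
    then obtain M where M: "M \<in> L" "M \<notin> G" by blast
    then have "S \<subseteq> M" using G by (auto simp: N_def)
    then show False using t_MaxD(3,4)[OF D LM(1)[OF M(1)]] S by blast
  qed
  then obtain M0 where M0: "M0 \<in> t_Max D" "I \<subseteq> M0" by blast
  then have M0L: "M0 \<in> L" using \<open>a \<in> I\<close> by (auto simp: L_def)
  define L' where "L' = L - {M0}"
  have red: "N L' \<subseteq> M0" using memI[of "{M0}"] M0 M0L by (auto simp: \<G>_def L'_def)
  obtain x where x: "\<forall>r\<in>D. r * x \<in> D \<longleftrightarrow> r \<in> M0" using t_Max_colon[OF D wd M0(1)] by blast
  define \<G>' where "\<G>' = {G. finite G \<and> G \<subseteq> L'}"
  define S where "S = (\<Union>G\<in>\<G>'. colon D (N G))"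
  have L'L: "G \<subseteq> L" if "G \<in> \<G>'" for G using that by (auto simp: \<G>'_def L'_def)
  have Sdir: "\<exists>G\<in>\<G>'. F \<subseteq> colon D (N G)" if "finite F" "F \<subseteq> S" for F
    using directed[OF that(1) that(2)[unfolded S_def] \<G>'_def] colon_antimono Nmono by metis
  have memS: "y \<in> S" if "G \<in> \<G>'" "y \<in> colon D (N G)" for G y using that by (auto simp: S_def)
  have e': "{} \<in> \<G>'" by (auto simp: \<G>'_def)
  have oneS: "1 \<in> S" by (rule memS[OF e']) (auto simp: colon_def N_def)
  have sS: "submodule_of D S"
    unfolding S_def
  proof (rule submodule_Union_directed)
    fix X Y assume "X \<in> (\<lambda>G. colon D (N G)) ` \<G>'" "Y \<in> (\<lambda>G. colon D (N G)) ` \<G>'"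
    then obtain G H where "G \<in> \<G>'" "H \<in> \<G>'" "X = colon D (N G)" "Y = colon D (N H)" by blast
    then show "\<exists>Z\<in>(\<lambda>G. colon D (N G)) ` \<G>'. X \<subseteq> Z \<and> Y \<subseteq> Z"
      using colon_antimono[OF Nmono[of _ "G \<union> H"]]
      by (intro bexI[of _ "colon D (N (G \<union> H))"]) (auto simp: \<G>'_def)
  qed (use submodule_colon[OF sr] e' in auto)
  have "a * y \<in> D" if "y \<in> S" for y
    using that aN[OF L'L] by (auto simp: S_def colon_def mult.commute)
  then have fS: "nz_frac_ideal D S" unfolding nz_frac_ideal_def using sS oneS a by (metis singletonD zero_neq_one)
  have "w_cl D S \<subseteq> S"
  proof
    fix y assume "y \<in> w_cl D S"
    then obtain F where F: "finite F" "1 \<in> v_cl D F" "\<forall>f\<in>F. f * y \<in> S" using w_cl_finite[OF D fS] by blast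
    obtain G where G: "G \<in> \<G>'" "(\<lambda>f. f * y) ` F \<subseteq> colon D (N G)"
      using Sdir[of "(\<lambda>f. f * y) ` F"] F by auto
    then have "f * y \<in> v_cl D (colon D (N G))" if "f \<in> F" for f unfolding v_cl_colon using that by blast
    then have "y \<in> v_cl D (colon D (N G))" by (rule one_v_cl_cancel_v[OF F(2)])
    then show "y \<in> S" unfolding v_cl_colon using memS G by blast
  qed
  then have vS: "v_cl D S \<subseteq> S" unfolding w_divisorial_v_cl[OF D wd fS] .
  \<comment> \<open>An element of \<open>(D : S)\<close> lies in the \<open>v\<close>-closure of
    each member of \<open>L'\<close>, that is, in the member itself. By \<open>red\<close> it then
    lies in \<open>M0\<close>, the ideal of denominators of \<open>x\<close>.\<close>
  have "x * y \<in> D" if y: "y \<in> colon D S" for y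
  proof -
    have "y * 1 \<in> D" using y oneS unfolding colon_def by blast
    then have yD: "y \<in> D" by simp
    have "y \<in> M" if M: "M \<in> L'" for M
    proof -
      have "{M} \<in> \<G>'" using M by (auto simp: \<G>'_def)
      then have "colon D (N {M}) \<subseteq> S" using memS by blast
      then have "y \<in> v_cl D (N {M})" unfolding v_cl_def using y colon_antimono by blast
      moreover have "N {M} = M" using id(2)[of M] M by (auto simp: N_def L'_def)
      ultimately show ?thesis using t_Max_v_cl[OF D wd LM(1)[of M]] M by (auto simp: L'_def)
    qed
    then have "y \<in> N L'" using yD by (auto simp: N_def)
    then show ?thesis using red x yD by (auto simp: mult.commute)
  qed
  then have "x \<in> v_cl D S" by (rule v_clI)
  then obtain G where G: "G \<in> \<G>'" "x \<in> colon D (N G)" using vS by (auto simp: S_def)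
  have "finite G" "G \<subseteq> t_Max D - {M0}" using G(1) LM by (auto simp: \<G>'_def L'_def)
  then obtain r where r: "r \<in> D - M0" "\<forall>M\<in>G. r \<in> M" using t_Max_avoid[OF D M0(1)] by blast
  then have "x * r \<in> D" using G(2) by (auto simp: N_def colon_def)
  then show False using x r by (auto simp: mult.commute)
qed

subsection \<open>Localizations at t-maximal ideals\<close>

text \<open>The last hypothesis makes the w-operation trivial: if \<open>x\<close> in
  \<open>I_w\<close> were outside \<open>I\<close>, its multipliers into \<open>I\<close> would lie
  in a t-maximal ideal \<open>M\<close>, contrary to \<open>x\<close> being in
  \<open>I D_M\<close>.\<close>

lemma divisorial_of_w_divisorial:
  assumes D: "qdom D" and wd: "w_divisorial_domain D"
    and t: "\<And>E. nz_ideal D E \<Longrightarrow> 1 \<notin> E \<Longrightarrow> \<exists>P. t_ideal D P \<and> P \<subset> D \<and> E \<subseteq> P"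
  shows "divisorial_domain D"
proof (rule divisorial_domainI)
  note sr = qdom_subring[OF D]
  show "is_subring D" by (rule sr)
  fix I assume I: "nz_ideal D I"
  note fI = nz_ideal_frac[OF sr I] and sI = nz_idealD(1)[OF I] and ID = nz_idealD(3)[OF I]
  show "v_cl D I \<subseteq> I"
  proof
    fix x assume x: "x \<in> v_cl D I"
    have xD: "x \<in> D" using x v_cl_subset_ring[OF sr ID] by blast
    have xw: "x \<in> w_cl D I" using x w_divisorial_v_cl[OF D wd fI] by simp
    define E where "E = {r \<in> D. r * x \<in> I}"
    have "I \<subseteq> E" using ID submodule_smult'[OF sI xD] by (auto simp: E_def)
    then have E: "nz_ideal D E" using multiplier_ideal[OF sr sI, of x] nz_idealD(2)[OF I]
      unfolding nz_ideal_def E_def by blast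
    show "x \<in> I"
    proof (rule ccontr)
      assume "x \<notin> I"
      then have "1 \<notin> E" by (auto simp: E_def)
      then obtain M where M: "M \<in> t_Max D" "E \<subseteq> M" using t[OF E] exists_t_Max[OF D] by blast
      then have "x \<in> loc D M I" using xw w_cl_iff[OF D sI] by blast
      then show False using M(2) by (auto simp: E_def elim: locE)
    qed
  qed
qed

lemma local_ring_proper_ideal:
  assumes A: "local_ring A m" and E: "ideal_of A E" "1 \<notin> E" shows "E \<subseteq> m"
proof
  fix x assume x: "x \<in> E"
  have sE: "submodule_of A E" and xA: "x \<in> A" using E x by (auto simp: ideal_of_def)
  show "x \<in> m"
  proof (rule ccontr)
    assume n: "x \<notin> m"
    then have "inverse x * x \<in> E" using submodule_smult[OF sE _ x] local_ringD(6)[OF A xA] by blast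
    then show False using E(2) local_ringD(7)[OF A xA n] by simp
  qed
qed

text \<open>A divisorial maximal ideal is a proper t-ideal containing every proper ideal, which
  trivializes the w-operation.\<close>

lemma local_ring_w_divisorial:
  assumes A: "local_ring A m" and wd: "w_divisorial_domain A" and m0: "m \<noteq> {0}" and vm: "v_cl A m = m"
  shows "divisorial_domain A"
proof (rule divisorial_of_w_divisorial[OF local_ringD(1)[OF A] wd])
  note sr = local_ringD(2)[OF A]
  have nzm: "nz_ideal A m" using m0 local_ringD(3,4)[OF A] by (simp add: nz_ideal_def ideal_of_def)
  then have "t_ideal A m"
    using vm nz_ideal_frac[OF sr nzm] by (intro divisorial_t_ideal local_ringD(1)[OF A]) (simp add: divisorial_ideal_def)
  moreover have "m \<subset> A" using local_ringD(4,5)[OF A] subring_one[OF sr] by blast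
  ultimately show "\<exists>P. t_ideal A P \<and> P \<subset> A \<and> E \<subseteq> P" if "nz_ideal A E" "1 \<notin> E" for E
    using local_ring_proper_ideal[OF A] that unfolding nz_ideal_def by blast
qed

text \<open>The ring \<open>B = (A : m)\<close> consists of elements quadratic over the
  one-dimensional ring \<open>A\<close>, so each of its nonzero primes contains \<open>m\<close> and
  is minimal over a nonzero \<open>a\<close> in \<open>A\<close>. Such primes are t-ideals, and so
  w-divisorial becomes divisorial.\<close>

lemma divisorial_colon_maximal_ideal:
  assumes A: "local_ring A m" and od: "one_dim A m" and dd: "divisorial_domain A" and m0: "m \<noteq> {0}"
    and np: "\<And>h. m \<noteq> (*) h ` A" and wd: "w_divisorial_domain (colon A m)"
  shows "divisorial_domain (colon A m)"
proof -
  define B where "B = colon A m"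
  note sr = local_ringD(2)[OF A] and mm = local_ringD(3)[OF A]
  note cr = colon_maximal_ideal_ring[OF A m0 np, folded B_def]
  have srB: "is_subring B" and AB: "A \<subseteq> B" using cr by auto
  have D: "qdom B" using qdom_overring[OF local_ringD(1)[OF A]] srB AB by (simp add: overring_def)
  have "divisorial_domain B"
  proof (rule divisorial_of_w_divisorial[OF D wd[folded B_def]])
    fix E assume E: "nz_ideal B E" "1 \<notin> E"
    then obtain P where P: "prime_ideal_of B P" "E \<subseteq> P"
      using exists_prime_ideal[OF srB, of E "{1}"] subring_one[OF srB] by (auto simp: nz_ideal_def)
    note pP = prime_idealD[OF P(1)]
    have sPA: "submodule_of A P" using submodule_mono[OF pP(2) AB] .
    obtain a where a: "a \<in> P" "a \<in> A" "a \<noteq> 0"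
      using submodule_nz_integral[OF local_ringD(1)[OF A] sPA] nz_idealD(2)[OF E(1)] P(2) by blast
    have mP: "m \<subseteq> P"
    proof
      fix s assume s: "s \<in> m"
      then obtain k z where "s ^ k = a * z" "z \<in> A" using od a unfolding one_dim_def by blast
      then have "s ^ k \<in> P" using submodule_smult'[OF sPA _ a(1)] by simp
      then show "s \<in> P" using prime_ideal_power_mem[OF srB P(1)] s AB local_ringD(4)[OF A] by blast
    qed
    have Pm: "c \<in> m" if "c \<in> A" "c \<in> P" for c
      using local_ring_proper_ideal[OF A, of "P \<inter> A"] sPA submodule_Int[OF sPA submodule_self[OF sr]] that pP(4)
      by (auto simp: ideal_of_def)
    have "t_ideal B P"
    proof (rule t_ideal_of_minimal_prime[OF D P(1) a(1,3)])
      fix s assume s: "s \<in> P"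
      have m_case: "\<exists>u\<in>B - P. \<exists>k. \<exists>w\<in>B. u * s ^ k = a * w" if "v \<in> B - P" "v * s ^ n \<in> m" for v n
      proof -
        obtain k z where k: "(v * s ^ n) ^ k = a * z" "z \<in> A" using od a \<open>v * s ^ n \<in> m\<close> unfolding one_dim_def by blast
        then have "v ^ k * s ^ (n * k) = a * z" by (simp add: power_mult_distrib power_mult)
        then show ?thesis using prime_ideal_power[OF srB P(1) that(1)] k(2) AB by blast
      qed
      have one: "1 \<in> B - P" using pP(4) subring_one[OF srB] by blast
      have sB: "s \<in> B" using s pP(3) by blast
      show "\<exists>u\<in>B - P. \<exists>k. \<exists>w\<in>B. u * s ^ k = a * w"
      proof (cases "s \<in> A")
        case True
        then show ?thesis using m_case[OF one, of 1] Pm s by simp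
      next
        case False
        \<comment> \<open>Any element outside \<open>A\<close> completes \<open>1\<close> to
          generators of \<open>B\<close>, so \<open>s\<close> satisfies a monic quadratic equation.
          Its linear coefficient decides: if \<open>q\<close> is in \<open>m\<close>, so is
          \<open>s * s\<close>; otherwise \<open>s - q\<close> is outside \<open>P\<close> and
          multiplies \<open>s\<close> into \<open>m\<close>.\<close>
        have "B = span2 A 1 s"
          unfolding B_def by (rule colon_maximal_ideal_eq[OF A dd _ False]) (use sB B_def in simp)
        then obtain p q where pq: "p \<in> A" "q \<in> A" "s * s = 1 * p + s * q"
          using subring_mult[OF srB sB sB] unfolding span2_def by blast
        have qB: "q \<in> B" using pq AB by blast
        have e: "p = (s - q) * s" using pq(3) by (simp add: algebra_simps)
        then have "p \<in> P" using submodule_smult[OF pP(2) subring_diff[OF srB sB qB] s] by simp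
        then have pm: "p \<in> m" using Pm pq by blast
        show ?thesis
        proof (cases "q \<in> m")
          case False
          then have "q \<notin> P" using Pm pq by blast
          then have "s - q \<notin> P" using submodule_diff[OF srB pP(2) s, of "s - q"] by auto
          then show ?thesis using m_case[of "s - q" 1] subring_diff[OF srB sB qB] pm e by simp
        next
          case True
          then have "s * q \<in> m" using cr(1)[OF True sB] by (simp add: mult.commute)
          then have "s * s \<in> m" using pq(3) pm submodule_add[OF mm] by simp
          then show ?thesis using m_case[OF one, of 2] by (simp add: power2_eq_square)
        qed
      qed
    qed
    moreover have "P \<subset> B" using pP(3,4) subring_one[OF srB] by blast
    ultimately show "\<exists>P. t_ideal B P \<and> P \<subset> B \<and> E \<subseteq> P" using P(2) by blast
  qed
  then show ?thesis unfolding B_def .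
qed

lemma two_gen_of_w_divisorial_overrings:
  assumes A: "local_ring A m" and od: "one_dim A m" and dd: "divisorial_domain A" and m0: "m \<noteq> {0}"
    and wd: "\<And>T. overring A T \<Longrightarrow> w_divisorial_domain T"
  shows "two_gen_ring A"
proof (rule two_gen_of_divisorial[OF A od dd m0])
  assume np: "m \<noteq> (*) h ` A" for h
  have "overring A (colon A m)" using colon_maximal_ideal_ring[OF A m0 np] by (simp add: overring_def)
  then show "divisorial_domain (colon A m)" by (intro divisorial_colon_maximal_ideal[OF A od dd m0 np] wd)
qed

context
  fixes R M :: "'a::field set"
  assumes R: "qdom R" and M: "M \<in> t_Max R"
begin

lemma t_Max_local_ring: "local_ring (loc R M R) (loc R M M)"
  by (rule local_ring_loc[OF R t_Max_prime[OF R M]])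

lemma t_Max_loc_nz: "loc R M M \<noteq> {0}"
  using nz_idealD(2)[OF t_MaxD(2)[OF R M]] loc_upper[OF qdom_subring[OF R] t_Max_prime[OF R M], of M] by blast

text \<open>The fraction \<open>x\<close> with ideal of denominators \<open>M\<close> shows that the
  maximal ideal of \<open>R_M\<close> is divisorial: \<open>x\<close> is in its inverse but not in
  \<open>R_M\<close>, so no unit belongs to the \<open>v\<close>-closure.\<close>

lemma t_Max_loc_divisorial:
  assumes wd: "w_divisorial_domain R" and wdL: "w_divisorial_domain (loc R M R)"
  shows "divisorial_domain (loc R M R)"
proof (rule local_ring_w_divisorial[OF t_Max_local_ring wdL t_Max_loc_nz])
  let ?A = "loc R M R" and ?m = "loc R M M"
  note A = t_Max_local_ring
  obtain x where x: "\<forall>r\<in>R. r * x \<in> R \<longleftrightarrow> r \<in> M" using t_Max_colon[OF R wd M] by blast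
  have xA: "x \<notin> ?A" using x by (auto elim: locE)
  have xm: "x \<in> colon ?A ?m"
    unfolding colon_def
  proof (intro CollectI ballI)
    fix z assume "z \<in> ?m"
    then obtain u where u: "u \<in> R" "u \<notin> M" "u * z \<in> M" by (rule locE)
    then have "(u * z) * x \<in> R" using x nz_idealD(3)[OF t_MaxD(2)[OF R M]] by blast
    then have "u * (x * z) \<in> R" by (simp only: mult_ac)
    then show "x * z \<in> ?A" using u by (blast intro: locI)
  qed
  have "y \<in> ?m" if y: "y \<in> v_cl ?A ?m" for y
  proof (rule ccontr)
    assume n: "y \<notin> ?m"
    have yA: "y \<in> ?A" using y v_cl_subset_ring[OF local_ringD(2,4)[OF A]] by blast
    have "y * x \<in> ?A" using y xm by (blast intro: v_clD)
    then have "inverse y * (y * x) \<in> ?A" using subring_mult[OF local_ringD(2)[OF A] local_ringD(6)[OF A yA n]] by blast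
    then show False using xA local_ringD(7)[OF A yA n] by (simp add: mult.assoc[symmetric])
  qed
  then show "v_cl ?A ?m = ?m" using v_cl_extensive by blast
qed

lemma one_dim_locI:
  assumes *: "\<And>s a. s \<in> M \<Longrightarrow> a \<in> R \<Longrightarrow> a \<noteq> 0 \<Longrightarrow> \<exists>u\<in>R - M. \<exists>k::nat. \<exists>w\<in>R. u * s ^ k = a * w"
  shows "one_dim (loc R M R) (loc R M M)"
  unfolding one_dim_def
proof (intro ballI impI)
  note sr = qdom_subring[OF R] and P = t_Max_prime[OF R M]
  fix s a assume s: "s \<in> loc R M M" and a: "a \<in> loc R M R" "a \<noteq> 0"
  obtain u where u: "u \<in> R" "u \<notin> M" "u * s \<in> M" using s by (rule locE)
  obtain v where v: "v \<in> R" "v \<notin> M" "v * a \<in> R" using a(1) by (rule locE)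
  have nz: "u \<noteq> 0" "v \<noteq> 0" using u v prime_idealD(6)[OF P] by auto
  obtain x k w where x: "x \<in> R - M" "w \<in> R" "x * (u * s) ^ k = v * a * w" using *[OF u(3) v(3)] nz a by auto
  have "x * u ^ k \<in> R - M" using prime_ideal_mult[OF sr P x(1) prime_ideal_power[OF sr P, of u]] u by blast
  moreover have "x \<noteq> 0" using x prime_idealD(6)[OF P] by auto
  then have "s ^ k = a * (v * w / (x * u ^ k))" "(x * u ^ k) * (v * w / (x * u ^ k)) = v * w"
    using x(3) nz by (simp_all add: field_simps power_mult_distrib)
  ultimately show "\<exists>k. \<exists>z\<in>loc R M R. s ^ k = a * z"
    using subring_mult[OF sr v(1) x(2)] by (intro exI[of _ k] bexI[of _ "v * w / (x * u ^ k)"]) (auto intro: locI)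
qed

text \<open>A finitely generated \<open>J\<close> with trivial inverse is not contained in
  \<open>M\<close>, so \<open>JT\<close> contains a unit of \<open>T\<close>. Hypotheses on t-linked
  overrings of \<open>R\<close> thereby reach all overrings of \<open>R_M\<close>.\<close>

lemma t_linked_overring_loc:
  assumes T: "overring (loc R M R) T" shows "t_linked_overring R T"
  unfolding t_linked_overring_def
proof (intro conjI allI impI)
  note sr = qdom_subring[OF R] and P = t_Max_prime[OF R M]
  have LT: "loc R M R \<subseteq> T" and srT: "is_subring T" using T by (auto simp: overring_def)
  have RT: "R \<subseteq> T" using LT loc_upper[OF sr P, of R] by blast
  then show "overring R T" using srT by (simp add: overring_def)
  fix J assume J: "nz_ideal R J \<and> fin_gen R J \<and> colon R J = R"
  then obtain S where S: "finite S" "J = gen R S" by (auto simp: fin_gen_def)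
  have "1 \<in> v_cl R J" unfolding v_cl_def colon_def[of R "colon R J"] using J by auto
  then have v1: "1 \<in> v_cl R S" unfolding S(2) v_cl_gen[OF sr] .
  have "\<not> S \<subseteq> M" using t_MaxD(3,4)[OF R M] S(1) v1 by blast
  then obtain u where u: "u \<in> S" "u \<notin> M" by blast
  then have uJ: "u \<in> J" "u \<in> R" using gen_superset[of S R] S(2) J nz_idealD(3) by blast+
  then have uu: "u \<noteq> 0" "inverse u \<in> T" using u prime_idealD(6)[OF P] inverse_mem_loc[OF sr P] LT by auto
  have JT: "gen T J \<subseteq> T" using J nz_idealD(3)[of R J] RT by (intro gen_least submodule_self srT) auto
  show "colon T (gen T J) = T"
  proof
    show "T \<subseteq> colon T (gen T J)" using JT by (auto simp: colon_def intro: subring_mult[OF srT])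
    show "colon T (gen T J) \<subseteq> T"
    proof
      fix x assume "x \<in> colon T (gen T J)"
      then have "x * u \<in> T" using uJ gen_superset[of J T] by (auto simp: colon_def)
      then have "x * u * inverse u \<in> T" using uu subring_mult[OF srT] by blast
      then show "x \<in> T" using uu by (simp add: mult.assoc)
    qed
  qed
qed

end

lemma t_linked_overring_self:
  assumes "is_subring R" shows "t_linked_overring R R"
  unfolding t_linked_overring_def
proof (intro conjI allI impI)
  show "overring R R" using assms by (simp add: overring_def)
  fix J assume J: "nz_ideal R J \<and> fin_gen R J \<and> colon R J = R"
  then have "gen R J = J" using gen_least[OF nz_idealD(1), of R J J] gen_superset[of J R] by blast
  then show "colon R (gen R J) = R" using J by simp
qed

lemma height_one_prime:
  assumes h: "height R P = 1" and P: "prime_ideal_of R P" and Q: "prime_ideal_of R Q" "Q \<subseteq> P" "Q \<noteq> {0}"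
    and R: "is_subring R"
  shows "Q = P"
proof (rule ccontr)
  assume n: "Q \<noteq> P"
  note z = prime_ideal_zero[OF R]
  have zQ: "{0} \<subset> Q" using Q(3) prime_idealD(6)[OF Q(1)] by blast
  define F where "F i = (if i = 0 then {0} else if i = Suc 0 then Q else P)" for i :: nat
  have "\<exists>F :: nat \<Rightarrow> 'a set. F 2 = P \<and> (\<forall>i\<le>2. prime_ideal_of R (F i)) \<and> (\<forall>i<2. F i \<subset> F (Suc i))"
  proof (intro exI[of _ F] conjI allI impI)
    show "F 2 = P" by (simp add: F_def)
    show "prime_ideal_of R (F i)" for i using z P Q by (simp add: F_def)
    show "F i \<subset> F (Suc i)" if "i < 2" for i
    proof -
      have "i = 0 \<or> i = Suc 0" using that by auto
      then show ?thesis using zQ Q(2) n by (auto simp: F_def)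
    qed
  qed
  then have "enat 2 \<le> height R P" unfolding height_def by (intro Sup_upper) blast
  then show False using h by (simp add: one_enat_def)
qed

text \<open>If no \<open>u * s ^ k\<close> with \<open>u\<close> outside \<open>M\<close> were a
  multiple of \<open>a\<close>, some prime would contain \<open>a\<close> and avoid all of them. It
  would lie strictly between zero and \<open>M\<close>, which as a t-prime has height one.\<close>

lemma t_dimension_one_loc:
  assumes R: "qdom R" and td: "t_dimension_one R" and M: "M \<in> t_Max R"
  shows "one_dim (loc R M R) (loc R M M)"
proof (rule one_dim_locI[OF R M])
  note sr = qdom_subring[OF R] and P = t_Max_prime[OF R M]
  fix s a assume s: "s \<in> M" and a: "a \<in> R" "a \<noteq> 0"
  have sR: "s \<in> R" using s prime_idealD(3)[OF P] by blast
  show "\<exists>u\<in>R - M. \<exists>k. \<exists>w\<in>R. u * s ^ k = a * w"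
  proof (rule ccontr)
    assume no: "\<not> ?thesis"
    define S where "S = {u * s ^ k | u k. u \<in> R - M}"
    have SI: "u * s ^ k \<in> S" if "u \<in> R - M" for u k using that by (auto simp: S_def)
    have "\<exists>Q. prime_ideal_of R Q \<and> (*) a ` R \<subseteq> Q \<and> Q \<inter> S = {}"
    proof (rule exists_prime_ideal[OF sr])
      show "ideal_of R ((*) a ` R)"
        unfolding ideal_of_def using submodule_mult_image[OF submodule_self[OF sr], of a] subring_mult[OF sr a(1)] by blast
      show "S \<subseteq> R" unfolding S_def using subring_mult[OF sr _ subring_power[OF sr sR]] by blast
      show "S \<noteq> {}" using SI[of 1] subring_one[OF sr] prime_idealD(4)[OF P] by blast
      show "x * y \<in> S" if "x \<in> S" "y \<in> S" for x y
      proof -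
        obtain u k v l where "x = u * s ^ k" "y = v * s ^ l" "u \<in> R - M" "v \<in> R - M"
          using \<open>x \<in> S\<close> \<open>y \<in> S\<close> by (auto simp: S_def)
        moreover have "u * s ^ k * (v * s ^ l) = (u * v) * s ^ (k + l)" by (simp add: power_add mult_ac)
        ultimately show ?thesis using SI[OF prime_ideal_mult[OF sr P], of u v "k + l"] by (simp only:)
      qed
      show "(*) a ` R \<inter> S = {}"
      proof (rule ccontr)
        assume "(*) a ` R \<inter> S \<noteq> {}"
        then obtain w u k where "w \<in> R" "u \<in> R - M" "u * s ^ k = a * w" unfolding S_def by force
        then show False using no by blast
      qed
    qed
    then obtain Q where Q: "prime_ideal_of R Q" "(*) a ` R \<subseteq> Q" "Q \<inter> S = {}" by blast
    have aQ: "a \<in> Q" using Q(2) subring_one[OF sr] by force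
    have "Q \<subseteq> M"
    proof
      fix q assume q: "q \<in> Q"
      show "q \<in> M"
      proof (rule ccontr)
        assume "q \<notin> M"
        then have "q * s ^ 0 \<in> S" using q prime_idealD(3)[OF Q(1)] by (intro SI) auto
        then show False using q Q(3) by auto
      qed
    qed
    moreover have "1 * s ^ 1 \<in> S" using subring_one[OF sr] prime_idealD(4)[OF P] by (intro SI) auto
    then have "s \<notin> Q" using Q(3) by auto
    moreover have "Q \<noteq> {0}" using aQ a by blast
    moreover have "t_prime R M" unfolding t_prime_def
      using P t_MaxD(1,2)[OF R M] by (auto simp: nz_ideal_def)
    then have "height R M = 1" using td by (simp add: t_dimension_one_def)
    ultimately show False using height_one_prime[OF _ P Q(1) _ _ sr] s by blast
  qed
qed

subsection \<open>Mori domains\<close>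

text \<open>Otherwise adding elements outside the current \<open>v\<close>-closure builds a strictly
  ascending chain of divisorial ideals. A fixed nonzero \<open>p\<close> is kept in all the finite
  sets so that their closures are nonzero.\<close>

lemma Mori_finite:
  assumes R: "qdom R" and mori: "Mori R" and I: "nz_ideal R I"
  shows "\<exists>S. finite S \<and> S \<subseteq> I \<and> I \<subseteq> v_cl R S"
proof (rule ccontr)
  assume no: "\<not> ?thesis"
  note sr = qdom_subring[OF R] and IR = nz_idealD(3)[OF I]
  obtain p where p: "p \<in> I" "p \<noteq> 0" using nz_idealD(2)[OF I] by blast
  have "\<exists>F :: nat \<Rightarrow> 'a set. \<forall>n. (finite (F n) \<and> F n \<subseteq> I \<and> p \<in> F n) \<and> (F n \<subseteq> F (Suc n) \<and> \<not> F (Suc n) \<subseteq> v_cl R (F n))"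
  proof (rule dependent_nat_choice)
    show "\<exists>S. finite S \<and> S \<subseteq> I \<and> p \<in> S" using p by (intro exI[of _ "{p}"]) auto
    fix S and n :: nat assume S: "finite S \<and> S \<subseteq> I \<and> p \<in> S"
    then obtain x where "x \<in> I" "x \<notin> v_cl R S" using no by blast
    then show "\<exists>T. (finite T \<and> T \<subseteq> I \<and> p \<in> T) \<and> (S \<subseteq> T \<and> \<not> T \<subseteq> v_cl R S)"
      using S by (intro exI[of _ "insert x S"]) auto
  qed
  then obtain F :: "nat \<Rightarrow> 'a set"
    where "\<forall>n. (finite (F n) \<and> F n \<subseteq> I \<and> p \<in> F n) \<and> (F n \<subseteq> F (Suc n) \<and> \<not> F (Suc n) \<subseteq> v_cl R (F n))"
    by (elim exE)
  then have F: "\<And>n. finite (F n)" "\<And>n. F n \<subseteq> I" "\<And>n. p \<in> F n"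
    "\<And>n. F n \<subseteq> F (Suc n)" "\<And>n. \<not> F (Suc n) \<subseteq> v_cl R (F n)" by simp_all
  have "\<forall>n. divisorial_ideal R (v_cl R (F n)) \<and> v_cl R (F n) \<subset> R \<and> v_cl R (F n) \<subseteq> v_cl R (F (Suc n))"
  proof (intro allI conjI)
    fix n
    have sub: "v_cl R (F n) \<subseteq> R" using v_cl_subset_ring[OF sr, of "F n"] F(2)[of n] IR by blast
    have "nz_ideal R (v_cl R (F n))"
      using v_cl_extensive[of "F n" R] F(3)[of n] p sub by (intro nz_idealI[of _ _ p] submodule_v_cl sr) auto
    then show "divisorial_ideal R (v_cl R (F n))" using nz_ideal_frac[OF sr] by (simp add: divisorial_ideal_def v_cl_idem)
    show "v_cl R (F n) \<subset> R" using sub F(5)[of n] F(2)[of "Suc n"] IR by blast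
    show "v_cl R (F n) \<subseteq> v_cl R (F (Suc n))" using F(4) by (rule v_cl_mono)
  qed
  then have "\<exists>N. \<forall>n\<ge>N. v_cl R (F n) = v_cl R (F N)"
    by (rule mp[OF spec[OF mori[unfolded Mori_def], of "\<lambda>n. v_cl R (F n)"]])
  then obtain N where N: "\<forall>n\<ge>N. v_cl R (F n) = v_cl R (F N)" by (elim exE)
  have "v_cl R (F (Suc N)) = v_cl R (F N)" by (rule N[rule_format]) simp
  then have "F (Suc N) \<subseteq> v_cl R (F N)" using v_cl_extensive[of "F (Suc N)" R] by (simp only:)
  then show False using F(5)[of N] by (rule notE[rotated])
qed

lemma Mori_w_divisorial:
  assumes R: "qdom R" and mori: "Mori R" and dL: "\<And>M. M \<in> t_Max R \<Longrightarrow> divisorial_domain (loc R M R)"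
  shows "w_divisorial_domain R"
proof (rule w_divisorial_domainI_ideal[OF R])
  fix I assume I: "nz_ideal R I"
  note fI = nz_ideal_frac[OF qdom_subring[OF R] I]
  obtain S where "finite S" "S \<subseteq> I" "I \<subseteq> v_cl R S" using Mori_finite[OF R mori I] by blast
  then show "v_cl R I \<subseteq> w_cl R I"
    using v_cl_subset_w_cl_of_finite[OF R dL fI] w_cl_extensive[OF R nz_idealD(1)[OF I]] by blast
qed

text \<open>Lets the chain condition of \<open>R\<close> control chains of ideals of
  \<open>R_P\<close>. The Mori property replaces the contracted ideal by a finite set, whose
  \<open>v\<close>-closure can be compared with the one over \<open>R_P\<close>.\<close>

lemma Mori_contraction_divisorial:
  assumes R: "qdom R" and mori: "Mori R" and P: "prime_ideal_of R P" and dL: "divisorial_domain (loc R P R)"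
    and J: "nz_ideal (loc R P R) J"
  shows "divisorial_ideal R (J \<inter> R)"
proof -
  note sr = qdom_subring[OF R]
  have nz: "nz_ideal R (J \<inter> R)" by (rule nz_ideal_contraction[OF R loc_upper[OF sr P] J])
  obtain S where S: "finite S" "S \<subseteq> J \<inter> R" "J \<inter> R \<subseteq> v_cl R S" using Mori_finite[OF R mori nz] by blast
  have "v_cl R (J \<inter> R) \<subseteq> J \<inter> R"
  proof
    fix x assume x: "x \<in> v_cl R (J \<inter> R)"
    then have "x \<in> v_cl R S" using v_cl_mono[OF S(3), of R] unfolding v_cl_idem by blast
    then have "x \<in> v_cl (loc R P R) S" by (rule v_cl_finite_subset_loc[OF sr P S(1)])
    then have "x \<in> v_cl (loc R P R) J" using v_cl_mono[of S J "loc R P R"] S(2) by blast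
    then have "x \<in> J"
      using divisorial_domain_frac[OF subring_loc[OF sr P] dL nz_ideal_frac[OF subring_loc[OF sr P] J]] by simp
    moreover have "x \<in> R" using x v_cl_subset_ring[OF sr, of "J \<inter> R"] by blast
    ultimately show "x \<in> J \<inter> R" by blast
  qed
  then show ?thesis unfolding divisorial_ideal_def using nz_ideal_frac[OF sr nz] v_cl_extensive by blast
qed

text \<open>The descending chain \<open>(a, s\<^sup>n)\<close> stabilizes because its dual is an ascending chain of divisorial
  fractional ideals.\<close>
lemma Mori_one_dim:
  assumes R: "qdom R" and mori: "Mori R" and M: "M \<in> t_Max R" and dL: "divisorial_domain (loc R M R)"
  shows "one_dim (loc R M R) (loc R M M)"
  unfolding one_dim_def
proof (intro ballI impI)
  let ?A = "loc R M R" and ?m = "loc R M M"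
  note sr = qdom_subring[OF R] and P = t_Max_prime[OF R M] and A = t_Max_local_ring[OF R M]
  note srA = local_ringD(2)[OF A]
  fix s a assume s: "s \<in> ?m" and a: "a \<in> ?A" "a \<noteq> 0"
  show "\<exists>k. \<exists>z\<in>?A. s ^ k = a * z"
  proof (cases "s = 0")
    case True
    then show ?thesis using subring_zero[OF srA] by (intro exI[of _ 1] bexI[of _ 0]) auto
  next
    case s0: False
    have sA: "s \<in> ?A" using s local_ringD(4)[OF A] by blast
    define F where "F n = span2 ?A a (s ^ n)" for n :: nat
    have sF: "submodule_of ?A (F n)" for n unfolding F_def by (rule submodule_span2[OF srA])
    have gF: "a \<in> F n" "s ^ n \<in> F n" for n unfolding F_def using span2_gens[OF srA] by blast+
    have FA: "F n \<subseteq> ?A" for n unfolding F_def by (intro span2_least submodule_self srA a subring_power sA)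
    have nzF: "nz_ideal ?A (F n)" for n using nz_idealI[OF sF FA gF(1) a(2)] .
    have dec: "F (Suc n) \<subseteq> F n" for n
      unfolding F_def[of "Suc n"] using submodule_smult[OF sF sA gF(2)] gF by (intro span2_least sF) auto
    define X where "X n = colon ?A (F n)" for n
    have inc: "X n \<subseteq> X (Suc n)" for n unfolding X_def by (rule colon_antimono[OF dec])
    have colX: "colon ?A (X n) = F n" for n
      using divisorial_domain_frac[OF srA dL nz_ideal_frac[OF srA nzF]] unfolding X_def v_cl_def .
    \<comment> \<open>The factor \<open>a\<close> makes the inverses integral and the factor
      \<open>s\<close> puts them into the maximal ideal, since the chain condition concerns proper
      integral ideals.\<close>
    define c where "c = s * a"
    have c0: "c \<noteq> 0" using a s0 by (simp add: c_def)
    define J where "J n = (*) c ` X n" for n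
    have sJ: "submodule_of ?A (J n)" for n unfolding J_def X_def by (intro submodule_mult_image submodule_colon srA)
    have Jm: "J n \<subseteq> ?m" for n
    proof
      fix y assume "y \<in> J n"
      then obtain x where x: "x \<in> X n" "y = c * x" by (auto simp: J_def)
      then have "x * a \<in> ?A" using gF(1)[of n] by (auto simp: X_def colon_def)
      then have "(x * a) * s \<in> ?m" using submodule_smult[OF local_ringD(3)[OF A] _ s] by blast
      then show "y \<in> ?m" unfolding x(2) c_def by (simp add: mult_ac)
    qed
    have JA: "J n \<subseteq> ?A" for n using Jm local_ringD(4)[OF A] by blast
    have "1 \<in> X n" for n using FA by (auto simp: X_def colon_def)
    then have "c * 1 \<in> J n" for n unfolding J_def by blast
    then have nzJ: "nz_ideal ?A (J n)" for n using nz_idealI[OF sJ JA, of "c * 1"] c0 by simp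
    have "\<forall>n. divisorial_ideal R (J n \<inter> R) \<and> J n \<inter> R \<subset> R \<and> J n \<inter> R \<subseteq> J (Suc n) \<inter> R"
    proof (intro allI conjI)
      fix n
      show "divisorial_ideal R (J n \<inter> R)" by (rule Mori_contraction_divisorial[OF R mori P dL nzJ])
      have "1 \<notin> J n" using Jm local_ringD(5)[OF A] by blast
      then show "J n \<inter> R \<subset> R" using subring_one[OF sr] by blast
      show "J n \<inter> R \<subseteq> J (Suc n) \<inter> R" unfolding J_def using inc[of n] by blast
    qed
    then have "\<exists>N. \<forall>n\<ge>N. J n \<inter> R = J N \<inter> R"
      by (rule mp[OF spec[OF mori[unfolded Mori_def], of "\<lambda>n. J n \<inter> R"]])
    then obtain N where N: "\<forall>n\<ge>N. J n \<inter> R = J N \<inter> R" by (elim exE)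
    have "J (Suc N) \<inter> R = J N \<inter> R" by (rule N[rule_format]) simp
    then have JN: "J (Suc N) = J N" using loc_contraction[OF sr P sJ JA] by metis
    have "X (Suc N) = X N"
    proof -
      have "inj ((*) c)" using c0 by (simp add: inj_on_def)
      then show ?thesis using JN unfolding J_def by (simp add: inj_image_eq_iff)
    qed
    then have "F (Suc N) = F N" using colX by metis
    \<comment> \<open>Stationarity gives \<open>s ^ N * (1 - s * q) = a * p\<close>, and
      \<open>1 - s * q\<close> is a unit.\<close>
    then have "s ^ N \<in> span2 ?A a (s ^ Suc N)" using gF(2)[of N] F_def by blast
    then obtain p q where pq: "p \<in> ?A" "q \<in> ?A" "s ^ N = a * p + s ^ Suc N * q" unfolding span2_def by blast
    have u: "1 - s * q \<in> ?A" "1 - s * q \<notin> ?m"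
      using local_ring_unit_minus[OF A subring_one[OF srA] local_ringD(5)[OF A]]
        submodule_smult'[OF local_ringD(3)[OF A] pq(2) s] by blast+
    then have "1 - s * q \<noteq> 0" using local_ringD(7)[OF A] by blast
    moreover have "s ^ N * (1 - s * q) = a * p" using pq(3) by (simp add: algebra_simps)
    ultimately have "s ^ N = a * (p / (1 - s * q))" by (simp add: field_simps)
    then show ?thesis using local_ring_div[OF A pq(1) u] by blast
  qed
qed

subsection \<open>Two w-generated ideals\<close>

text \<open>Nakayama's lemma for two generators made explicit: \<open>a\<close> and \<open>b\<close>
  arise from \<open>x\<close> and \<open>y\<close> by a matrix that modulo \<open>m\<close> is
  diagonal with unit entries, so its determinant \<open>e\<close> is a unit and Cramer's rule
  inverts it.\<close>

lemma local_generation_by_approximation: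
  assumes A: "local_ring A m" and J: "J = span2 A x y"
    and u: "u \<in> A" "u \<notin> m" and v: "v \<in> A" "v \<notin> m"
    and c: "c \<in> m" "d \<in> m" "c' \<in> m" "d' \<in> m"
    and a: "a = u * x + (x * c + y * d)" and b: "b = v * y + (x * c' + y * d')"
  shows "span2 A a b = J"
proof -
  note sr = local_ringD(2)[OF A] and mm = local_ringD(3)[OF A] and mA = local_ringD(4)[OF A]
  have cA: "c \<in> A" "d \<in> A" "c' \<in> A" "d' \<in> A" using c mA by auto
  define p q where "p = u + c" and "q = v + d'"
  have pq: "p \<in> A" "p \<notin> m" "q \<in> A" "q \<notin> m"
    unfolding p_def q_def using local_ring_unit_plus[OF A] u v c by auto
  then have "p * q \<notin> m" using local_ring_prime[OF A] by blast
  define e where "e = p * q - d * c'"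
  have e: "e \<in> A" "e \<notin> m"
    unfolding e_def
    using local_ring_unit_minus[OF A subring_mult[OF sr pq(1,3)] \<open>p * q \<notin> m\<close> submodule_smult[OF mm cA(2) c(3)]] by blast+
  then have e0: "e \<noteq> 0" using local_ringD(7)[OF A] by blast
  have ab: "a = p * x + d * y" "b = c' * x + q * y" using a b by (auto simp: p_def q_def algebra_simps)
  show ?thesis unfolding J
  proof (rule span2_eqI[OF sr])
    show "a \<in> span2 A x y" unfolding ab by (rule span2I[OF pq(1) cA(2)]) (simp add: mult.commute)
    show "b \<in> span2 A x y" unfolding ab by (rule span2I[OF cA(3) pq(3)]) (simp add: mult.commute)
    have "q * a - d * b = e * x" "p * b - c' * a = e * y" unfolding ab e_def by (simp_all add: algebra_simps)
    then have "x = (q * a - d * b) / e" "y = (p * b - c' * a) / e" using e0 by simp_all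
    then have "x = a * (q / e) + b * (- d / e)" "y = a * (- c' / e) + b * (p / e)"
      by (simp_all add: divide_inverse algebra_simps)
    moreover have "q / e \<in> A" "- d / e \<in> A" "- c' / e \<in> A" "p / e \<in> A"
      using pq cA e by (auto intro!: local_ring_div[OF A] subring_uminus[OF sr] simp del: minus_divide_left)
    ultimately show "x \<in> span2 A a b" "y \<in> span2 A a b" using span2I by blast+
  qed
qed

lemma span2_unit_multiples:
  assumes D: "is_subring D" and u: "u \<in> D" "inverse u \<in> D" "u \<noteq> 0" and v: "v \<in> D" "inverse v \<in> D" "v \<noteq> 0"
  shows "span2 D (u * a) (v * b) = span2 D a b"
proof (rule span2_eqI[OF D])
  show "u * a \<in> span2 D a b" "v * b \<in> span2 D a b"
    using submodule_smult[OF submodule_span2[OF D]] u v span2_gens[OF D] by blast+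
  have "inverse u * (u * a) \<in> span2 D (u * a) (v * b)" "inverse v * (v * b) \<in> span2 D (u * a) (v * b)"
    using submodule_smult[OF submodule_span2[OF D]] u v span2_gens[OF D] by blast+
  then show "a \<in> span2 D (u * a) (v * b)" "b \<in> span2 D (u * a) (v * b)"
    using u v by (simp_all add: mult.assoc[symmetric])
qed

lemma submodule_sum:
  "submodule_of D I \<Longrightarrow> (\<And>x. x \<in> S \<Longrightarrow> f x \<in> I) \<Longrightarrow> (\<Sum>x\<in>S. f x) \<in> I"
  by (induction S rule: infinite_finite_induct) (auto intro: submodule_zero submodule_add)

text \<open>The element is the sum of all \<open>e M * f M\<close>, where \<open>e M\<close> is
  outside \<open>M\<close> but in every other member of \<open>F\<close>. Comaximality may fail,
  hence a factor \<open>u\<close> in place of \<open>1\<close>.\<close>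

lemma t_Max_approximation:
  assumes R: "qdom R" and I: "submodule_of R I" and F: "finite F" "F \<subseteq> t_Max R"
    and f: "\<And>M. M \<in> F \<Longrightarrow> f M \<in> I"
  shows "\<exists>b\<in>I. \<forall>M\<in>F. \<exists>u\<in>R - M. b - u * f M \<in> gen R {x * y | x y. x \<in> M \<and> y \<in> I}"
proof -
  have "\<exists>r\<in>R - M. \<forall>N\<in>F - {M}. r \<in> N" if "M \<in> F" for M
    using that F by (intro t_Max_avoid[OF R]) auto
  then obtain e where e: "\<And>M. M \<in> F \<Longrightarrow> e M \<in> R - M" "\<And>M N. M \<in> F \<Longrightarrow> N \<in> F - {M} \<Longrightarrow> e M \<in> N" by metis
  define b where "b = (\<Sum>M\<in>F. e M * f M)"
  have "b \<in> I" unfolding b_def using e(1) f by (intro submodule_sum[OF I] submodule_smult[OF I]) auto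
  moreover have "b - e M * f M \<in> gen R {x * y | x y. x \<in> M \<and> y \<in> I}" if M: "M \<in> F" for M
  proof -
    have "b - e M * f M = (\<Sum>N\<in>F - {M}. e N * f N)" unfolding b_def using F(1) M by (simp add: sum_diff1)
    also have "\<dots> \<in> gen R {x * y | x y. x \<in> M \<and> y \<in> I}"
    proof (rule submodule_sum[OF submodule_gen])
      fix N assume N: "N \<in> F - {M}"
      then have "e N \<in> M" "f N \<in> I" using e(2)[of N M] M f by auto
      then show "e N * f N \<in> gen R {x * y | x y. x \<in> M \<and> y \<in> I}"
        using gen_superset[of "{x * y | x y. x \<in> M \<and> y \<in> I}" R] by blast
    qed
    finally show ?thesis .
  qed
  ultimately show ?thesis using e(1) by blast
qed

text \<open>Generators of the localized ideal are moved into \<open>I\<close> by their denominators,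
  which are units there.\<close>

lemma two_gens_of_loc:
  assumes R: "qdom R" and M: "prime_ideal_of R M" and tg: "two_gen_ring (loc R M R)" and I: "nz_ideal R I"
  shows "\<exists>x\<in>I. \<exists>y\<in>I. loc R M I = span2 (loc R M R) x y"
proof -
  let ?A = "loc R M R"
  note sr = qdom_subring[OF R]
  note srA = subring_loc[OF sr M]
  have "nz_frac_ideal ?A (loc R M I)" by (rule nz_frac_ideal_loc[OF sr M nz_ideal_frac[OF sr I]])
  then obtain x y where xy: "loc R M I = span2 ?A x y" using two_gen_frac[OF tg] by blast
  then have "x \<in> loc R M I" "y \<in> loc R M I" using span2_gens[OF srA] by blast+
  then obtain u v where u: "u \<in> R - M" "u * x \<in> I" and v: "v \<in> R - M" "v * y \<in> I" by (auto simp: loc_def)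
  have "span2 ?A (u * x) (v * y) = span2 ?A x y"
    using u v loc_upper[OF sr M, of R] inverse_mem_loc[OF sr M] prime_idealD(6)[OF M]
    by (intro span2_unit_multiples srA) auto
  then show ?thesis using u v xy by blast
qed

text \<open>Turns the error terms of the approximation, which lie in \<open>MI\<close>, into
  coefficients in the maximal ideal of \<open>R_M\<close>.\<close>

lemma gen_products_subset:
  assumes R: "qdom R" and M: "prime_ideal_of R M" and J: "loc R M I = span2 (loc R M R) x y"
    and z: "z \<in> gen R {x * y | x y. x \<in> M \<and> y \<in> I}"
  shows "\<exists>c\<in>loc R M M. \<exists>d\<in>loc R M M. z = x * c + y * d"
proof -
  note sr = qdom_subring[OF R]
  let ?A = "loc R M R" and ?m = "loc R M M"
  note A = local_ring_loc[OF R M]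
  note mm = local_ringD(3)[OF A] and RA = loc_upper[OF sr M, of R]
  let ?X = "{x * c + y * d | c d. c \<in> ?m \<and> d \<in> ?m}"
  have XI: "w = x * c + y * d \<Longrightarrow> c \<in> ?m \<Longrightarrow> d \<in> ?m \<Longrightarrow> w \<in> ?X" for w c d by blast
  have "submodule_of R ?X"
    unfolding submodule_of_def
  proof (intro conjI ballI)
    show "0 \<in> ?X" using submodule_zero[OF mm] by (intro XI[of _ 0 0]) auto
    fix w assume "w \<in> ?X"
    then obtain c d where w: "w = x * c + y * d" "c \<in> ?m" "d \<in> ?m" by blast
    { fix w' assume "w' \<in> ?X"
      then obtain c' d' where w': "w' = x * c' + y * d'" "c' \<in> ?m" "d' \<in> ?m" by blast
      show "w + w' \<in> ?X"
        using w w' by (intro XI[of _ "c + c'" "d + d'"] submodule_add[OF mm]) (auto simp: algebra_simps) }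
    { fix r assume "r \<in> R"
      then have rA: "r \<in> ?A" using RA by blast
      show "r * w \<in> ?X"
        using w by (intro XI[of _ "r * c" "r * d"] submodule_smult[OF mm rA]) (auto simp: algebra_simps) }
  qed
  moreover have "{x * y | x y. x \<in> M \<and> y \<in> I} \<subseteq> ?X"
  proof
    fix w assume "w \<in> {x * y | x y. x \<in> M \<and> y \<in> I}"
    then obtain s t where st: "w = s * t" "s \<in> M" "t \<in> I" by blast
    have "t \<in> span2 ?A x y" using st loc_upper[OF sr M, of I] J by blast
    then obtain p q where pq: "p \<in> ?A" "q \<in> ?A" "t = x * p + y * q" unfolding span2_def by blast
    have sm: "s \<in> ?m" using st loc_upper[OF sr M, of M] by blast
    show "w \<in> ?X" using pq st submodule_smult[OF mm _ sm]
      by (intro XI[of _ "p * s" "q * s"]) (auto simp: algebra_simps)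
  qed
  ultimately have "gen R {x * y | x y. x \<in> M \<and> y \<in> I} \<subseteq> ?X" by (rule gen_least)
  then show ?thesis using z by blast
qed

text \<open>Fix a nonzero \<open>a0\<close> in \<open>I\<close>. At the finitely many t-maximal
  ideals containing \<open>a0\<close>, \<open>a\<close> approximates a first local generator and
  \<open>b\<close> a second one. At the remaining ones containing \<open>a\<close>, \<open>b\<close>
  is arranged to be a unit, and everywhere else \<open>a\<close> is a unit.\<close>

lemma two_w_generated_of_local:
  assumes R: "qdom R" and tg: "\<And>M. M \<in> t_Max R \<Longrightarrow> two_gen_ring (loc R M R)"
    and fc: "\<And>a. a \<in> R \<Longrightarrow> a \<noteq> 0 \<Longrightarrow> finite {M \<in> t_Max R. a \<in> M}" and I: "nz_ideal R I"
  shows "two_w_generated R I"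
proof -
  note sr = qdom_subring[OF R] and sI = nz_idealD(1)[OF I] and IR = nz_idealD(3)[OF I]
  let ?P = "\<lambda>M. gen R {x * y | x y. x \<in> M \<and> y \<in> I}"
  obtain a0 where a0: "a0 \<in> I" "a0 \<noteq> 0" using nz_idealD(2)[OF I] by blast
  define G where "G = {M \<in> t_Max R. a0 \<in> M}"
  have finG: "finite G" and GM: "G \<subseteq> t_Max R" using fc a0 IR by (auto simp: G_def)
  have "\<exists>x\<in>I. \<exists>y\<in>I. loc R M I = span2 (loc R M R) x y" if "M \<in> t_Max R" for M
    using two_gens_of_loc[OF R t_Max_prime[OF R that] tg[OF that] I] .
  then obtain f g where fg: "\<And>M. M \<in> t_Max R \<Longrightarrow> f M \<in> I \<and> g M \<in> I \<and> loc R M I = span2 (loc R M R) (f M) (g M)" by metis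
  obtain a1 where a1: "a1 \<in> I" "\<forall>M\<in>G. \<exists>u\<in>R - M. a1 - u * f M \<in> ?P M"
    using t_Max_approximation[OF R sI finG GM, of f] fg GM by blast
  obtain a where a: "a \<in> I" "a \<noteq> 0" "\<forall>M\<in>G. \<exists>u\<in>R - M. a - u * f M \<in> ?P M"
  proof (cases "a1 = 0")
    case False then show ?thesis using that a1 by blast
  next
    \<comment> \<open>A nonzero \<open>a\<close> makes \<open>H\<close> finite. Since
      \<open>a0\<close> lies in \<open>I\<close> and in each \<open>M\<close> of \<open>G\<close>,
      its square vanishes modulo \<open>MI\<close> and can replace the zero element.\<close>
    case True
    have "\<exists>u\<in>R - M. a0 * a0 - u * f M \<in> ?P M" if M: "M \<in> G" for M
    proof -
      obtain u where u: "u \<in> R - M" "a1 - u * f M \<in> ?P M" using a1 M by blast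
      have "a0 * a0 \<in> ?P M"
        using M a0 gen_superset[of "{x * y | x y. x \<in> M \<and> y \<in> I}" R] unfolding G_def by blast
      then have "a0 * a0 + (a1 - u * f M) \<in> ?P M" using submodule_add[OF submodule_gen] u(2) by blast
      then show ?thesis using u(1) True by auto
    qed
    moreover have "a0 * a0 \<in> I" "a0 * a0 \<noteq> 0" using a0 IR submodule_smult[OF sI] by auto
    ultimately show ?thesis using that by blast
  qed
  define H where "H = G \<union> {M \<in> t_Max R. a \<in> M}"
  have finH: "finite H" and HM: "H \<subseteq> t_Max R" using fc[of a] a IR finG GM by (auto simp: H_def)
  \<comment> \<open>At members of \<open>H\<close> outside \<open>G\<close> the element
    \<open>a0\<close> is a local unit, so approximating it keeps \<open>b\<close> out of
    \<open>M\<close>.\<close>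
  define h where "h M = (if M \<in> G then g M else a0)" for M
  have "h M \<in> I" if "M \<in> H" for M using fg[of M] HM that a0(1) by (auto simp: h_def)
  then obtain b where b: "b \<in> I" "\<forall>M\<in>H. \<exists>u\<in>R - M. b - u * h M \<in> ?P M"
    using t_Max_approximation[OF R sI finH HM, of h] by blast
  have key: "loc R M (span2 R a b) = loc R M I" if M: "M \<in> t_Max R" for M
  proof -
    note P = t_Max_prime[OF R M]
    let ?A = "loc R M R" and ?m = "loc R M M"
    note A = local_ring_loc[OF R P]
    note srA = local_ringD(2)[OF A] and RA = loc_upper[OF sr P, of R]
    have unit: "u \<notin> ?m" if "u \<in> R - M" for u
      using prime_ideal_mult[OF sr P _ that] by (auto elim!: locE)
    have full: ?thesis if c: "c \<in> span2 R a b" "c \<in> R - M" for c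
    proof -
      have sub: "span2 R a b \<subseteq> I" by (intro span2_least sI a b)
      have "R \<subseteq> loc R M (span2 R a b)"
        using c submodule_smult'[OF submodule_span2[OF sr] _ c(1)] by (auto intro!: locI[OF c(2)])
      then have "loc R M I \<subseteq> loc R M (span2 R a b)"
        using IR loc_mono[of I "loc R M (span2 R a b)" R M]
          loc_module[OF sr P submodule_loc[OF sr P submodule_span2[OF sr]]] by simp
      then show ?thesis using loc_mono[OF sub] by blast
    qed
    consider "M \<in> G" | "M \<notin> G" "a \<in> M" | "a \<notin> M" by blast
    then show ?thesis
    proof cases
      case 1
      have J: "loc R M I = span2 ?A (f M) (g M)" using fg M by blast
      obtain u where u: "u \<in> R - M" "a - u * f M \<in> ?P M" using a 1 by blast
      have MH: "M \<in> H" and hM: "h M = g M" using 1 by (auto simp: H_def h_def)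
      obtain v where v: "v \<in> R - M" "b - v * g M \<in> ?P M" using bspec[OF b(2) MH] unfolding hM by (elim bexE)
      obtain c d where c: "c \<in> ?m" "d \<in> ?m" "a - u * f M = f M * c + g M * d"
        using gen_products_subset[OF R P J u(2)] by blast
      obtain c' d' where c': "c' \<in> ?m" "d' \<in> ?m" "b - v * g M = f M * c' + g M * d'"
        using gen_products_subset[OF R P J v(2)] by blast
      have "span2 ?A a b = loc R M I"
      proof (rule local_generation_by_approximation[OF A J _ unit[OF u(1)] _ unit[OF v(1)] c(1,2) c'(1,2)])
        show "u \<in> ?A" "v \<in> ?A" using u v RA by auto
        show "a = u * f M + (f M * c + g M * d)" "b = v * g M + (f M * c' + g M * d')"
          using c(3) c'(3) by (simp_all add: algebra_simps)
      qed
      then show ?thesis unfolding loc_span2[OF sr P] .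
    next
      case 2
      have MH: "M \<in> H" and hM: "h M = a0" using 2 M by (auto simp: H_def h_def)
      obtain u where u: "u \<in> R - M" "b - u * a0 \<in> ?P M" using bspec[OF b(2) MH] unfolding hM by (elim bexE)
      have "a0 \<in> R - M" using 2 M a0 IR by (auto simp: G_def)
      then have n: "u * a0 \<in> R - M" using prime_ideal_mult[OF sr P u(1)] by blast
      have "?P M \<subseteq> M"
        using IR submodule_smult'[OF prime_idealD(2)[OF P]] by (intro gen_least prime_idealD(2)[OF P]) auto
      then have "b - u * a0 \<in> M" using u by blast
      then have "b \<notin> M" using submodule_diff[OF sr prime_idealD(2)[OF P], of b "b - u * a0"] n by auto
      then show ?thesis using full[of b] span2_gens(2)[OF sr] b IR by blast
    next
      case 3
      then show ?thesis using full[of a] span2_gens(1)[OF sr] a IR by blast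
    qed
  qed
  have "w_cl R I = w_cl R (span2 R a b)"
    using key by (auto simp: w_cl_iff[OF R sI] w_cl_iff[OF R submodule_span2[OF sr]])
  then show ?thesis
    unfolding two_w_generated_def span2_def using nz_ideal_frac[OF sr I] by blast
qed

section \<open>Consequences of all ideals being two w-generated\<close>

lemma two_w_generated_loc:
  assumes R: "qdom R" and tw: "\<And>I. nz_ideal R I \<Longrightarrow> two_w_generated R I" and M: "M \<in> t_Max R"
  shows "two_gen_ring (loc R M R)"
  unfolding two_gen_ring_def
proof (intro allI impI)
  note sr = qdom_subring[OF R] and P = t_Max_prime[OF R M]
  let ?A = "loc R M R"
  fix J assume J: "nz_ideal ?A J"
  define I where "I = J \<inter> R"
  have I: "nz_ideal R I" unfolding I_def by (rule nz_ideal_contraction[OF R loc_upper[OF sr P] J])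
  note sI = nz_idealD(1)[OF I]
  obtain a b where ab: "w_cl R I = w_cl R (span2 R a b)" using tw[OF I] unfolding two_w_generated_def span2_def by blast
  \<comment> \<open>Equal w-closures force equal localizations, because the w-closure of
    \<open>Y\<close> lies in every localization of \<open>Y\<close> at a t-maximal ideal.\<close>
  have le: "loc R M X \<subseteq> loc R M Y" if s: "submodule_of R X" "submodule_of R Y" and w: "w_cl R X = w_cl R Y" for X Y
  proof -
    have "X \<subseteq> loc R M Y" using w_cl_extensive[OF R s(1)] w M w_cl_iff[OF R s(2)] by blast
    then show ?thesis
      using loc_mono[of X "loc R M Y" R M] loc_module[OF sr P submodule_loc[OF sr P s(2)]] by simp
  qed
  have "loc R M I = loc R M (span2 R a b)"
    using le[OF sI submodule_span2[OF sr] ab] le[OF submodule_span2[OF sr] sI ab[symmetric]] by blast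
  then have "J = span2 ?A a b"
    using loc_contraction[OF sr P nz_idealD(1,3)[OF J]] loc_span2[OF sr P] unfolding I_def by simp
  then show "\<exists>a b. J = span2 ?A a b" by blast
qed

text \<open>Otherwise \<open>Q\<close> would contain a finite set with trivial inverse over
  \<open>R\<close>. By t-linkedness its inverse over \<open>T\<close> is trivial too, and no proper
  t-ideal contains such a set.\<close>

lemma t_linked_t_Max_contraction:
  assumes R: "qdom R" and tl: "t_linked_overring R T" and Q: "Q \<in> t_Max T"
  shows "\<exists>M\<in>t_Max R. Q \<inter> R \<subseteq> M"
proof (rule ccontr)
  note sr = qdom_subring[OF R]
  have ov: "overring R T" using tl by (simp add: t_linked_overring_def)
  then have RT: "R \<subseteq> T" and srT: "is_subring T" by (auto simp: overring_def)
  have T: "qdom T" by (rule qdom_overring[OF R ov])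
  note tQ = t_MaxD[OF T Q]
  have nz: "nz_ideal R (Q \<inter> R)" by (rule nz_ideal_contraction[OF R RT tQ(2)])
  assume "\<not> ?thesis"
  then obtain S where S: "finite S" "S \<subseteq> Q \<inter> R" "\<not> S \<subseteq> {0}" "1 \<in> v_cl R S"
    using not_subset_t_Max[OF R nz] by blast
  define J where "J = gen R S"
  have JR: "J \<subseteq> R" unfolding J_def using S by (intro gen_least submodule_self sr) auto
  have "nz_ideal R J"
    using nz_frac_ideal_gen[OF R S(1,3)] JR by (simp add: J_def nz_ideal_def ideal_of_def nz_frac_ideal_def)
  moreover have "fin_gen R J" using S(1) by (auto simp: fin_gen_def J_def)
  moreover have "colon R J = R"
  proof
    show "R \<subseteq> colon R J" using JR by (auto simp: colon_def intro: subring_mult[OF sr])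
    show "colon R J \<subseteq> R"
    proof
      fix x assume "x \<in> colon R J"
      then have "s * x \<in> R" if "s \<in> S" for s
        using that gen_superset[of S R] by (auto simp: J_def colon_def mult.commute)
      then show "x \<in> R" by (rule one_v_cl_cancel[OF S(4)])
    qed
  qed
  ultimately have "colon T (gen T J) = T" using tl by (simp add: t_linked_overring_def)
  moreover have "gen T J \<subseteq> gen T S"
    unfolding J_def using gen_superset[of S T] submodule_mono[OF submodule_gen RT] by (intro gen_least submodule_gen)
  ultimately have "colon T S \<subseteq> T" using colon_antimono[of "gen T J" "gen T S" T] colon_gen[OF srT] by simp
  then have "1 \<in> v_cl T S" unfolding v_cl_def colon_def[of T "colon T S"] by auto
  then show False using tQ(3,4) S(1,2) by blast
qed

context
  fixes R :: "'a::field set"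
  assumes R: "qdom R" and tw: "\<And>I. nz_ideal R I \<Longrightarrow> two_w_generated R I"
begin

lemma two_w_generated_v_cl:
  assumes I: "nz_ideal R I" shows "v_cl R I = w_cl R I"
proof
  note sr = qdom_subring[OF R]
  note fI = nz_ideal_frac[OF sr I] and sI = nz_idealD(1)[OF I]
  show "w_cl R I \<subseteq> v_cl R I" by (rule w_cl_subset_v_cl[OF R fI])
  obtain a b where ab: "w_cl R I = w_cl R (span2 R a b)"
    using tw[OF I] unfolding two_w_generated_def span2_def by blast
  show "v_cl R I \<subseteq> w_cl R I"
  proof (cases "t_Max R = {}")
    \<comment> \<open>An empty intersection makes \<open>w_cl R I\<close> the whole field.\<close>
    case True
    then show ?thesis by (simp add: w_cl_def)
  next
    case False
    have nz: "\<not> {a, b} \<subseteq> {0}"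
    proof
      assume "{a, b} \<subseteq> {0}"
      then have z: "span2 R a b \<subseteq> {0}" by (auto simp: span2_def)
      obtain M where M: "M \<in> t_Max R" using False by blast
      obtain p where p: "p \<in> I" "p \<noteq> 0" using nz_idealD(2)[OF I] by blast
      have "p \<in> loc R M (span2 R a b)"
        using p(1) w_cl_extensive[OF R sI] ab M w_cl_iff[OF R submodule_span2[OF sr]] by blast
      then obtain u where "u \<in> R" "u \<notin> M" "u * p \<in> span2 R a b" by (rule locE)
      then show False using z p(2) prime_idealD(6)[OF t_Max_prime[OF R M]] by auto
    qed
    have dL: "divisorial_domain (loc R M R)" if "M \<in> t_Max R" for M
      using two_gen_local_divisorial[OF t_Max_local_ring[OF R that] two_w_generated_loc[OF R tw that]] .
    show ?thesis
    proof (rule v_cl_subset_w_cl_of_finite[OF R dL fI])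
      show "finite {a, b}" by simp
      show "{a, b} \<subseteq> w_cl R I"
        unfolding ab using w_cl_extensive[OF R submodule_span2[OF sr]] span2_gens[OF sr] by blast
      have "nz_frac_ideal R (span2 R a b)" unfolding span2_eq_gen[OF sr] using nz by (intro nz_frac_ideal_gen[OF R]) auto
      then have "w_cl R (span2 R a b) \<subseteq> v_cl R {a, b}" using w_cl_subset_v_cl[OF R] v_cl_span2[OF sr] by blast
      then show "I \<subseteq> v_cl R {a, b}" using w_cl_extensive[OF R sI] ab by blast
    qed
  qed
qed

lemma two_w_generated_w_divisorial: "w_divisorial_domain R"
  using two_w_generated_v_cl by (intro w_divisorial_domainI_ideal[OF R]) simp

text \<open>The union \<open>U\<close> of the chain has the w-closure of two elements. Each of them
  already lies in some \<open>F n\<close>: a finite certificate for membership in \<open>U_w\<close>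
  lives in one member, and divisorial ideals absorb it. From then on the chain is constant.\<close>

lemma two_w_generated_Mori: "Mori R"
  unfolding Mori_def
proof (intro allI impI)
  note sr = qdom_subring[OF R]
  fix F :: "nat \<Rightarrow> 'a set" assume F: "\<forall>n. divisorial_ideal R (F n) \<and> F n \<subset> R \<and> F n \<subseteq> F (Suc n)"
  have fF: "nz_frac_ideal R (F n)" and vF: "v_cl R (F n) = F n" for n using F by (auto simp: divisorial_ideal_def)
  note sF = nz_fracD(1)[OF fF]
  have mono: "F i \<subseteq> F j" if "i \<le> j" for i j using lift_Suc_mono_le[of F, OF _ that] F by blast
  define U where "U = (\<Union>n. F n)"
  have sU: "submodule_of R U"
    unfolding U_def
  proof (rule submodule_Union_directed)
    fix X Y assume "X \<in> range F" "Y \<in> range F"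
    then obtain i j where "X = F i" "Y = F j" by blast
    then show "\<exists>Z\<in>range F. X \<subseteq> Z \<and> Y \<subseteq> Z"
      using mono[of i "max i j"] mono[of j "max i j"] by (intro bexI[of _ "F (max i j)"]) auto
  qed (use sF in auto)
  have UR: "U \<subseteq> R" using F by (auto simp: U_def)
  obtain p where "p \<in> F 0" "p \<noteq> 0" using nz_fracD(2)[OF fF] by blast
  then have U: "nz_ideal R U" using nz_idealI[OF sU UR] by (auto simp: U_def)
  note fU = nz_ideal_frac[OF sr U]
  obtain a b where ab: "w_cl R U = w_cl R (span2 R a b)"
    using tw[OF U] unfolding two_w_generated_def span2_def by blast
  have bounded: "\<exists>n. x \<in> F n" if x: "x \<in> w_cl R U" for x
  proof -
    obtain S where S: "finite S" "1 \<in> v_cl R S" "\<forall>s\<in>S. s * x \<in> U" using w_cl_finite[OF R fU x] by blast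
    have "\<exists>n. \<forall>s\<in>S. s * x \<in> F n"
      using S(1,3)
    proof (induction S)
      case empty then show ?case by simp
    next
      case (insert s S)
      then obtain i j where ij: "\<forall>s\<in>S. s * x \<in> F i" "s * x \<in> F j" by (auto simp: U_def)
      have "F i \<subseteq> F (max i j)" "F j \<subseteq> F (max i j)" by (rule mono, simp)+
      then show ?case using ij by (intro exI[of _ "max i j"]) auto
    qed
    then obtain n where n: "\<forall>s\<in>S. s * x \<in> F n" by blast
    have "x \<in> v_cl R (F n)" by (rule one_v_cl_cancel_v[OF S(2)]) (use n vF in auto)
    then show ?thesis using vF by auto
  qed
  have "a \<in> w_cl R U" "b \<in> w_cl R U"
    unfolding ab using w_cl_extensive[OF R submodule_span2[OF sr]] span2_gens[OF sr] by blast+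
  then obtain i j where "a \<in> F i" "b \<in> F j" using bounded by blast
  then have "a \<in> F (max i j)" "b \<in> F (max i j)" using mono[of i "max i j"] mono[of j "max i j"] by auto
  then have sub: "span2 R a b \<subseteq> F (max i j)" by (intro span2_least sF)
  have "U \<subseteq> F (max i j)"
  proof
    fix x assume "x \<in> U"
    then have x: "x \<in> w_cl R (span2 R a b)" using w_cl_extensive[OF R sU] ab by blast
    then have "x \<in> w_cl R (F (max i j))"
      unfolding w_cl_iff[OF R sF] w_cl_iff[OF R submodule_span2[OF sr]] using loc_mono[OF sub] by blast
    then show "x \<in> F (max i j)" using w_cl_subset_v_cl[OF R fF] vF by blast
  qed
  then have "F n = F (max i j)" if "n \<ge> max i j" for n using mono[OF that] by (auto simp: U_def)
  then show "\<exists>N. \<forall>n\<ge>N. F n = F N" by blast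
qed

text \<open>Take a t-maximal \<open>M\<close> above \<open>P\<close> and a nonzero \<open>a\<close>
  in a prime \<open>Q\<close> below \<open>P\<close>. A power of each \<open>s\<close> in
  \<open>P\<close> falls into \<open>a R_M\<close>, and clearing a denominator outside
  \<open>M\<close> puts \<open>s\<close> into \<open>Q\<close>.\<close>

lemma two_w_generated_t_dimension_one: "t_dimension_one R"
  unfolding t_dimension_one_def
proof (intro allI impI)
  note sr = qdom_subring[OF R]
  fix P assume tP: "t_prime R P"
  then have P: "prime_ideal_of R P" and P0: "P \<noteq> {0}" and tI: "t_ideal R P" by (auto simp: t_prime_def)
  note pP = prime_idealD[OF P]
  have "P \<subset> R" using pP(3,4) subring_one[OF sr] by blast
  then obtain M where M: "M \<in> t_Max R" "P \<subseteq> M" using exists_t_Max[OF R tI] by blast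
  note pM = t_Max_prime[OF R M(1)]
  have od: "one_dim (loc R M R) (loc R M M)"
    by (rule two_gen_local_one_dim[OF t_Max_local_ring[OF R M(1)] two_w_generated_loc[OF R tw M(1)]])
  have min: "P \<subseteq> Q" if Q: "prime_ideal_of R Q" "Q \<noteq> {0}" "Q \<subseteq> P" for Q
  proof
    fix s assume s: "s \<in> P"
    obtain a where a: "a \<in> Q" "a \<noteq> 0" using Q(2) prime_idealD(6)[OF Q(1)] by blast
    have "s \<in> loc R M M" "a \<in> loc R M R"
      using s M(2) a prime_idealD(3)[OF Q(1)] loc_upper[OF sr pM] by blast+
    then obtain k z where k: "s ^ k = a * z" "z \<in> loc R M R" using od a(2) unfolding one_dim_def by blast
    obtain u where u: "u \<in> R" "u \<notin> M" "u * z \<in> R" using k(2) by (rule locE)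
    have sR: "s \<in> R" using s pP by blast
    have "u * s ^ k = (u * z) * a" using k by (simp add: mult_ac)
    then have "u * s ^ k \<in> Q" using submodule_smult[OF prime_idealD(2)[OF Q(1)] u(3) a(1)] by (simp only:)
    then have "s ^ k \<in> Q" using prime_idealD(5)[OF Q(1) u(1) subring_power[OF sr sR]] u(2) Q(3) M(2) by blast
    then show "s \<in> Q" by (rule prime_ideal_power_mem[OF sr Q(1) sR])
  qed
  note z = prime_ideal_zero[OF sr]
  show "height R P = 1"
  proof (rule antisym)
    show "height R P \<le> 1"
      unfolding height_def
    proof (rule Sup_least, clarify)
      fix n :: nat and Q :: "nat \<Rightarrow> 'a set"
      assume Q: "P = Q n" "\<forall>i\<le>n. prime_ideal_of R (Q i)" "\<forall>i<n. Q i \<subset> Q (Suc i)"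
      show "enat n \<le> 1"
      proof (rule ccontr)
        assume "\<not> enat n \<le> 1"
        then have n: "n \<ge> 2" by (simp add: one_enat_def)
        have "Q i \<subset> Q (Suc i)" if "i < n" for i using Q(3) that by blast
        have up: "Q 2 \<subseteq> Q j" if "2 \<le> j" "j \<le> n" for j
          using that
        proof (induction j rule: dec_induct)
          case (step j) then show ?case using Q(3) by (meson Suc_le_lessD less_imp_le psubset_imp_subset subset_trans)
        qed simp
        have "Q 0 \<subset> Q 1" "Q 1 \<subset> Q 2" using Q(3) n by (auto simp: numeral_2_eq_2)
        moreover have "Q 2 \<subseteq> P" using up[of n] n Q(1) by blast
        moreover have "prime_ideal_of R (Q 0)" "prime_ideal_of R (Q 1)" using Q(2) n by auto
        moreover have "Q 1 \<noteq> {0}"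
          using \<open>Q 0 \<subset> Q 1\<close> prime_idealD(6)[OF \<open>prime_ideal_of R (Q 0)\<close>] by (metis empty_iff subset_singletonD psubsetE)
        ultimately show False using min[of "Q 1"] by blast
      qed
    qed
    have "{0} \<subset> P" using P0 pP(6) by blast
    then have "\<exists>Q :: nat \<Rightarrow> 'a set. Q 1 = P \<and> (\<forall>i\<le>1. prime_ideal_of R (Q i)) \<and> (\<forall>i<1. Q i \<subset> Q (Suc i))"
      using z P by (intro exI[of _ "\<lambda>i. if i = 0 then {0} else P"]) auto
    then have "enat 1 \<le> height R P" unfolding height_def by (intro Sup_upper) blast
    then show "1 \<le> height R P" by (simp add: one_enat_def)
  qed
qed

text \<open>Finite character is used over \<open>R\<close> rather than \<open>T\<close>: a nonzero
  \<open>d\<close> in \<open>I \<inter> R\<close> lies in finitely many t-maximal ideals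
  \<open>M\<close> of \<open>R\<close>, and at each the localization of \<open>I\<close> at
  \<open>R - M\<close> has two generators. These and \<open>d\<close> generate \<open>I\<close> up
  to w-closure, as each t-maximal ideal of \<open>T\<close> contracts into one of
  \<open>R\<close>.\<close>

lemma two_w_generated_t_linked:
  assumes tl: "t_linked_overring R T" shows "w_divisorial_domain T"
proof -
  note sr = qdom_subring[OF R]
  have ov: "overring R T" using tl by (simp add: t_linked_overring_def)
  then have RT: "R \<subseteq> T" and srT: "is_subring T" by (auto simp: overring_def)
  have T: "qdom T" by (rule qdom_overring[OF R ov])
  have tgL: "two_gen_ring (loc R M R)" if "M \<in> t_Max R" for M using two_w_generated_loc[OF R tw that] .
  have dL: "divisorial_domain (loc T Q T)" if Q: "Q \<in> t_Max T" for Q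
  proof -
    obtain M where M: "M \<in> t_Max R" "Q \<inter> R \<subseteq> M" using t_linked_t_Max_contraction[OF R tl Q] by blast
    note PQ = t_Max_prime[OF T Q]
    have "loc R M R \<subseteq> loc T Q T"
    proof
      fix x assume "x \<in> loc R M R"
      then obtain u where "u \<in> R" "u \<notin> M" "u * x \<in> R" by (rule locE)
      then show "x \<in> loc T Q T" using M(2) RT by (intro locI[of u]) auto
    qed
    then have "overring (loc R M R) (loc T Q T)" using subring_loc[OF srT PQ] by (simp add: overring_def)
    then have "two_gen_ring (loc T Q T)" using two_gen_overring[OF t_Max_local_ring[OF R M(1)] tgL[OF M(1)]] by blast
    then show ?thesis using two_gen_local_divisorial[OF t_Max_local_ring[OF T Q]] by blast
  qed
  show ?thesis
  proof (rule w_divisorial_domainI_ideal[OF T])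
    fix I assume I: "nz_ideal T I"
    note sI = nz_idealD(1)[OF I] and IT = nz_idealD(3)[OF I] and fI = nz_ideal_frac[OF srT I]
    obtain d where d: "d \<in> I" "d \<in> R" "d \<noteq> 0"
      using submodule_nz_integral[OF R submodule_mono[OF sI RT]] nz_idealD(2)[OF I] by blast
    define G where "G = {M \<in> t_Max R. d \<in> M}"
    have finG: "finite G" unfolding G_def
      by (rule w_divisorial_finite_character[OF R two_w_generated_w_divisorial d(2,3)])
    have "\<exists>x\<in>I. \<exists>y\<in>I. \<forall>z\<in>I. \<exists>u\<in>R - M. u * z \<in> span2 T x y" if M: "M \<in> t_Max R" for M
    proof -
      note P = t_Max_prime[OF R M]
      let ?B = "loc R M T"
      have srB: "is_subring ?B" by (rule subring_loc_overring[OF sr P RT srT])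
      have "overring (loc R M R) ?B" using srB loc_mono[OF RT] by (simp add: overring_def)
      then have tgB: "two_gen_ring ?B" using two_gen_overring[OF t_Max_local_ring[OF R M] tgL[OF M]] by blast
      have "nz_ideal ?B (loc R M I)"
        using d loc_upper[OF sr P, of I] by (intro nz_idealI[of _ _ d] submodule_loc_overring[OF sr P RT] sI loc_mono IT) auto
      then obtain x y where xy: "loc R M I = span2 ?B x y" using tgB by (auto simp: two_gen_ring_def)
      then have "x \<in> loc R M I" "y \<in> loc R M I" using span2_gens[OF srB] by blast+
      then obtain u v where u: "u \<in> R - M" "u * x \<in> I" and v: "v \<in> R - M" "v * y \<in> I" by (auto simp: loc_def)
      have "\<exists>w\<in>R - M. w * z \<in> span2 T (u * x) (v * y)" if z: "z \<in> I" for z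
      proof -
        have "z \<in> span2 ?B x y" using z loc_upper[OF sr P, of I] xy by blast
        then obtain p q where pq: "p \<in> ?B" "q \<in> ?B" "z = x * p + y * q" unfolding span2_def by blast
        obtain r where r: "r \<in> R - M" "r * p \<in> T" using pq(1) by (auto simp: loc_def)
        obtain s where s: "s \<in> R - M" "s * q \<in> T" using pq(2) by (auto simp: loc_def)
        have "(u * v) * (r * s) * z = (u * x) * ((v * s) * (r * p)) + (v * y) * ((u * r) * (s * q))"
          unfolding pq(3) by (simp add: algebra_simps)
        moreover have "(v * s) * (r * p) \<in> T" "(u * r) * (s * q) \<in> T"
          using u v r s RT by (auto intro!: subring_mult[OF srT])
        ultimately have "(u * v) * (r * s) * z \<in> span2 T (u * x) (v * y)" by (intro span2I)
        then show ?thesis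
          by (rule bexI[OF _ prime_ideal_mult[OF sr P prime_ideal_mult[OF sr P u(1) v(1)]
                prime_ideal_mult[OF sr P r(1) s(1)]]])
      qed
      then have *: "\<forall>z\<in>I. \<exists>w\<in>R - M. w * z \<in> span2 T (u * x) (v * y)" by (rule ballI)
      show ?thesis by (rule bexI[OF _ u(2)], rule bexI[OF _ v(2)]) (rule *)
    qed
    then obtain f g where fg: "\<And>M. M \<in> t_Max R \<Longrightarrow>
        f M \<in> I \<and> g M \<in> I \<and> (\<forall>z\<in>I. \<exists>u\<in>R - M. u * z \<in> span2 T (f M) (g M))" by metis
    define S where "S = insert d (f ` G \<union> g ` G)"
    have S: "finite S" "S \<subseteq> I" using finG fg d by (auto simp: S_def G_def)
    have nS: "\<not> S \<subseteq> {0}" using d by (auto simp: S_def)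
    have "I \<subseteq> w_cl T (gen T S)"
      unfolding subset_iff w_cl_iff[OF T submodule_gen]
    proof (intro allI impI ballI)
      fix z Q assume z: "z \<in> I" and Q: "Q \<in> t_Max T"
      obtain M where M: "M \<in> t_Max R" "Q \<inter> R \<subseteq> M" using t_linked_t_Max_contraction[OF R tl Q] by blast
      show "z \<in> loc T Q (gen T S)"
      proof (cases "d \<in> M")
        case True
        then have MG: "M \<in> G" using M by (simp add: G_def)
        obtain u where u: "u \<in> R - M" "u * z \<in> span2 T (f M) (g M)" using fg[OF M(1)] z by blast
        have "span2 T (f M) (g M) \<subseteq> gen T S"
          using MG gen_superset[of S T] by (intro span2_least submodule_gen) (auto simp: S_def)
        then show ?thesis using u M(2) RT by (intro locI[of u]) auto
      next
        case False
        then have "d \<in> T - Q" using M(2) d RT by blast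
        moreover have "d \<in> gen T S" using gen_superset[of S T] by (auto simp: S_def)
        then have "d * z \<in> gen T S" using submodule_smult'[OF submodule_gen] z IT by blast
        ultimately show ?thesis by (rule locI)
      qed
    qed
    also have "w_cl T (gen T S) \<subseteq> v_cl T S"
      using w_cl_subset_v_cl[OF T nz_frac_ideal_gen[OF T S(1) nS]] v_cl_gen[OF srT] by simp
    finally have "I \<subseteq> v_cl T S" .
    then show "v_cl T I \<subseteq> w_cl T I"
      using S w_cl_extensive[OF T sI] by (intro v_cl_subset_w_cl_of_finite[OF T dL fI S(1)]) auto
  qed
qed

end

section \<open>The equivalence of the five conditions\<close>

lemma two_w_generated_of_w_divisorial:
  assumes R: "qdom R" and wd: "w_divisorial_domain R"
    and od: "\<And>M. M \<in> t_Max R \<Longrightarrow> one_dim (loc R M R) (loc R M M)"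
    and dL: "\<And>M. M \<in> t_Max R \<Longrightarrow> divisorial_domain (loc R M R)"
    and ov: "\<And>M T. M \<in> t_Max R \<Longrightarrow> overring (loc R M R) T \<Longrightarrow> w_divisorial_domain T"
    and I: "nz_ideal R I"
  shows "two_w_generated R I"
proof (rule two_w_generated_of_local[OF R _ w_divisorial_finite_character[OF R wd] I])
  fix M assume M: "M \<in> t_Max R"
  show "two_gen_ring (loc R M R)"
    by (rule two_gen_of_w_divisorial_overrings[OF t_Max_local_ring[OF R M] od[OF M] dL[OF M] t_Max_loc_nz[OF R M] ov[OF M]])
qed

lemma divisorial_imp_w_divisorial:
  assumes "qdom D" "divisorial_domain D" shows "w_divisorial_domain D"
  using divisorial_domain_frac[OF qdom_subring[OF assms(1)] assms(2)] w_cl_extensive[OF assms(1) nz_fracD(1)]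
  by (intro w_divisorial_domainI[OF assms(1)]) blast

theorem theorem4p11:
  fixes R :: "'a::field set"
  assumes "domain_with_quotient_field_UNIV R"
    and "R \<noteq> UNIV"
  shows
    "((t_dimension_one R \<and> (\<forall>T. t_linked_overring R T \<longrightarrow> w_divisorial_domain T)) \<longleftrightarrow>
      (Mori R \<and> (\<forall>T. t_linked_overring R T \<longrightarrow> w_divisorial_domain T))) \<and>
     ((Mori R \<and> (\<forall>T. t_linked_overring R T \<longrightarrow> w_divisorial_domain T)) \<longleftrightarrow>
      (Mori R \<and> (\<forall>M\<in>t_Max R. totally_divisorial (localize R M)))) \<and>
     ((Mori R \<and> (\<forall>M\<in>t_Max R. totally_divisorial (localize R M))) \<longleftrightarrow>
      (\<forall>I. nz_ideal R I \<longrightarrow> two_w_generated R I \<and> w_divisorial_ideal R I)) \<and>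
     ((\<forall>I. nz_ideal R I \<longrightarrow> two_w_generated R I \<and> w_divisorial_ideal R I) \<longleftrightarrow>
      (\<forall>I. nz_ideal R I \<longrightarrow> two_w_generated R I))"
proof -
  note R = assms(1)
  note sr = qdom_subring[OF R]
  let ?L = "\<forall>T. t_linked_overring R T \<longrightarrow> w_divisorial_domain T"
  let ?TD = "\<forall>M\<in>t_Max R. totally_divisorial (localize R M)"
  let ?four = "\<forall>I. nz_ideal R I \<longrightarrow> two_w_generated R I \<and> w_divisorial_ideal R I"
  let ?five = "\<forall>I. nz_ideal R I \<longrightarrow> two_w_generated R I"
  have locR: "localize R M = loc R M R" if "M \<in> t_Max R" for M
    using localize_eq_loc[OF t_Max_prime[OF R that]] .
  \<comment> \<open>\<open>R\<close> and all overrings of its localizations \<open>R_M\<close> are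
    t-linked over \<open>R\<close>, so the hypothesis covers them.\<close>
  have linked: "w_divisorial_domain R"
    "\<And>M T. M \<in> t_Max R \<Longrightarrow> overring (loc R M R) T \<Longrightarrow> w_divisorial_domain T"
    "\<And>M. M \<in> t_Max R \<Longrightarrow> divisorial_domain (loc R M R)" if L: ?L
  proof -
    show wd: "w_divisorial_domain R" using L t_linked_overring_self[OF sr] by blast
    show ov: "w_divisorial_domain T" if "M \<in> t_Max R" "overring (loc R M R) T" for M T
      using L t_linked_overring_loc[OF R that] by blast
    show "divisorial_domain (loc R M R)" if M: "M \<in> t_Max R" for M
      using ov[OF M] subring_loc[OF sr t_Max_prime[OF R M]]
      by (intro t_Max_loc_divisorial[OF R M wd]) (simp add: overring_def)
  qed
  have 15: ?five if "t_dimension_one R" ?L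
  proof (intro allI impI)
    fix I assume I: "nz_ideal R I"
    show "two_w_generated R I"
      by (rule two_w_generated_of_w_divisorial[OF R linked(1)[OF that(2)] _ _ _ I])
        (fact t_dimension_one_loc[OF R that(1)] linked(2)[OF that(2)] linked(3)[OF that(2)])+
  qed
  have 25: ?five if "Mori R" ?L
  proof (intro allI impI)
    fix I assume I: "nz_ideal R I"
    have od: "one_dim (loc R M R) (loc R M M)" if "M \<in> t_Max R" for M
      by (rule Mori_one_dim[OF R \<open>Mori R\<close> that linked(3)[OF \<open>?L\<close> that]])
    show "two_w_generated R I"
      by (rule two_w_generated_of_w_divisorial[OF R linked(1)[OF that(2)] _ _ _ I])
        (fact od linked(2)[OF that(2)] linked(3)[OF that(2)])+
  qed
  have 35: ?five if mori: "Mori R" and TD: ?TD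
  proof -
    have ov: "divisorial_domain T" if "M \<in> t_Max R" "overring (loc R M R) T" for M T
      using TD that locR by (auto simp: totally_divisorial_def)
    have dL: "divisorial_domain (loc R M R)" if M: "M \<in> t_Max R" for M
      using ov[OF M] subring_loc[OF sr t_Max_prime[OF R M]] by (simp add: overring_def)
    have wov: "w_divisorial_domain T" if M: "M \<in> t_Max R" and T: "overring (loc R M R) T" for M T
      using divisorial_imp_w_divisorial[OF qdom_overring[OF local_ringD(1)[OF t_Max_local_ring[OF R M]] T] ov[OF M T]] .
    \<comment> \<open>Under (3) w-divisoriality of \<open>R\<close> itself comes from the Mori
      property together with local divisoriality.\<close>
    have wd: "w_divisorial_domain R" by (rule Mori_w_divisorial[OF R mori dL])
    show ?thesis
    proof (intro allI impI)
      fix I assume I: "nz_ideal R I"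
      have od: "one_dim (loc R M R) (loc R M M)" if "M \<in> t_Max R" for M
        by (rule Mori_one_dim[OF R mori that dL[OF that]])
      show "two_w_generated R I"
        by (rule two_w_generated_of_w_divisorial[OF R wd _ _ _ I]) (fact od dL wov)+
    qed
  qed
  have from5: "t_dimension_one R" "Mori R" ?L ?TD ?four if five: ?five
  proof -
    have tw: "two_w_generated R I" if "nz_ideal R I" for I using five that by blast
    show "t_dimension_one R" by (rule two_w_generated_t_dimension_one[OF R tw])
    show "Mori R" by (rule two_w_generated_Mori[OF R tw])
    show ?L using two_w_generated_t_linked[OF R tw] by blast
    show ?TD
      using two_gen_totally_divisorial[OF t_Max_local_ring[OF R] two_w_generated_loc[OF R tw]] locR by auto
    show ?four
      using tw two_w_generated_v_cl[OF R tw] nz_ideal_frac[OF sr] by (auto simp: w_divisorial_ideal_def)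
  qed
  have 45: ?five if ?four using that by blast
  show ?thesis using 15 25 35 45 from5 by blast
qed

end
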